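(* Let $\varepsilon\in[0,1]$ and $2\leq m\leq n$. Let $Z_1,\ldots,Z_m$ be zonoids in $\mathbb{R}^n$, and let $\alpha_1,\ldots,\alpha_m\geq 1$ be integers with $\alpha_1+\cdots+\alpha_m=n$. If $$ 0<V_{\alpha_1}(Z_1)\cdots V_{\alpha_m}(Z_m)\le (1+\varepsilon) \binom{n}{\alpha_1,\ldots,\alpha_m} V(Z_1[\alpha_1],\ldots,Z_m[\alpha_m]), $$ then there exist linear subspaces $L_i\subset\mathbb{R}^n$ with $\dim(L_i)=\alpha_i$, $i=1,\ldots,m$, such that $$[L_1,\ldots,L_m]\geq 1-n^{10}2^{\frac{n}{2}}\sqrt{\varepsilon} $$ and $$ Z_i\subset Z_i|L_i+n^{\frac{9}{2}}2^{\frac{n}{2}}r_{\alpha_i}(Z_i)\sqrt{\varepsilon}\,B^n\quad\text{for } i=1,\ldots,m. $$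
   Context: $V(K_1,\ldots,K_n)$ denotes the mixed volume of (non-empty) compact convex sets in $\mathbb{R}^n$, normalized so that $V(K,\ldots,K)$ is the $n$-dimensional volume of $K$; $K[\alpha]$ inside a mixed volume means that $K$ is repeated $\alpha$ times. $B^n$ is the Euclidean unit ball of $\mathbb{R}^n$, and $\kappa_j=\pi^{j/2}/\Gamma(\frac j2+1)$ is the volume of the $j$-dimensional unit ball. The intrinsic volumes are $V_i(K)=\frac{\binom ni}{\kappa_{n-i}}V(K[i],B^n[n-i])$, $i=0,\ldots,n$. $\binom{n}{\alpha_1,\ldots,\alpha_m}=\frac{n!}{\alpha_1!\cdots \alpha_m!}$. A zonoid is a compact convex set $Z\subset\mathbb{R}^n$ for which there is a non-trivial finite even Borel measure $\varrho$ on the unit sphere $\mathbb{S}^{n-1}$ such that the support function satisfies $h(Z,u)=\max_{x\in Z}\langle x,u\rangle=\int_{\mathbb{S}^{n-1}}|\langle u,v\rangle|\,\varrho(dv)$ for all $u\in\mathbb{R}^n$ (so zonoids are centred at the origin). $K|L$ is the orthogonal projection of $K$ onto the subspace $L$. $r_i(K)$ is the largest radius of an $i$-dimensional ball contained in $K$ (equal to $0$ if $\dim K<i$). For linear subspaces $L_1,\ldots,L_m$ of $\mathbb{R}^n$ with $\dim(L_i)=\alpha_i$ and $\alpha_1+\cdots+\alpha_m=n$, the bracket is $[L_1,\ldots,L_m]=|\det(u_1,\ldots,u_n)|$, where $u_1,\ldots,u_{\alpha_1}$ is an orthonormal basis of $L_1$, the next $\alpha_2$ vectors form an orthonormal basis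 of $L_2$, and so on, the last $\alpha_m$ vectors $u_{n-\alpha_m+1},\ldots,u_n$ forming an orthonormal basis of $L_m$. Sums of sets are Minkowski sums. *)

theory Defs
  imports "HOL-Analysis.Analysis"
begin

section \<open>Convex bodies, mixed volumes and intrinsic volumes\<close>

definition convex_body :: "(real^'n) set \<Rightarrow> bool" where
  "convex_body K \<longleftrightarrow> K \<noteq> {} \<and> compact K \<and> convex K"

definition support_function :: "(real^'n) set \<Rightarrow> real^'n \<Rightarrow> real" where
  "support_function K u = (SUP x\<in>K. x \<bullet> u)"

text \<open>
  The mixed volume of a list of \<^term>\<open>CARD('n)\<close> convex bodies, by the polarization formula
  \[ n!\,V(K_1,\dots,K_n) = \sum_{S \subseteq [n]} (-1)^{n-|S|}\, vol(\sum_{i \in S} K_i). \]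
  Addition of sets is Minkowski addition (from \<^theory>\<open>HOL-Library.Set_Algebras\<close>); the summand
  for the empty \<open>S\<close> is the volume of \<open>{0}\<close>, that is, zero. Lemma
  \<open>mixed_volume_eqI\<close> below shows that this is the only possible symmetric coefficient
  functional in Minkowski's expansion of the volume of \<open>\<lambda>\<^sub>1 K\<^sub>1 + \<dots> + \<lambda>\<^sub>n K\<^sub>n\<close>,
  and \<open>mixed_volume_replicate\<close> gives the normalization.
\<close>

definition mixed_volume :: "(real^'n) set list \<Rightarrow> real" where
  "mixed_volume Ks =
     (\<Sum>S\<in>Pow {..<CARD('n)}. (-1) ^ (CARD('n) - card S) * measure lborel (\<Sum>i\<in>S. Ks ! i))
       / fact CARD('n)"

definition intrinsic_volume :: "nat \<Rightarrow> (real^'n) set \<Rightarrow> real" where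
  "intrinsic_volume i K =
     real (CARD('n) choose i) / unit_ball_vol (real (CARD('n) - i))
       * mixed_volume (replicate i K @ replicate (CARD('n) - i) (cball 0 1))"

lemma sum_indicator_scaled_sets:
  fixes Ks :: "nat \<Rightarrow> (real^'n) set"
  assumes "finite N" "S \<subseteq> N" "\<And>i. i \<in> N \<Longrightarrow> Ks i \<noteq> {}"
  shows "(\<Sum>i\<in>N. (\<lambda>x. indicat_real S i *\<^sub>R x) ` Ks i) = (\<Sum>i\<in>S. Ks i)"
proof -
  have "(\<lambda>x. indicat_real S i *\<^sub>R x) ` Ks i = (if i \<in> S then Ks i else 0)" if "i \<in> N" for i
    using assms(3)[OF that] by (auto simp: indicator_def)
  then have "(\<Sum>i\<in>N. (\<lambda>x. indicat_real S i *\<^sub>R x) ` Ks i) = (\<Sum>i\<in>N. if i \<in> S then Ks i else 0)"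
    by (rule sum.cong[OF refl])
  also have "\<dots> = (\<Sum>i\<in>S. Ks i)"
    by (rule sum.mono_neutral_cong_right) (use assms in auto)
  finally show ?thesis .
qed

lemma mixed_volume_eqI:
  fixes Ks :: "(real^'n) set list" and V :: "(real^'n) set list \<Rightarrow> real"
  assumes len: "length Ks = CARD('n)" and ne: "{} \<notin> set Ks"
    and sym: "\<And>Ls Ms. mset Ls = mset Ms \<Longrightarrow> V Ls = V Ms"
    and expansion: "\<And>c. (\<And>i. 0 \<le> c i) \<Longrightarrow>
      measure lborel (\<Sum>i<CARD('n). (\<lambda>x. c i *\<^sub>R x) ` (Ks ! i)) =
      (\<Sum>f\<in>{..<CARD('n)} \<rightarrow>\<^sub>E {..<CARD('n)}.
         (\<Prod>k<CARD('n). c (f k)) * V (map (\<lambda>k. Ks ! f k) [0..<CARD('n)]))"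
  shows "mixed_volume Ks = V Ks"
proof -
  define n where "n = CARD('n)"
  define W where "W f = V (map (\<lambda>k. Ks ! f k) [0..<n])" for f :: "nat \<Rightarrow> nat"
  define F where "F = ({..<n} \<rightarrow>\<^sub>E {..<n})"
  define h where "h U = (\<Sum>f\<in>{f\<in>F. f ` {..<n} = U}. W f)" for U
  have ne': "Ks ! i \<noteq> {}" if "i < n" for i
    using ne len that by (metis n_def nth_mem)
  have finF: "finite F" by (auto simp: F_def intro: finite_PiE)
  have vol: "measure lborel (\<Sum>i\<in>S. Ks ! i) = sum h (Pow S)" if "S \<subseteq> {..<n}" for S
  proof -
    have "measure lborel (\<Sum>i\<in>S. Ks ! i)
        = measure lborel (\<Sum>i<n. (\<lambda>x. indicat_real S i *\<^sub>R x) ` (Ks ! i))"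
      using that ne' by (subst sum_indicator_scaled_sets) auto
    also have "\<dots> = (\<Sum>f\<in>F. (\<Prod>k<n. indicat_real S (f k)) * W f)"
      unfolding n_def F_def W_def by (rule expansion) auto
    also have "\<dots> = (\<Sum>f\<in>F. if f ` {..<n} \<subseteq> S then W f else 0)"
      by (intro sum.cong refl) (auto simp: indicator_def image_subset_iff intro!: prod.neutral)
    also have "\<dots> = sum W {f\<in>F. f ` {..<n} \<subseteq> S}"
      by (rule sum.inter_filter[OF finF, symmetric])
    also have "\<dots> = (\<Sum>U\<in>Pow S. \<Sum>f\<in>{g\<in>{f\<in>F. f ` {..<n} \<subseteq> S}. g ` {..<n} = U}. W f)"
      using finF that finite_subset[of S] by (intro sum.group[symmetric]) auto
    also have "\<dots> = sum h (Pow S)"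
      unfolding h_def by (intro sum.cong refl) auto
    finally show ?thesis .
  qed
  have "(\<Sum>S\<in>Pow {..<n}. (-1) ^ (n - card S) * measure lborel (\<Sum>i\<in>S. Ks ! i))
      = (\<Sum>S\<in>Pow {..<n}. (-1) ^ (card {..<n} - card S) * sum h (Pow S))"
    by (intro sum.cong refl) (auto simp: vol)
  also have "\<dots> = h {..<n}"
    by (rule inclusion_exclusion_mobius[symmetric]) auto
  also have "\<dots> = (\<Sum>f\<in>{f\<in>F. f ` {..<n} = {..<n}}. V Ks)"
    unfolding h_def
  proof (intro sum.cong refl)
    fix f assume "f \<in> {f\<in>F. f ` {..<n} = {..<n}}"
    then have bij: "bij_betw f {..<n} {..<n}"
      by (simp add: bij_betw_def finite_surj_inj)
    have "mset (map (\<lambda>k. Ks ! f k) [0..<n]) = image_mset (\<lambda>k. Ks ! k) (image_mset f (mset_set {..<n}))"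
      by (simp add: lessThan_atLeast0 image_mset.compositionality o_def)
    also have "image_mset f (mset_set {..<n}) = mset_set {..<n}"
      using bij by (simp add: image_mset_mset_set bij_betw_def)
    also have "image_mset (\<lambda>k. Ks ! k) (mset_set {..<n}) = mset (map ((!) Ks) [0..<n])"
      by (simp add: lessThan_atLeast0)
    also have "map ((!) Ks) [0..<n] = Ks"
      using len map_nth[of Ks] by (simp add: n_def)
    finally show "W f = V Ks" unfolding W_def by (rule sym)
  qed
  also have "\<dots> = card {f\<in>F. f ` {..<n} = {..<n}} * V Ks" by simp
  also have "card {f\<in>F. f ` {..<n} = {..<n}} = fact n"
  proof -
    have "bij_betw (\<lambda>p. restrict p {..<n}) {p. p permutes {..<n}} {f\<in>F. f ` {..<n} = {..<n}}"
    proof (rule bij_betwI[where g = "\<lambda>f x. if x < n then f x else x"])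
      show "(\<lambda>p. restrict p {..<n}) \<in> {p. p permutes {..<n}} \<rightarrow> {f\<in>F. f ` {..<n} = {..<n}}"
      proof
        fix p assume "p \<in> {p. p permutes {..<n}}"
        then have p: "p ` {..<n} = {..<n}" by (simp add: permutes_image)
        have "restrict p {..<n} ` {..<n} = p ` {..<n}" by (rule image_cong) auto
        with p have "restrict p {..<n} ` {..<n} = {..<n}" by (rule trans[rotated])
        moreover have "restrict p {..<n} \<in> F"
          unfolding F_def by (rule restrict_PiE_iff[THEN iffD2]) (use p in blast)
        ultimately show "restrict p {..<n} \<in> {f\<in>F. f ` {..<n} = {..<n}}" by simp
      qed
      show "(\<lambda>f x. if x < n then f x else x) \<in> {f\<in>F. f ` {..<n} = {..<n}} \<rightarrow> {p. p permutes {..<n}}"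
      proof
        fix f assume "f \<in> {f\<in>F. f ` {..<n} = {..<n}}"
        then have "bij_betw f {..<n} {..<n}"
          by (simp add: bij_betw_def finite_surj_inj)
        then have bij: "bij_betw (\<lambda>x. if x < n then f x else x) {..<n} {..<n}"
          by (subst bij_betw_cong[where g=f]) auto
        show "(\<lambda>x. if x < n then f x else x) \<in> {p. p permutes {..<n}}"
          by (rule CollectI, rule bij_imp_permutes[OF bij]) simp
      qed
      show "(\<lambda>x. if x < n then restrict p {..<n} x else x) = p" if "p \<in> {p. p permutes {..<n}}" for p
        using that by (auto simp: permutes_def fun_eq_iff)
      show "restrict (\<lambda>x. if x < n then f x else x) {..<n} = f" if "f \<in> {f\<in>F. f ` {..<n} = {..<n}}" for f
        using that by (auto simp: F_def fun_eq_iff PiE_def extensional_def)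
    qed
    then have "card {f\<in>F. f ` {..<n} = {..<n}} = card {p. p permutes {..<n}}"
      by (simp add: bij_betw_same_card)
    also have "\<dots> = fact n" by (rule card_permutations) auto
    finally show ?thesis .
  qed
  finally show ?thesis
    unfolding mixed_volume_def by (simp add: n_def)
qed

lemma sum_scaled_convex_set:
  fixes K :: "(real^'n) set"
  assumes "convex K" "K \<noteq> {}" "finite A" "\<And>i. i \<in> A \<Longrightarrow> 0 \<le> c i"
  shows "(\<Sum>i\<in>A. (\<lambda>x. c i *\<^sub>R x) ` K) = (\<lambda>x. (\<Sum>i\<in>A. c i) *\<^sub>R x) ` K"
  using assms(3,4)
proof (induction A rule: finite_induct)
  case empty
  then show ?case using assms(2) by auto
next
  case (insert a A)
  define s where "s = (\<Sum>i\<in>A. c i)"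
  have nn: "0 \<le> c a" "0 \<le> s" using insert.prems by (auto simp: s_def intro: sum_nonneg)
  have "(\<lambda>x. c a *\<^sub>R x) ` K + (\<lambda>x. s *\<^sub>R x) ` K = (\<lambda>x. (c a + s) *\<^sub>R x) ` K"
  proof
    show "(\<lambda>x. c a *\<^sub>R x) ` K + (\<lambda>x. s *\<^sub>R x) ` K \<subseteq> (\<lambda>x. (c a + s) *\<^sub>R x) ` K"
    proof
      fix z assume "z \<in> (\<lambda>x. c a *\<^sub>R x) ` K + (\<lambda>x. s *\<^sub>R x) ` K"
      then obtain x y where xy: "x \<in> K" "y \<in> K" "z = c a *\<^sub>R x + s *\<^sub>R y"
        by (auto simp: set_plus_def)
      show "z \<in> (\<lambda>x. (c a + s) *\<^sub>R x) ` K"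
      proof (cases "c a + s = 0")
        case True
        then have "c a = 0" "s = 0" using nn by auto
        then show ?thesis using xy by auto
      next
        case False
        then have pos: "c a + s > 0" using nn by auto
        have "(c a / (c a + s)) *\<^sub>R x + (s / (c a + s)) *\<^sub>R y \<in> K"
          using assms(1) xy nn pos by (intro convexD) (auto simp: add_divide_distrib[symmetric])
        moreover have "z = (c a + s) *\<^sub>R ((c a / (c a + s)) *\<^sub>R x + (s / (c a + s)) *\<^sub>R y)"
          using pos xy by (simp add: scaleR_add_right)
        ultimately show ?thesis by blast
      qed
    qed
    show "(\<lambda>x. (c a + s) *\<^sub>R x) ` K \<subseteq> (\<lambda>x. c a *\<^sub>R x) ` K + (\<lambda>x. s *\<^sub>R x) ` K"
      by (auto simp: set_plus_def scaleR_add_left)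
  qed
  then show ?case using insert by (simp add: s_def)
qed

lemma mixed_volume_replicate:
  fixes K :: "(real^'n) set"
  assumes "convex_body K"
  shows "mixed_volume (replicate CARD('n) K) = measure lborel K"
proof -
  define n where "n = CARD('n)"
  define V :: "(real^'n) set list \<Rightarrow> real" where "V Ls = measure lborel K" for Ls
  have K: "K \<noteq> {}" "compact K" "convex K" using assms by (auto simp: convex_body_def)
  have "mixed_volume (replicate n K) = V (replicate n K)"
    unfolding n_def
  proof (rule mixed_volume_eqI)
    fix c :: "nat \<Rightarrow> real" assume c: "\<And>i. 0 \<le> c i"
    define s where "s = (\<Sum>i<n. c i)"
    have s: "0 \<le> s" using c by (auto simp: s_def intro: sum_nonneg)
    have "(\<Sum>i<n. (\<lambda>x. c i *\<^sub>R x) ` (replicate n K ! i)) = (\<Sum>i<n. (\<lambda>x. c i *\<^sub>R x) ` K)"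
      by (intro sum.cong) auto
    also have "\<dots> = (\<lambda>x. s *\<^sub>R x) ` K"
      unfolding s_def using K c by (intro sum_scaled_convex_set) auto
    finally have "measure lborel (\<Sum>i<n. (\<lambda>x. c i *\<^sub>R x) ` (replicate n K ! i))
        = measure lborel ((\<lambda>x. s *\<^sub>R x) ` K)" by simp
    also have "\<dots> = measure lebesgue ((\<lambda>x. s *\<^sub>R x) ` K)"
      using K by (intro measure_completion[symmetric]) (auto intro!: borel_compact compact_scaling)
    also have "\<dots> = s ^ n * measure lebesgue K"
      using measure_lebesgue_affine[of s 0 K] s by (simp add: n_def)
    also have "measure lebesgue K = measure lborel K"
      using K by (intro measure_completion) (auto intro!: borel_compact)
    also have "s ^ n = (\<Prod>k<n. \<Sum>i<n. c i)" by (simp add: s_def)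
    also have "\<dots> = (\<Sum>f\<in>{..<n} \<rightarrow>\<^sub>E {..<n}. \<Prod>k<n. c (f k))"
      by (rule prod_sum_PiE) auto
    finally show "measure lborel (\<Sum>i<CARD('n). (\<lambda>x. c i *\<^sub>R x) ` (replicate CARD('n) K ! i)) =
      (\<Sum>f\<in>{..<CARD('n)} \<rightarrow>\<^sub>E {..<CARD('n)}.
         (\<Prod>k<CARD('n). c (f k)) * V (map (\<lambda>k. replicate CARD('n) K ! f k) [0..<CARD('n)]))"
      by (simp add: n_def V_def sum_distrib_right)
  qed (use K in \<open>auto simp: V_def\<close>)
  then show ?thesis by (simp add: n_def V_def)
qed


section \<open>Zonoids\<close>

definition zonoid :: "(real^'n) set \<Rightarrow> bool" where
  "zonoid Z \<longleftrightarrow> convex_body Z \<and>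
     (\<exists>\<rho> :: (real^'n) measure.
        finite_measure \<rho> \<and>
        sets \<rho> = sets (restrict_space borel (sphere 0 1)) \<and>
        emeasure \<rho> (sphere 0 1) \<noteq> 0 \<and>
        (\<forall>A\<in>sets \<rho>. emeasure \<rho> (uminus ` A) = emeasure \<rho> A) \<and>
        (\<forall>u. support_function Z u = (\<integral>v. \<bar>u \<bullet> v\<bar> \<partial>\<rho>)))"


section \<open>Projections, inradii and brackets\<close>

definition orth_proj :: "(real^'n) set \<Rightarrow> real^'n \<Rightarrow> real^'n" where
  "orth_proj L x = (THE y. y \<in> L \<and> (\<forall>z\<in>L. orthogonal (x - y) z))"

lemma orth_proj_eqI:
  assumes "subspace L" "y \<in> L" "\<And>z. z \<in> L \<Longrightarrow> orthogonal (x - y) z"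
  shows "orth_proj L x = y"
  unfolding orth_proj_def
proof (rule the_equality)
  fix y' assume y': "y' \<in> L \<and> (\<forall>z\<in>L. orthogonal (x - y') z)"
  have d: "y - y' \<in> L" using assms y' by (simp add: subspace_diff)
  have "(x - y') \<bullet> (y - y') = 0" "(x - y) \<bullet> (y - y') = 0"
    using assms y' d by (auto simp: orthogonal_def)
  then have "(y - y') \<bullet> (y - y') = 0" by (simp add: inner_diff_left)
  then show "y' = y" by simp
qed (use assms in auto)

text \<open>
  Degenerate balls of radius \<open>0\<close> are admitted, so that the supremum is \<open>0\<close> if the
  non-empty compact set \<open>K\<close> has dimension less than \<open>i\<close>. For \<open>1 \<le> i \<le> CARD('n)\<close>
  the supremum is attained. The ball is translated: it need not be centred at the origin.
\<close>

definition inradius :: "nat \<Rightarrow> (real^'n) set \<Rightarrow> real" where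
  "inradius i K =
     Sup {r. 0 \<le> r \<and> (\<exists>c L. subspace L \<and> dim L = i \<and> (\<lambda>x. c + x) ` (L \<inter> cball 0 r) \<subseteq> K)}"

text \<open>
  A frame adapted to \<open>L\<^sub>1, \<dots>, L\<^sub>m\<close> is a family of vectors labelled by the coordinate
  type \<open>'n\<close>, together with a labelling \<open>b\<close> of these vectors by blocks, so that the
  vectors of block \<open>i\<close> form an orthonormal basis of \<open>L\<^sub>i\<close>. Listing the vectors block by
  block would only permute the rows of the determinant, which does not affect its absolute value.
\<close>

definition adapted_frame ::
    "nat \<Rightarrow> (nat \<Rightarrow> (real^'n) set) \<Rightarrow> ('n \<Rightarrow> nat) \<Rightarrow> ('n \<Rightarrow> real^'n) \<Rightarrow> bool" where
  "adapted_frame m L b u \<longleftrightarrow>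
     (\<forall>k. b k \<in> {1..m}) \<and>
     (\<forall>k l. b k = b l \<longrightarrow> u k \<bullet> u l = (if k = l then 1 else 0)) \<and>
     (\<forall>i\<in>{1..m}. span (u ` {k. b k = i}) = L i)"

text \<open>By \<open>bracket_eq\<close> and \<open>adapted_frame_exists\<close> below, the choice of the frame does not
  matter, and frames exist for subspaces whose dimensions add up to \<open>CARD('n)\<close>.\<close>

definition bracket :: "nat \<Rightarrow> (nat \<Rightarrow> (real^'n) set) \<Rightarrow> real" where
  "bracket m L = (SOME r. \<exists>b u. adapted_frame m L b u \<and> r = \<bar>det (\<chi> k. u k)\<bar>)"

lemma adapted_frame_card:
  assumes "adapted_frame m L b u" "i \<in> {1..m}"
  shows "card {k. b k = i} = dim (L i)"
proof -
  let ?B = "u ` {k. b k = i}"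
  have on: "u k \<bullet> u l = (if k = l then 1 else 0)" if "b k = i" "b l = i" for k l
    using assms that by (auto simp: adapted_frame_def)
  have inj: "inj_on u {k. b k = i}"
    by (rule inj_onI) (metis (mono_tags) mem_Collect_eq on zero_neq_one)
  have "pairwise orthogonal ?B"
    by (auto simp: pairwise_def orthogonal_def on)
  moreover have "0 \<notin> ?B" using on by (metis (mono_tags) imageE inner_zero_left mem_Collect_eq zero_neq_one)
  ultimately have "independent ?B" by (rule pairwise_orthogonal_independent)
  then have "dim (span ?B) = card ?B" by (simp add: dim_eq_card_independent)
  moreover have "span ?B = L i" using assms by (simp add: adapted_frame_def)
  ultimately show ?thesis using inj by (simp add: card_image)
qed

lemma adapted_frame_expand:
  assumes fr: "adapted_frame m L b u" and i: "i \<in> {1..m}" and x: "x \<in> L i"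
  shows "x = (\<Sum>k | b k = i. (x \<bullet> u k) *\<^sub>R u k)"
proof -
  have on: "u k \<bullet> u l = (if k = l then 1 else 0)" if "b k = i" "b l = i" for k l
    using fr that by (auto simp: adapted_frame_def)
  have inj: "inj_on u {k. b k = i}"
    by (rule inj_onI) (metis (mono_tags) mem_Collect_eq on zero_neq_one)
  have "(\<Sum>v\<in>u ` {k. b k = i}. (x \<bullet> v) *\<^sub>R v) = x"
  proof (rule orthonormal_basis_expand)
    show "x \<in> span (u ` {k. b k = i})" using fr i x by (simp add: adapted_frame_def)
  qed (auto simp: pairwise_def orthogonal_def on norm_eq_1)
  then show ?thesis using inj by (simp add: sum.reindex)
qed

lemma adapted_frame_abs_det_unique:
  fixes u u' :: "'n \<Rightarrow> real^'n"
  assumes fr: "adapted_frame m L b u" and fr': "adapted_frame m L b' u'"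
  shows "\<bar>det (\<chi> k. u' k)\<bar> = \<bar>det (\<chi> k. u k)\<bar>"
proof -
  have rng: "b k \<in> {1..m}" "b' k \<in> {1..m}" for k
    using fr fr' by (auto simp: adapted_frame_def)
  have "\<exists>q. bij_betw q {k. b k = i} {k. b' k = i}" if "i \<in> {1..m}" for i
    using adapted_frame_card[OF fr that] adapted_frame_card[OF fr' that]
    by (intro finite_same_card_bij) auto
  then obtain q where q: "\<And>i. i \<in> {1..m} \<Longrightarrow> bij_betw (q i) {k. b k = i} {k. b' k = i}"
    by metis
  define p where "p k = q (b k) k" for k
  have bp: "b' (p k) = b k" for k
    using bij_betwE[OF q[OF rng(1)[of k]]] by (auto simp: p_def)
  have "inj p"
  proof (rule injI)
    fix k l assume e: "p k = p l"
    then have "b k = b l" by (metis bp)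
    then show "k = l" using e q[OF rng(1)[of k]] by (auto simp: p_def bij_betw_def dest: inj_onD)
  qed
  then have perm: "p permutes UNIV"
    by (auto intro!: bij_imp_permutes simp: bij_betw_def finite_UNIV_inj_surj)
  define w where "w k = u' (p k)" for k
  have wL: "w k \<in> L (b k)" for k
    using fr' rng(1)[of k] bp by (force simp: adapted_frame_def w_def intro: span_base)
  have on: "w k \<bullet> w l = (if k = l then 1 else 0)" if "b k = b l" for k l
    using fr' that \<open>inj p\<close> by (simp add: adapted_frame_def w_def bp inj_eq)
  define Q :: "real^'n^'n" where "Q = (\<chi> k l. if b l = b k then w k \<bullet> u l else 0)"
  have expand: "w k = (\<Sum>l | b l = b k. (w k \<bullet> u l) *\<^sub>R u l)" for k
    by (rule adapted_frame_expand[OF fr rng(1) wL])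
  have "(\<chi> k. w k) = Q ** (\<chi> k. u k)"
  proof (simp add: vec_eq_iff matrix_matrix_mult_def, intro allI)
    fix k j
    have "w k $ j = (\<Sum>l | b l = b k. (w k \<bullet> u l) * u l $ j)"
      by (subst expand) simp
    also have "\<dots> = (\<Sum>l\<in>UNIV. Q $ k $ l * u l $ j)"
      by (intro sum.mono_neutral_cong_left) (auto simp: Q_def)
    finally show "w k $ j = (\<Sum>l\<in>UNIV. Q $ k $ l * u l $ j)" .
  qed
  moreover have "orthogonal_matrix Q"
  proof -
    have "row k Q \<bullet> row l Q = (if k = l then 1 else 0)" for k l
    proof (cases "b k = b l")
      case True
      have "w k \<bullet> w l = (\<Sum>j | b j = b k. (w k \<bullet> u j) * (w l \<bullet> u j))"
        by (subst expand[of k]) (simp add: inner_sum_left inner_commute[of "u _"])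
      also have "\<dots> = row k Q \<bullet> row l Q"
        unfolding inner_vec_def[of "row k Q"] using True
        by (intro sum.mono_neutral_cong_left) (auto simp: Q_def row_def)
      finally show ?thesis using on[OF True] by simp
    next
      case False
      then have "row k Q \<bullet> row l Q = 0"
        unfolding inner_vec_def[of "row k Q"] by (intro sum.neutral) (auto simp: Q_def row_def)
      then show ?thesis using False by auto
    qed
    then show ?thesis
      by (auto simp: orthogonal_matrix_orthonormal_rows norm_eq_1 orthogonal_def)
  qed
  ultimately have "\<bar>det (\<chi> k. w k)\<bar> = \<bar>det (\<chi> k. u k)\<bar>"
    using det_orthogonal_matrix[of Q] by (auto simp: det_mul abs_mult)
  moreover have "\<bar>det (\<chi> k. w k)\<bar> = \<bar>det (\<chi> k. u' k)\<bar>"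
    using det_permute_rows[OF perm, of "\<chi> k. u' k"] by (simp add: w_def abs_mult sign_def)
  ultimately show ?thesis by simp
qed

lemma bracket_eq:
  assumes "adapted_frame m L b u"
  shows "bracket m L = \<bar>det (\<chi> k. u k)\<bar>"
  unfolding bracket_def
  by (rule some_equality) (use assms adapted_frame_abs_det_unique in blast)+

lemma adapted_frame_exists:
  fixes L :: "nat \<Rightarrow> (real^'n) set"
  assumes sub: "\<And>i. i \<in> {1..m} \<Longrightarrow> subspace (L i)" and dim: "(\<Sum>i=1..m. dim (L i)) = CARD('n)"
  shows "\<exists>b u. adapted_frame m L b u"
proof -
  have "\<exists>e. inj_on e {..<dim (L i)} \<and> pairwise orthogonal (e ` {..<dim (L i)}) \<and>
      (\<forall>v \<in> e ` {..<dim (L i)}. norm v = 1) \<and> span (e ` {..<dim (L i)}) = L i"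
    if i: "i \<in> {1..m}" for i
  proof -
    obtain B where B: "pairwise orthogonal B" "\<And>x. x \<in> B \<Longrightarrow> norm x = 1" "independent B"
        "card B = dim (L i)" "span B = L i"
      using orthonormal_basis_subspace[of "L i"] sub[OF i] by metis
    then obtain e where "bij_betw e {..<dim (L i)} B"
      using finite_same_card_bij[of "{..<dim (L i)}" B] independent_imp_finite by auto
    then show ?thesis using B by (metis bij_betw_def)
  qed
  then obtain e where e: "\<And>i. i \<in> {1..m} \<Longrightarrow> inj_on (e i) {..<dim (L i)}"
      "\<And>i. i \<in> {1..m} \<Longrightarrow> pairwise orthogonal (e i ` {..<dim (L i)})"
      "\<And>i v. i \<in> {1..m} \<Longrightarrow> v \<in> e i ` {..<dim (L i)} \<Longrightarrow> norm v = 1"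
      "\<And>i. i \<in> {1..m} \<Longrightarrow> span (e i ` {..<dim (L i)}) = L i"
    by metis
  obtain g :: "'n \<Rightarrow> nat \<times> nat" where g: "bij_betw g UNIV (SIGMA i:{1..m}. {..<dim (L i)})"
    using finite_same_card_bij[of "UNIV :: 'n set" "SIGMA i:{1..m}. {..<dim (L i)}"] dim by auto
  have gin: "fst (g k) \<in> {1..m}" "snd (g k) \<in> {..<dim (L (fst (g k)))}" for k
    using bij_betwE[OF g] by (auto simp: mem_Sigma_iff split_beta dest: spec[of _ k])
  have ginj: "k = l" if "fst (g k) = fst (g l)" "snd (g k) = snd (g l)" for k l
    using g that by (metis UNIV_I bij_betw_def inj_on_def prod_eqI)
  have "adapted_frame m L (fst \<circ> g) (\<lambda>k. e (fst (g k)) (snd (g k)))"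
    unfolding adapted_frame_def
  proof (intro conjI allI ballI impI)
    fix k show "(fst \<circ> g) k \<in> {1..m}" using gin by simp
  next
    fix k l assume "(fst \<circ> g) k = (fst \<circ> g) l"
    then have fe: "fst (g l) = fst (g k)" by simp
    let ?i = "fst (g k)"
    have mem: "e ?i (snd (g k)) \<in> e ?i ` {..<dim (L ?i)}" "e ?i (snd (g l)) \<in> e ?i ` {..<dim (L ?i)}"
      using gin[of k] gin[of l] fe by auto
    show "e (fst (g k)) (snd (g k)) \<bullet> e (fst (g l)) (snd (g l)) = (if k = l then 1 else 0)"
    proof (cases "k = l")
      case True
      then show ?thesis using e(3)[OF gin(1) mem(1)] by (simp add: norm_eq_1)
    next
      case False
      then have "e ?i (snd (g k)) \<noteq> e ?i (snd (g l))"
        using ginj[of k l] fe gin(2)[of k] gin(2)[of l] inj_onD[OF e(1)[OF gin(1)[of k]]] by metis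
      then have "orthogonal (e ?i (snd (g k))) (e ?i (snd (g l)))"
        by (rule pairwiseD[OF e(2)[OF gin(1)[of k]] mem])
      then show ?thesis using False fe by (simp add: orthogonal_def)
    qed
  next
    fix i assume i: "i \<in> {1..m}"
    have "(\<lambda>k. e (fst (g k)) (snd (g k))) ` {k. (fst \<circ> g) k = i} = e i ` {..<dim (L i)}"
    proof (intro subset_antisym subsetI)
      fix v assume "v \<in> e i ` {..<dim (L i)}"
      then obtain j where j: "j < dim (L i)" "v = e i j" by auto
      then have "(i, j) \<in> range g" using g i by (auto simp: bij_betw_def)
      then obtain k where "g k = (i, j)" by (metis imageE)
      then show "v \<in> (\<lambda>k. e (fst (g k)) (snd (g k))) ` {k. (fst \<circ> g) k = i}"
        using j by (intro image_eqI[of _ _ k]) auto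
    qed (use gin(2) in auto)
    then show "span ((\<lambda>k. e (fst (g k)) (snd (g k))) ` {k. (fst \<circ> g) k = i}) = L i"
      using e(4)[OF i] by simp
  qed
  then show ?thesis by blast
qed

end

theory Submission
  imports Defs "HOL-Probability.Probability"
begin

text \<open>
  A zonoid \<open>Z\<close> with generating probability measure \<open>\<mu>\<close> is the mean of the random segment from \<open>- v\<close> to
  \<open>v\<close>, where \<open>v\<close> has distribution \<open>\<mu>\<close>. Since the volume of a sum of segments is a sum of absolute
  determinants (\<open>vol_zonotope\<close>, and \<open>vol_zonoid_sum\<close> in the limit), the mixed volume of \<open>n\<close> zonoids in
  dimension \<open>n\<close> is \<open>2 ^ n / fact n\<close> times the mean of \<open>\<bar>det (v 1, ..., v n)\<bar>\<close> for independent random vectors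
  (\<open>mixed_volume_zonoids\<close>). Taking Euclidean balls for some of the zonoids, the intrinsic volume
  of index \<open>j\<close> of \<open>Z\<close> is \<open>2 ^ j / fact j\<close> times the mean volume of the parallelepiped spanned by \<open>j\<close> independent
  vectors with distribution \<open>\<mu>\<close> (\<open>intrinsic_volume_zonoid\<close>).

  In these terms let a random frame of \<open>n\<close> vectors consist of \<open>m\<close> blocks, with \<open>\<alpha> i\<close> vectors distributed according to
  the measure of \<open>Z i\<close>, and let \<open>D i\<close> be the volume of the parallelepiped of block \<open>i\<close>. By Fischer's
  inequality (\<open>pvol_UNION_le\<close>) the absolute determinant is at most the product of the \<open>D i\<close>, and all
  constants being equal on both sides, the hypothesis says that the mean of the product is at most \<open>1 + \<epsilon>\<close> times
  the mean of the absolute determinant. For a typical frame the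
  quotient of the determinant by the product of the \<open>D i\<close> is therefore close to one. This quotient is the bracket
  of the spans \<open>L i\<close> of the blocks (\<open>abs_rdet_orthonormal_blocks\<close>).

  The quotient also remains close to one for most choices when one vector of block \<open>i\<close> is replaced by another random
  vector \<open>x\<close>. If \<open>F\<close> is the span of the vectors of the block that stay, the determinant as a function of the replaced
  vector is given by the inner product with a vector \<open>g\<close> orthogonal to \<open>F\<close>, and a quotient near one means that
  the residual modulo \<open>F\<close> is almost parallel to \<open>g\<close>. This holds for the old vector and for \<open>x\<close>, so \<open>x\<close> is close
  to \<open>L i\<close> (\<open>infdist_extended_subspace_le\<close>). Averaging shows that some frame has a small gap and, in
  every block, a small mean distance from a random vector to \<open>L i\<close> (\<open>good_frame_exists\<close>). By the integral formula for
  the support function this mean distance bounds the distance from every point of \<open>Z i\<close> to \<open>L i\<close>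
  (\<open>subset_orth_proj_plus_ball\<close>).

  The bound for the mean distance contains the mean distance from a random vector to an arbitrary subspace of dimension
  less than \<open>\<alpha> i\<close>. The inradius enters by choosing for this a subspace spanned by a facet of a
  parallelepiped of maximal volume with edges in \<open>Z i\<close>: all of \<open>Z i\<close> is within \<open>\<alpha> i\<close> times the inradius of such a
  subspace (\<open>subspace_near_symmetric_body\<close>).
\<close>

section \<open>Volumes of parallelepipeds spanned by subfamilies\<close>

abbreviation rdet :: "('n \<Rightarrow> real^'n) \<Rightarrow> real" where
  "rdet v \<equiv> det (\<chi> k. v k)"

text \<open>The volume of the parallelepiped spanned by the vectors \<open>v k\<close>, \<open>k \<in> A\<close>: the square root of their
  Gram determinant. The Gram matrix is padded with the identity outside \<open>A\<close>, so that subfamilies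
  of every size are treated by determinants over one and the same index type.\<close>

definition pvol :: "'n set \<Rightarrow> ('n \<Rightarrow> real^'n) \<Rightarrow> real" where
  "pvol A v = sqrt (det (\<chi> i j. if i \<in> A \<and> j \<in> A then v i \<bullet> v j else if i = j then 1 else 0))"

lemma rdet_upd_add: "rdet (v(a := x + y)) = rdet (v(a := x)) + rdet (v(a := y))"
  using det_row_add[of a "\<lambda>_. x" "\<lambda>_. y" v] by (simp add: fun_upd_def)

lemma rdet_upd_scale: "rdet (v(a := c *\<^sub>R x)) = c * rdet (v(a := x))"
  using det_row_mul[of a c "\<lambda>_. x" v] unfolding scalar_mult_eq_scaleR fun_upd_def .

lemma linear_rdet_upd: "linear (\<lambda>x. rdet (v(a := x)))"
  by (rule linearI) (rule rdet_upd_add, unfold real_scaleR_def, rule rdet_upd_scale)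

lemma rdet_upd_span:
  assumes "x \<in> span (v ` (UNIV - {a}))"
  shows "rdet (v(a := v a + x)) = rdet v"
proof -
  have "{row j (\<chi> k. v k) |j. j \<noteq> a} = v ` (UNIV - {a})"
    by (auto simp: row_def vec_lambda_eta)
  then have "x \<in> vec.span {row j (\<chi> k. v k) |j. j \<noteq> a}"
    using assms by (simp add: span_vec_eq)
  from det_row_span[OF this] show ?thesis
    by (simp add: row_def vec_lambda_eta fun_upd_def if_distrib cong: if_cong)
qed

lemma infdist_subspace_eq_norm:
  fixes F :: "'a::euclidean_space set"
  assumes "subspace F" "p \<in> F" "\<And>z. z \<in> F \<Longrightarrow> orthogonal (x - p) z"
  shows "infdist x F = norm (x - p)"
proof (rule antisym)
  show "infdist x F \<le> norm (x - p)"
    using infdist_le[OF assms(2), of x] by (simp add: dist_norm)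
  have "norm (x - p) \<le> dist x z" if "z \<in> F" for z
  proof -
    have "orthogonal (x - p) (p - z)" using assms that by (auto intro: subspace_diff)
    then have "norm ((x - p) + (p - z)) ^ 2 = norm (x - p) ^ 2 + norm (p - z) ^ 2"
      by (rule norm_add_Pythagorean)
    then have "norm (x - p) ^ 2 \<le> norm (x - z) ^ 2" by simp
    from power2_le_imp_le[OF this norm_ge_zero] show ?thesis by (simp add: dist_norm)
  qed
  moreover have "F \<noteq> {}" using assms by auto
  ultimately show "norm (x - p) \<le> infdist x F"
    by (simp add: infdist_notempty cINF_greatest)
qed

lemma subspace_residual:
  fixes F :: "'a::euclidean_space set"
  assumes "subspace F"
  obtains p where "p \<in> F" "\<And>z. z \<in> F \<Longrightarrow> (x - p) \<bullet> z = 0" "infdist x F = norm (x - p)"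
proof -
  obtain y z where "y \<in> span F" "\<And>w. w \<in> span F \<Longrightarrow> orthogonal z w" "x = y + z"
    using orthogonal_subspace_decomp_exists[of F x] by blast
  moreover have "span F = F" using assms by (simp add: span_eq_iff)
  ultimately have "y \<in> F" "\<And>w. w \<in> F \<Longrightarrow> orthogonal (x - y) w" by auto
  with infdist_subspace_eq_norm[OF assms this] show ?thesis
    by (intro that[of y]) (auto simp: orthogonal_def)
qed

lemma infdist_mem_orthogonal:
  fixes F :: "'a::euclidean_space set"
  assumes "subspace F" "\<And>z. z \<in> F \<Longrightarrow> x \<bullet> z = 0"
  shows "infdist x F = norm x"
  using infdist_subspace_eq_norm[of F 0 x] assms subspace_0 by (auto simp: orthogonal_def)

lemma abs_inner_le_infdist:
  fixes F :: "'a::euclidean_space set"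
  assumes "subspace F" "\<And>z. z \<in> F \<Longrightarrow> u \<bullet> z = 0"
  shows "\<bar>x \<bullet> u\<bar> \<le> norm u * infdist x F"
proof -
  obtain p where p: "p \<in> F" "infdist x F = norm (x - p)"
    using subspace_residual[OF assms(1), of x] by metis
  have "x \<bullet> u = (x - p) \<bullet> u" using assms(2)[OF p(1)] by (simp add: inner_diff_left inner_diff_right inner_commute)
  then show ?thesis using Cauchy_Schwarz_ineq2[of "x - p" u] p(2) by (simp add: mult.commute)
qed

lemma infdist_add_subspace:
  fixes F :: "'a::euclidean_space set"
  assumes "subspace F" "y \<in> F"
  shows "infdist (x + y) F = infdist x F"
proof -
  obtain p where p: "p \<in> F" "\<And>z. z \<in> F \<Longrightarrow> (x - p) \<bullet> z = 0" "infdist x F = norm (x - p)"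
    using subspace_residual[OF assms(1), of x] by metis
  have "infdist (x + y) F = norm (x + y - (p + y))"
    by (rule infdist_subspace_eq_norm) (use assms p in \<open>auto intro: subspace_add simp: orthogonal_def\<close>)
  then show ?thesis using p by simp
qed

lemma infdist_scale_subspace:
  fixes F :: "'a::euclidean_space set"
  assumes "subspace F"
  shows "infdist (c *\<^sub>R x) F = \<bar>c\<bar> * infdist x F"
proof -
  obtain p where p: "p \<in> F" "\<And>z. z \<in> F \<Longrightarrow> (x - p) \<bullet> z = 0" "infdist x F = norm (x - p)"
    using subspace_residual[OF assms(1), of x] by metis
  have eq: "c *\<^sub>R x - c *\<^sub>R p = c *\<^sub>R (x - p)" by (simp add: scaleR_diff_right)
  have "infdist (c *\<^sub>R x) F = norm (c *\<^sub>R x - c *\<^sub>R p)"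
    by (rule infdist_subspace_eq_norm)
      (use assms p in \<open>auto intro: subspace_scale simp: orthogonal_def eq\<close>)
  then show ?thesis using p by (simp add: eq)
qed

lemma infdist_le_norm_subspace:
  fixes F :: "'a::euclidean_space set"
  assumes "subspace F" shows "infdist x F \<le> norm x"
  using infdist_le[of 0 F x] subspace_0[OF assms] by simp

text \<open>Completing a subfamily by orthonormal vectors of its orthogonal complement turns the Gram
  determinant into the square of a full determinant. In this way the row operations for determinants
  become available for \<open>pvol\<close>.\<close>

definition completes :: "'n set \<Rightarrow> ('n \<Rightarrow> real^'n) \<Rightarrow> ('n \<Rightarrow> real^'n) \<Rightarrow> bool" where
  "completes A v c \<longleftrightarrow>
     (\<forall>i\<in>-A. \<forall>j\<in>-A. c i \<bullet> c j = (if i = j then 1 else 0)) \<and> (\<forall>i\<in>-A. \<forall>j\<in>A. c i \<bullet> v j = 0)"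

lemma pvol_completes:
  fixes v c :: "'n::finite \<Rightarrow> real^'n"
  assumes "completes A v c"
  shows "pvol A v = \<bar>rdet (\<lambda>k. if k \<in> A then v k else c k)\<bar>"
proof -
  let ?U = "(\<chi> k. if k \<in> A then v k else c k) :: real^'n^'n"
  have "(\<chi> i j. if i \<in> A \<and> j \<in> A then v i \<bullet> v j else if i = j then 1 else 0) = ?U ** transpose ?U"
    using assms
    by (auto simp: completes_def vec_eq_iff matrix_matrix_mult_def transpose_def inner_vec_def
        inner_commute mult.commute)
  then show ?thesis unfolding pvol_def by (simp add: det_mul power2_eq_square[symmetric])
qed

lemma dim_orthogonal_complement:
  fixes S :: "'a::euclidean_space set"
  shows "dim {y. \<forall>x\<in>span S. y \<bullet> x = 0} + dim S = DIM('a)"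
  using dim_subspace_orthogonal_to_vectors[of "span S" UNIV]
  by (simp add: orthogonal_def inner_commute)

lemma subspace_orthogonal_set: "subspace {y::'a::euclidean_space. \<forall>x\<in>S. y \<bullet> x = 0}"
  by (auto simp: subspace_def inner_add_left)

lemma completes_exists: "\<exists>c. completes A v c"
proof -
  let ?E = "{y. \<forall>x\<in>span (v ` A). y \<bullet> x = 0}"
  obtain C where C: "C \<subseteq> ?E" "pairwise orthogonal C" "\<And>x. x \<in> C \<Longrightarrow> norm x = 1"
      "independent C" "card C = dim ?E" "span C = ?E"
    using orthonormal_basis_subspace[OF subspace_orthogonal_set[of "span (v ` A)"]] by blast
  have "dim (v ` A) \<le> card A"
    using dim_le_card'[of "v ` A"] card_image_le[of A v] by (simp add: order_trans)
  then have "card (- A) \<le> card C"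
    using dim_orthogonal_complement[of "v ` A"] C(5) card_Diff_subset[of A UNIV] by (simp add: Compl_eq_Diff_UNIV)
  then obtain c where c: "c ` (- A) \<subseteq> C" "inj_on c (- A)"
    using card_le_inj[of "- A" C] independent_imp_finite[OF C(4)] by auto
  have "c i \<bullet> c j = (if i = j then 1 else 0)" if "i \<in> - A" "j \<in> - A" for i j
  proof (cases "i = j")
    case True then show ?thesis using C(3)[of "c i"] c(1) that by (auto simp: norm_eq_1)
  next
    case False
    then have "c i \<noteq> c j" using c(2) that by (auto dest: inj_onD)
    then have "orthogonal (c i) (c j)" using pairwiseD[OF C(2), of "c i" "c j"] c(1) that by auto
    then show ?thesis using False by (simp add: orthogonal_def)
  qed
  moreover have "c i \<bullet> v j = 0" if "i \<in> -A" "j \<in> A" for i j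
    using C(1) c(1) that span_base[of "v j" "v ` A"] by blast
  ultimately show ?thesis unfolding completes_def by blast
qed

lemma pvol_nonneg: "0 \<le> pvol A v"
  using completes_exists[of A v] pvol_completes by (metis abs_ge_zero)

lemma pvol_UNIV: "pvol UNIV v = \<bar>rdet v\<bar>"
  using pvol_completes[of UNIV v v] by (simp add: completes_def)

lemma pvol_empty [simp]:
  fixes v :: "'n::finite \<Rightarrow> real^'n"
  shows "pvol {} v = 1"
proof -
  have "(\<chi> i j. if i \<in> {} \<and> j \<in> {} then v i \<bullet> v j else if i = j then 1 else 0) = (mat 1 :: real^'n^'n)"
    by (simp add: mat_def vec_eq_iff)
  then show ?thesis unfolding pvol_def by simp
qed

lemma pvol_cong: "(\<And>i. i \<in> A \<Longrightarrow> v i = w i) \<Longrightarrow> pvol A v = pvol A w"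
  unfolding pvol_def by (simp cong: conj_cong if_cong)

lemma pvol_upd: "a \<notin> A \<Longrightarrow> pvol A (v(a := x)) = pvol A v"
  by (rule pvol_cong) auto

text \<open>Base times height. Subtracting from \<open>v a\<close> its projection to the span of the base leaves the full
  determinant unchanged; the residual is the height times a unit vector, and this unit vector joins the
  orthonormal completion of the base.\<close>

lemma pvol_insert:
  assumes "a \<notin> A"
  shows "pvol (insert a A) v = pvol A v * infdist (v a) (span (v ` A))"
proof -
  obtain c where c: "completes (insert a A) v c" using completes_exists by blast
  let ?u = "\<lambda>k. if k \<in> insert a A then v k else c k"
  obtain p where p: "p \<in> span (v ` A)" "\<And>z. z \<in> span (v ` A) \<Longrightarrow> (v a - p) \<bullet> z = 0"
      "infdist (v a) (span (v ` A)) = norm (v a - p)"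
    using subspace_residual[OF subspace_span] by metis
  define r where "r = v a - p"
  have "v ` A \<subseteq> ?u ` (UNIV - {a})" using assms by (force simp: image_iff)
  then have "- p \<in> span (?u ` (UNIV - {a}))"
    using p(1) span_mono span_neg by blast
  then have "rdet (?u(a := ?u a + - p)) = rdet ?u" by (rule rdet_upd_span)
  then have d1: "rdet ?u = rdet (?u(a := r))" by (simp add: r_def)
  have pv: "pvol (insert a A) v = \<bar>rdet ?u\<bar>" using pvol_completes[OF c] by simp
  show ?thesis
  proof (cases "r = 0")
    case True
    then have "rdet ?u = 0" using d1 rdet_upd_scale[of ?u a 0 0] by simp
    then show ?thesis using pv p(3) True r_def by simp
  next
    case False
    define e where "e = (1 / norm r) *\<^sub>R r"
    have "rdet (?u(a := r)) = norm r * rdet (?u(a := e))"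
      using rdet_upd_scale[of ?u a "norm r" e] False by (simp add: e_def)
    moreover have "completes A v (c(a := e))"
    proof -
      have cr: "c k \<bullet> r = 0" if "k \<notin> insert a A" for k
      proof -
        have "c k \<bullet> z = 0" if "z \<in> span (v ` A)" for z
          using that by (rule span_induct)
            (use c \<open>k \<notin> insert a A\<close> in \<open>auto simp: completes_def subspace_def inner_add_right\<close>)
        then have "c k \<bullet> p = 0" using p(1) .
        moreover have "c k \<bullet> v a = 0" using c that by (auto simp: completes_def)
        ultimately show ?thesis by (simp add: r_def inner_diff_right)
      qed
      have re: "r \<bullet> v j = 0" if "j \<in> A" for j
        using p(2)[of "v j"] that by (auto simp: r_def intro: span_base)
      have ee: "e \<bullet> e = 1" using False by (simp add: e_def dot_square_norm power2_eq_square)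
      have ce: "c k \<bullet> e = 0" "e \<bullet> c k = 0" if "k \<notin> insert a A" for k
        using cr[OF that] by (simp_all add: e_def inner_commute)
      show ?thesis unfolding completes_def
      proof (intro conjI ballI)
        fix i j assume ij: "i \<in> - A" "j \<in> - A"
        show "(c(a := e)) i \<bullet> (c(a := e)) j = (if i = j then 1 else 0)"
        proof (cases "i = a \<or> j = a")
          case True then show ?thesis using ij ce ee by auto
        next
          case False then show ?thesis using ij c by (simp add: completes_def)
        qed
      next
        fix i j assume ij: "i \<in> - A" "j \<in> A"
        show "(c(a := e)) i \<bullet> v j = 0"
        proof (cases "i = a")
          case True then show ?thesis using re[OF ij(2)] by (simp add: e_def)
        next
          case False then show ?thesis using ij c by (simp add: completes_def)
        qed
      qed
    qed
    then have "pvol A v = \<bar>rdet (\<lambda>k. if k \<in> A then v k else (c(a := e)) k)\<bar>"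
      by (rule pvol_completes)
    moreover have "(\<lambda>k. if k \<in> A then v k else (c(a := e)) k) = ?u(a := e)"
      using assms by auto
    ultimately show ?thesis
      using pv p(3) d1 by (simp add: abs_mult r_def[symmetric] mult.commute del: fun_upd_apply)
  qed
qed

lemma pvol_remove:
  assumes "a \<in> A"
  shows "pvol A v = pvol (A - {a}) v * infdist (v a) (span (v ` (A - {a})))"
  using pvol_insert[of a "A - {a}" v] assms by (simp add: insert_absorb)

lemma pvol_remove_upd:
  assumes "a \<in> A"
  shows "pvol A (v(a := x)) = pvol (A - {a}) v * infdist x (span (v ` (A - {a})))"
proof -
  have "(v(a := x)) ` (A - {a}) = v ` (A - {a})" by (auto simp: image_iff)
  then show ?thesis using pvol_remove[OF assms, of "v(a := x)"] by (simp add: pvol_upd)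
qed

text \<open>Fischer's inequality: a vector has a smaller height over a larger base.\<close>

lemma pvol_Un_le:
  fixes A B :: "'n::finite set"
  assumes "A \<inter> B = {}"
  shows "pvol (A \<union> B) v \<le> pvol A v * pvol B v"
proof -
  have "finite B" by simp
  then show ?thesis using assms
  proof (induction B rule: finite_induct)
    case (insert b B)
    have "span (v ` B) \<subseteq> span (v ` (A \<union> B))" by (intro span_mono) auto
    then have "infdist (v b) (span (v ` (A \<union> B))) \<le> infdist (v b) (span (v ` B))"
      using span_zero by (intro infdist_mono) auto
    then have "pvol (A \<union> B) v * infdist (v b) (span (v ` (A \<union> B)))
        \<le> (pvol A v * pvol B v) * infdist (v b) (span (v ` B))"
      using insert by (intro mult_mono) (auto simp: pvol_nonneg infdist_nonneg)
    then show ?case using insert by (simp add: pvol_insert)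
  qed simp
qed

lemma pvol_UNION_le:
  fixes B :: "'i \<Rightarrow> 'n::finite set"
  assumes "finite I" "disjoint_family_on B I"
  shows "pvol (\<Union>i\<in>I. B i) v \<le> (\<Prod>i\<in>I. pvol (B i) v)"
  using assms
proof (induction I rule: finite_induct)
  case (insert a I)
  have "B a \<inter> (\<Union>i\<in>I. B i) = {}" using insert by (auto simp: disjoint_family_on_def)
  then have "pvol (B a \<union> (\<Union>i\<in>I. B i)) v \<le> pvol (B a) v * pvol (\<Union>i\<in>I. B i) v"
    by (rule pvol_Un_le)
  also have "\<dots> \<le> pvol (B a) v * (\<Prod>i\<in>I. pvol (B i) v)"
    using insert by (intro mult_left_mono) (auto simp: pvol_nonneg disjoint_family_on_def)
  finally show ?case using insert by simp
qed simp

lemma pvol_singleton: "pvol {k} v = norm (v k)"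
  using pvol_insert[of k "{}" v] by simp

lemma pvol_le_prod_norm: "pvol A v \<le> (\<Prod>k\<in>A. norm (v k))"
  using pvol_UNION_le[of A "\<lambda>k. {k}" v] by (simp add: pvol_singleton disjoint_family_on_def)

lemma abs_rdet_le_prod_norm: "\<bar>rdet v\<bar> \<le> (\<Prod>k\<in>UNIV. norm (v k))"
  using pvol_le_prod_norm[of UNIV v] by (simp add: pvol_UNIV)

lemma pvol_pos_subset:
  assumes "A \<subseteq> B" "pvol B v > 0" shows "pvol A v > 0"
proof -
  have "pvol B v \<le> pvol A v * pvol (B - A) v"
    using pvol_Un_le[of A "B - A" v] assms by (simp add: Un_absorb1)
  then show ?thesis using assms pvol_nonneg[of A v] by (cases "pvol A v = 0") auto
qed

lemma pvol_pos_independent: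
  fixes A :: "'n::finite set"
  assumes "pvol A v > 0"
  shows "inj_on v A" "independent (v ` A)" "dim (span (v ` A)) = card A"
proof -
  have "finite A" by simp
  then have *: "inj_on v A \<and> independent (v ` A)" using assms
  proof (induction A rule: finite_induct)
    case empty then show ?case by (simp add: independent_empty)
  next
    case (insert a A)
    have pos: "pvol A v > 0" using insert by (auto intro: pvol_pos_subset)
    have "infdist (v a) (span (v ` A)) \<noteq> 0"
      using insert by (auto simp: pvol_insert)
    then have "v a \<notin> span (v ` A)" by auto
    then show ?case using insert pos by (auto simp: independent_insert intro: span_base)
  qed
  then show "inj_on v A" "independent (v ` A)" by auto
  then show "dim (span (v ` A)) = card A"
    by (simp add: dim_eq_card_independent card_image)
qed

text \<open>A vector outside \<open>A\<close> multiplies both sides by its height, which depends on the span of the base only.\<close>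

lemma pvol_span_ratio:
  fixes A B :: "'n::finite set"
  assumes "span (v ` A) = span (u ` A)" "A \<inter> B = {}" "\<And>k. k \<in> B \<Longrightarrow> u k = v k"
  shows "pvol (A \<union> B) u * pvol A v = pvol (A \<union> B) v * pvol A u"
proof -
  have "finite B" by simp
  then show ?thesis using assms(2,3)
  proof (induction B rule: finite_induct)
    case (insert b B)
    have e: "v ` B = u ` B" using insert by (intro image_cong) auto
    then have "span (v ` (A \<union> B)) = span (u ` (A \<union> B))"
      unfolding image_Un e span_Un using assms(1) by simp
    then have "pvol (A \<union> insert b B) u * pvol A v
        = (pvol (A \<union> B) u * pvol A v) * infdist (v b) (span (v ` (A \<union> B)))"
      using insert by (simp add: pvol_insert)
    also have "\<dots> = (pvol (A \<union> B) v * pvol A u) * infdist (v b) (span (v ` (A \<union> B)))"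
      using insert by simp
    also have "\<dots> = pvol (A \<union> insert b B) v * pvol A u"
      using insert by (simp add: pvol_insert)
    finally show ?case .
  qed simp
qed

text \<open>Since \<open>F\<close> has too small a dimension, the span of the vectors contains a unit vector \<open>u\<close> orthogonal to
  \<open>F\<close>. Write \<open>u = (\<Sum>i\<in>A. a i *\<^sub>R v i)\<close>. Comparing heights over the facet without \<open>i\<close> shows that
  \<open>\<bar>a i\<bar>\<close> is at most the quotient of the volume of this facet by the volume of the whole, and
  \<open>\<bar>v i \<bullet> u\<bar>\<close> is at most the distance from \<open>v i\<close> to \<open>F\<close>. Now expand \<open>u \<bullet> u = 1\<close>.\<close>

lemma pvol_le_sum_infdist:
  fixes A :: "'n::finite set"
  assumes F: "subspace F" "dim F < card A"
  shows "pvol A v \<le> (\<Sum>i\<in>A. infdist (v i) F * pvol (A - {i}) v)"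
proof (cases "pvol A v > 0")
  case False
  then show ?thesis
    using pvol_nonneg[of A v] by (auto intro!: sum_nonneg mult_nonneg_nonneg simp: infdist_nonneg pvol_nonneg)
next
  case True
  note ind = pvol_pos_independent[OF True]
  have "\<exists>u. u \<in> span (v ` A) \<and> u \<noteq> 0 \<and> (\<forall>z\<in>F. u \<bullet> z = 0)"
  proof -
    have "dim F < dim (span (v ` A))" using F ind by simp
    let ?E = "{y. \<forall>x\<in>F. y \<bullet> x = 0}" and ?T = "span (v ` A)"
    have "dim ?E + dim F = CARD('n)"
      using dim_orthogonal_complement[of F] F(1) by (simp add: span_eq_iff[THEN iffD2])
    moreover have "dim {x + y |x y. x \<in> ?T \<and> y \<in> ?E} + dim (?T \<inter> ?E) = dim ?T + dim ?E"
      by (rule dim_sums_Int[OF subspace_span subspace_orthogonal_set])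
    moreover have "dim {x + y |x y. x \<in> ?T \<and> y \<in> ?E} \<le> CARD('n)"
      using dim_subset_UNIV[of "{x + y |x y. x \<in> ?T \<and> y \<in> ?E}"] by simp
    ultimately have nz: "dim (?T \<inter> ?E) \<noteq> 0"
      using \<open>dim F < dim ?T\<close> by linarith
    have "\<not> ?T \<inter> ?E \<subseteq> {0}"
    proof
      assume "?T \<inter> ?E \<subseteq> {0}"
      then have "dim (?T \<inter> ?E) = 0" by (rule dim_eq_0[THEN iffD2])
      with nz show False by (rule notE)
    qed
    then show ?thesis by blast
  qed
  then obtain u0 where u0: "u0 \<in> span (v ` A)" "u0 \<noteq> 0" "\<And>z. z \<in> F \<Longrightarrow> u0 \<bullet> z = 0" by blast
  define u where "u = (1 / norm u0) *\<^sub>R u0"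
  have u: "u \<in> span (v ` A)" "norm u = 1" "\<And>z. z \<in> F \<Longrightarrow> u \<bullet> z = 0"
    using u0 by (auto simp: u_def span_scale)
  obtain a where a: "u = (\<Sum>i\<in>A. a i *\<^sub>R v i)"
  proof -
    obtain f where "u = (\<Sum>x\<in>v ` A. f x *\<^sub>R x)"
      using u(1) by (auto simp: span_finite)
    then have "u = (\<Sum>i\<in>A. f (v i) *\<^sub>R v i)" using ind(1) by (simp add: sum.reindex)
    then show ?thesis by (rule that)
  qed
  have coef: "\<bar>a i\<bar> * pvol A v \<le> pvol (A - {i}) v" if i: "i \<in> A" for i
  proof -
    let ?S = "span (v ` (A - {i}))"
    have "(\<Sum>j\<in>A - {i}. a j *\<^sub>R v j) \<in> ?S"
      by (intro span_sum span_scale span_base) auto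
    from infdist_add_subspace[OF subspace_span this, of "a i *\<^sub>R v i"]
    have "infdist u ?S = infdist (a i *\<^sub>R v i) ?S"
      using i by (simp add: a sum.remove[of A i])
    then have "infdist u ?S = \<bar>a i\<bar> * infdist (v i) ?S"
      by (simp add: infdist_scale_subspace[OF subspace_span])
    moreover have "infdist u ?S \<le> 1" using infdist_le_norm_subspace[OF subspace_span] u(2) by metis
    ultimately have "pvol (A - {i}) v * (\<bar>a i\<bar> * infdist (v i) ?S) \<le> pvol (A - {i}) v * 1"
      by (intro mult_left_mono) (auto simp: pvol_nonneg)
    then show ?thesis using pvol_remove[OF i, of v] by (simp add: mult_ac)
  qed
  have "1 = u \<bullet> u" using u(2) by (simp add: norm_eq_1)
  also have "\<dots> = (\<Sum>i\<in>A. a i * (v i \<bullet> u))"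
    by (subst (1) a) (simp add: inner_sum_left)
  finally have one: "(\<Sum>i\<in>A. a i * (v i \<bullet> u)) = 1" by simp
  have "pvol A v = (\<Sum>i\<in>A. (v i \<bullet> u) * (a i * pvol A v))"
  proof -
    have "pvol A v = (\<Sum>i\<in>A. a i * (v i \<bullet> u)) * pvol A v" using one by simp
    also have "\<dots> = (\<Sum>i\<in>A. (v i \<bullet> u) * (a i * pvol A v))"
      unfolding sum_distrib_right by (intro sum.cong refl) (simp add: mult_ac)
    finally show ?thesis .
  qed
  also have "\<dots> \<le> (\<Sum>i\<in>A. infdist (v i) F * pvol (A - {i}) v)"
  proof (rule sum_mono)
    fix i assume i: "i \<in> A"
    have "(v i \<bullet> u) * (a i * pvol A v) \<le> \<bar>v i \<bullet> u\<bar> * (\<bar>a i\<bar> * pvol A v)"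
      by (metis abs_ge_self abs_mult abs_of_nonneg pvol_nonneg)
    also have "\<dots> \<le> infdist (v i) F * pvol (A - {i}) v"
      using abs_inner_le_infdist[OF F(1) u(3), of "v i"] u(2) coef[OF i]
      by (intro mult_mono) (auto simp: infdist_nonneg pvol_nonneg)
    finally show "(v i \<bullet> u) * (a i * pvol A v) \<le> infdist (v i) F * pvol (A - {i}) v" .
  qed
  finally show ?thesis .
qed

lemma orthonormal_on_pvol:
  fixes v :: "'n::finite \<Rightarrow> real^'n"
  assumes "\<And>i j. i \<in> A \<Longrightarrow> j \<in> A \<Longrightarrow> v i \<bullet> v j = (if i = j then 1 else 0)"
  shows "pvol A v = 1"
proof -
  have "(\<chi> i j. if i \<in> A \<and> j \<in> A then v i \<bullet> v j else if i = j then 1 else 0) = (mat 1 :: real^'n^'n)"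
    using assms by (auto simp: mat_def vec_eq_iff)
  then show ?thesis unfolding pvol_def by simp
qed

lemma orthonormal_reframe:
  fixes A :: "'n::finite set"
  assumes "pvol A v > 0"
  obtains u where "\<And>i j. i \<in> A \<Longrightarrow> j \<in> A \<Longrightarrow> u i \<bullet> u j = (if i = j then 1 else 0)"
    "span (u ` A) = span (v ` A)"
proof -
  obtain C where C: "C \<subseteq> span (v ` A)" "pairwise orthogonal C" "\<And>x. x \<in> C \<Longrightarrow> norm x = 1"
      "independent C" "card C = dim (span (v ` A))" "span C = span (v ` A)"
    using orthonormal_basis_subspace[OF subspace_span[of "v ` A"]] by blast
  obtain u where u: "bij_betw u A C"
    using finite_same_card_bij[of A C] C pvol_pos_independent[OF assms] independent_imp_finite[OF C(4)]
    by auto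
  show ?thesis
  proof
    show "span (u ` A) = span (v ` A)" using u C(6) by (simp add: bij_betw_def)
    fix i j assume ij: "i \<in> A" "j \<in> A"
    show "u i \<bullet> u j = (if i = j then 1 else 0)"
    proof (cases "i = j")
      case True then show ?thesis using C(3)[of "u i"] u ij by (auto simp: norm_eq_1 bij_betw_def)
    next
      case False
      then have "u i \<noteq> u j" using u ij by (auto simp: bij_betw_def dest: inj_onD)
      then have "orthogonal (u i) (u j)"
        using pairwiseD[OF C(2), of "u i" "u j"] u ij by (auto simp: bij_betw_def)
      then show ?thesis using False by (simp add: orthogonal_def)
    qed
  qed
qed

lemma borel_measurable_rdet [measurable]:
  assumes "\<And>k. f k \<in> borel_measurable M"
  shows "(\<lambda>x. rdet (\<lambda>k. f k x)) \<in> borel_measurable M"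
proof -
  have "(\<lambda>x. f k x $ j) \<in> borel_measurable M" for k j
    unfolding cart_eq_inner_axis using assms by simp
  then show ?thesis unfolding det_def by simp
qed

lemma borel_measurable_pvol [measurable]:
  assumes "\<And>k. k \<in> A \<Longrightarrow> f k \<in> borel_measurable M"
  shows "(\<lambda>x. pvol A (\<lambda>k. f k x)) \<in> borel_measurable M"
proof -
  have "(\<lambda>x. if i \<in> A \<and> j \<in> A then f i x \<bullet> f j x else if i = j then 1 else 0)
      \<in> borel_measurable M" for i j
    using assms by (cases "i \<in> A \<and> j \<in> A") auto
  then show ?thesis unfolding pvol_def det_def by simp
qed

section \<open>The volume of a zonotope\<close>

abbreviation vol :: "(real^'n) set \<Rightarrow> real" where
  "vol S \<equiv> measure lborel S"

lemma vol_eq_lebesgue: "compact S \<Longrightarrow> vol S = measure lebesgue S"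
  by (simp add: borel_compact)

lemma vol_translate:
  assumes "compact S" shows "vol ((+) a ` S) = vol S"
proof -
  have "compact ((+) a ` S)" using assms by (rule compact_translation)
  then show ?thesis using vol_eq_lebesgue assms measure_translation by metis
qed

lemma borel_measurable_vecI:
  fixes f :: "'a \<Rightarrow> real^'n"
  assumes "\<And>i. (\<lambda>x. f x $ i) \<in> borel_measurable M"
  shows "f \<in> borel_measurable M"
  using assms by (subst borel_measurable_euclidean_space) (auto simp: Basis_vec_def inner_axis)

text \<open>This description makes Fubini's theorem available for a single coordinate.\<close>

lemma lborel_vec_eq:
  "lborel = distr (\<Pi>\<^sub>M i\<in>(UNIV :: 'n::finite set). lborel) borel (\<lambda>w. (\<chi> i. w i) :: real^'n)"
proof (rule lborel_eqI)
  interpret product_sigma_finite "\<lambda>_::'n. lborel :: real measure" by standard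
  have meas: "(\<lambda>w. (\<chi> i. w i) :: real^'n) \<in> measurable (\<Pi>\<^sub>M i\<in>(UNIV :: 'n set). lborel) borel"
    by (rule borel_measurable_vecI) auto
  fix l u :: "real^'n" assume le: "\<And>b. b \<in> Basis \<Longrightarrow> l \<bullet> b \<le> u \<bullet> b"
  have le': "l $ i \<le> u $ i" for i
    using le[of "axis i 1"] by (simp add: axis_in_Basis_iff inner_axis)
  have "(\<lambda>w. (\<chi> i. w i) :: real^'n) -` box l u \<inter> space (\<Pi>\<^sub>M i\<in>(UNIV :: 'n set). lborel)
      = (\<Pi>\<^sub>E i\<in>UNIV. {l $ i<..<u $ i})"
    by (auto simp: space_PiM mem_box_cart PiE_def Pi_def)
  then have "emeasure (distr (\<Pi>\<^sub>M i\<in>(UNIV :: 'n set). lborel) borel (\<lambda>w. (\<chi> i. w i) :: real^'n)) (box l u)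
      = (\<Prod>i\<in>UNIV. ennreal (u $ i - l $ i))"
    using le' by (simp add: emeasure_distr[OF meas] emeasure_PiM)
  also have "\<dots> = ennreal (\<Prod>i\<in>UNIV. u $ i - l $ i)"
    using le' by (intro prod_ennreal) auto
  also have "(\<Prod>i\<in>UNIV. u $ i - l $ i) = (\<Prod>b\<in>Basis. (u - l) \<bullet> b)"
    by (subst prod.reindex_bij_betw[of "\<lambda>i. axis i 1" UNIV Basis, symmetric])
      (auto simp: bij_betw_def inj_on_def axis_eq_axis Basis_vec_def inner_axis)
  finally show "emeasure (distr (\<Pi>\<^sub>M i\<in>(UNIV :: 'n set). lborel) borel (\<lambda>w. (\<chi> i. w i) :: real^'n)) (box l u)
      = ennreal (\<Prod>b\<in>Basis. (u - l) \<bullet> b)" .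
qed simp

text \<open>On each line in the direction of the coordinate \<open>m\<close>, a shear is a translation.\<close>

lemma nn_integral_lborel_shear:
  fixes F :: "real^'n \<Rightarrow> ennreal"
  assumes [measurable]: "F \<in> borel_measurable borel" and mn: "m \<noteq> n"
  shows "(\<integral>\<^sup>+x. F (\<chi> i. if i = m then x $ m + x $ n else x $ i) \<partial>lborel) = (\<integral>\<^sup>+x. F x \<partial>lborel)"
proof -
  interpret product_sigma_finite "\<lambda>_::'n. lborel :: real measure" by standard
  let ?P = "\<lambda>I. (\<Pi>\<^sub>M i\<in>(I :: 'n set). (lborel :: real measure))"
  let ?h = "\<lambda>x :: real^'n. (\<chi> i. if i = m then x $ m + x $ n else x $ i) :: real^'n"
  have vec[measurable]: "(\<lambda>w. (\<chi> i. w i) :: real^'n) \<in> measurable (?P UNIV) borel"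
    by (rule borel_measurable_vecI) auto
  have nth: "(\<lambda>x :: real^'n. x $ j) \<in> borel_measurable borel" for j
    unfolding cart_eq_inner_axis by simp
  have hm[measurable]: "?h \<in> measurable borel borel"
  proof (rule borel_measurable_vecI)
    fix i show "(\<lambda>x. ?h x $ i) \<in> borel_measurable borel"
      using nth by (cases "i = m") auto
  qed
  have split: "(\<integral>\<^sup>+x. G x \<partial>lborel)
      = (\<integral>\<^sup>+w. (\<integral>\<^sup>+y. G (\<chi> i. (w(m := y)) i) \<partial>lborel) \<partial>?P (UNIV - {m}))"
    if [measurable]: "G \<in> borel_measurable borel" for G :: "real^'n \<Rightarrow> ennreal"
  proof -
    have "(\<integral>\<^sup>+x. G x \<partial>lborel) = (\<integral>\<^sup>+w. G (\<chi> i. w i) \<partial>?P UNIV)"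
      by (subst lborel_vec_eq) (simp add: nn_integral_distr)
    also have "?P UNIV = ?P (insert m (UNIV - {m}))" by (simp add: insert_UNIV)
    also have "(\<integral>\<^sup>+w. G (\<chi> i. w i) \<partial>?P (insert m (UNIV - {m})))
        = (\<integral>\<^sup>+w. (\<integral>\<^sup>+y. G (\<chi> i. (w(m := y)) i) \<partial>lborel) \<partial>?P (UNIV - {m}))"
      by (rule product_nn_integral_insert) (auto simp: insert_UNIV)
    finally show ?thesis .
  qed
  have "(\<integral>\<^sup>+y. F (?h (\<chi> i. (w(m := y)) i)) \<partial>lborel) = (\<integral>\<^sup>+y. F (\<chi> i. (w(m := y)) i) \<partial>lborel)" for w
  proof -
    let ?g = "\<lambda>y. F (\<chi> i. (w(m := y)) i)"
    have gm: "?g \<in> borel_measurable borel"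
    proof -
      have "(\<lambda>y. (\<chi> i. (w(m := y)) i) :: real^'n) \<in> borel_measurable borel"
        by (rule borel_measurable_vecI) auto
      then show ?thesis by measurable
    qed
    have "?h (\<chi> i. (w(m := y)) i) = (\<chi> i. (w(m := w n + 1 * y)) i)" for y
      using mn by (auto simp: vec_eq_iff)
    then have "(\<integral>\<^sup>+y. F (?h (\<chi> i. (w(m := y)) i)) \<partial>lborel) = (\<integral>\<^sup>+y. ?g (w n + 1 * y) \<partial>lborel)"
      by simp
    also have "\<dots> = (\<integral>\<^sup>+y. ?g y \<partial>lborel)"
      using nn_integral_real_affine[OF gm, of 1 "w n"] by simp
    finally show ?thesis .
  qed
  then show ?thesis using split[of "\<lambda>x. F (?h x)"] split[of F] by simp
qed

lemma vol_shear:
  assumes "m \<noteq> n" "compact S"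
  shows "vol ((\<lambda>x. \<chi> i. if i = m then x $ m + x $ n else x $ i) ` S) = vol (S :: (real^'n) set)"
proof -
  let ?h = "\<lambda>x :: real^'n. (\<chi> i. if i = m then x $ m + x $ n else x $ i) :: real^'n"
  have lin: "linear ?h"
    by (rule linearI) (auto simp: algebra_simps vec_eq_iff)
  have cS: "compact (?h ` S)"
    using assms lin by (intro compact_continuous_image linear_continuous_on linear_conv_bounded_linear[THEN iffD1])
  have inj: "inj ?h"
  proof (rule injI)
    fix x y assume eq: "?h x = ?h y"
    have *: "x $ i = y $ i" if "i \<noteq> m" for i using arg_cong[OF eq, of "\<lambda>z. z $ i"] that by simp
    have "x $ m + x $ n = y $ m + y $ n" using arg_cong[OF eq, of "\<lambda>z. z $ m"] by simp
    then have "x $ m = y $ m" using * assms by simp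
    with * show "x = y" by (metis vec_eq_iff)
  qed
  have "emeasure lborel (?h ` S) = (\<integral>\<^sup>+x. indicator (?h ` S) x \<partial>lborel)"
    using cS by (simp add: borel_compact)
  also have "\<dots> = (\<integral>\<^sup>+x. indicator (?h ` S) (?h x) \<partial>lborel)"
    using cS assms by (intro nn_integral_lborel_shear[symmetric]) (auto intro!: borel_measurable_indicator borel_compact)
  also have "\<dots> = (\<integral>\<^sup>+x. indicator S x \<partial>lborel)"
    by (rule nn_integral_cong) (simp only: indicator_def inj_image_mem_iff[OF inj])
  also have "\<dots> = emeasure lborel S" using assms by (simp add: borel_compact)
  finally show ?thesis by (simp add: measure_def)
qed

lemma vol_swap:
  assumes "compact S"
  shows "vol ((\<lambda>x. \<chi> i. x $ Transposition.transpose m n i) ` S) = vol (S :: (real^'n) set)"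
proof -
  let ?h = "\<lambda>x :: real^'n. (\<chi> i. x $ Transposition.transpose m n i) :: real^'n"
  have lin: "linear ?h" by (rule linearI) (simp_all add: vec_eq_iff)
  have inv: "?h (?h x) = x" for x by (simp add: vec_eq_iff)
  have im: "measure lebesgue (?h ` cbox a b) = 1 * measure lebesgue (cbox a b)" for a b
  proof (cases "cbox a b = {}")
    case False
    have "?h ` cbox a b = cbox (?h a) (?h b)"
    proof
      show "?h ` cbox a b \<subseteq> cbox (?h a) (?h b)" by (auto simp: mem_box_cart)
      show "cbox (?h a) (?h b) \<subseteq> ?h ` cbox a b"
      proof
        fix y assume y: "y \<in> cbox (?h a) (?h b)"
        have "?h y \<in> cbox a b"
          unfolding mem_box_cart
        proof
          fix i show "a $ i \<le> ?h y $ i \<and> ?h y $ i \<le> b $ i"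
            using y[unfolded mem_box_cart, rule_format, of "Transposition.transpose m n i"] by simp
        qed
        then show "y \<in> ?h ` cbox a b" using inv[of y] by (metis image_eqI)
      qed
    qed
    moreover have "(\<Prod>i\<in>UNIV. ?h b $ i - ?h a $ i) = (\<Prod>i\<in>UNIV. b $ i - a $ i)"
      using prod.permute[OF permutes_swap_id[of m UNIV n], of "\<lambda>i. b $ i - a $ i"] by (simp add: o_def)
    moreover have "cbox (?h a) (?h b) \<noteq> {}" using False calculation(1) by blast
    ultimately show ?thesis
      using content_cbox_cart[OF False] content_cbox_cart[of "?h a" "?h b"] by simp
  qed auto
  have "compact (?h ` S)"
    using assms lin by (intro compact_continuous_image linear_continuous_on linear_conv_bounded_linear[THEN iffD1])
  then show ?thesis
    using measure_linear_sufficient[OF lin lmeasurable_compact[OF assms] im] assms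
    by (simp add: vol_eq_lebesgue)
qed

text \<open>A linear map is a composition of coordinate scalings, transpositions of coordinates, shears and maps
  into a coordinate hyperplane, and for each of these the formula can be checked directly.\<close>

lemma vol_linear_image:
  fixes f :: "real^'n \<Rightarrow> real^'n"
  assumes "linear f" "compact S"
  shows "vol (f ` S) = \<bar>det (matrix f)\<bar> * vol S"
proof -
  have compact_im: "compact (g ` T)" if "linear g" "compact T" for g :: "real^'n \<Rightarrow> real^'n" and T
    using that by (intro compact_continuous_image linear_continuous_on linear_conv_bounded_linear[THEN iffD1])
  have "\<forall>S. compact S \<longrightarrow> vol (f ` S) = \<bar>det (matrix f)\<bar> * vol S"
  proof (rule induct_linear_elementary[OF assms(1)]; intro allI impI)
    fix f g :: "real^'n \<Rightarrow> real^'n" and S :: "(real^'n) set"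
    assume lin: "linear f" "linear g" and S: "compact S"
      and f: "\<forall>S. compact S \<longrightarrow> vol (f ` S) = \<bar>det (matrix f)\<bar> * vol S"
      and g: "\<forall>S. compact S \<longrightarrow> vol (g ` S) = \<bar>det (matrix g)\<bar> * vol S"
    then show "vol ((f \<circ> g) ` S) = \<bar>det (matrix (f \<circ> g))\<bar> * vol S"
      using compact_im[OF lin(2) S] matrix_compose[OF lin(2,1)]
      unfolding image_comp[symmetric] by (simp add: det_mul abs_mult)
  next
    fix f :: "real^'n \<Rightarrow> real^'n" and i and S :: "(real^'n) set"
    assume lin: "linear f" and 0: "\<And>x. f x $ i = 0" and S: "compact S"
    have "row i (matrix f) = 0" using 0 by (simp add: matrix_def row_def vec_eq_iff)
    then have "det (matrix f) = 0" by (rule det_zero_row)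
    moreover have "negligible (f ` S)"
      using 0 by (intro negligible_subset[OF negligible_hyperplane[of "axis i 1" 0]])
        (auto simp: inner_axis')
    then have "vol (f ` S) = 0"
      using negligible_imp_measure0 compact_im[OF lin S] by (simp add: vol_eq_lebesgue)
    ultimately show "vol (f ` S) = \<bar>det (matrix f)\<bar> * vol S" by simp
  next
    fix c :: "'n \<Rightarrow> real" and S :: "(real^'n) set" assume S: "compact S"
    have lin: "linear (\<lambda>x :: real^'n. (\<chi> i. c i * x $ i) :: real^'n)"
      by (rule linearI) (simp_all add: vec_eq_iff algebra_simps)
    have "measure lebesgue ((\<lambda>x. \<chi> i. c i * x $ i) ` S) = \<bar>prod c UNIV\<bar> * measure lebesgue S"
      by (rule measure_stretch[OF lmeasurable_compact[OF S]])
    moreover have "det (matrix (\<lambda>x :: real^'n. (\<chi> i. c i * x $ i) :: real^'n)) = prod c UNIV"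
      by (subst det_diagonal) (auto simp: matrix_def axis_def)
    ultimately show "vol ((\<lambda>x. \<chi> i. c i * x $ i) ` S)
        = \<bar>det (matrix (\<lambda>x :: real^'n. (\<chi> i. c i * x $ i) :: real^'n))\<bar> * vol S"
      using compact_im[OF lin S] S by (simp add: vol_eq_lebesgue)
  next
    fix m n :: 'n and S :: "(real^'n) set" assume "m \<noteq> n" and S: "compact S"
    let ?h = "\<lambda>x :: real^'n. (\<chi> i. x $ Transposition.transpose m n i) :: real^'n"
    have "matrix ?h = (\<chi> i. mat 1 $ Transposition.transpose m n i)"
      by (simp add: matrix_def mat_def axis_def vec_eq_iff)
    then have "\<bar>det (matrix ?h)\<bar> = 1"
      using det_permute_rows[OF permutes_swap_id[of m UNIV n], of "mat 1 :: real^'n^'n"]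
      by (simp add: abs_mult sign_def)
    then show "vol (?h ` S) = \<bar>det (matrix ?h)\<bar> * vol S" using vol_swap[OF S] by simp
  next
    fix m n :: 'n and S :: "(real^'n) set" assume mn: "m \<noteq> n" and S: "compact S"
    let ?h = "\<lambda>x :: real^'n. (\<chi> i. if i = m then x $ m + x $ n else x $ i) :: real^'n"
    have "matrix ?h = (\<chi> k. if k = m then row m (mat 1) + 1 *s row n (mat 1) else row k (mat 1))"
      by (auto simp: matrix_def mat_def axis_def vec_eq_iff row_def)
    then have "det (matrix ?h) = 1"
      using det_row_operation[OF mn, where c=1 and A="mat 1 :: real^'n^'n"] by simp
    then show "vol (?h ` S) = \<bar>det (matrix ?h)\<bar> * vol S" using vol_shear[OF mn S] by simp
  qed
  then show ?thesis using assms(2) by blast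
qed

lemma compact_set_plus:
  fixes S T :: "'a::real_normed_vector set"
  assumes "compact S" "compact T" shows "compact (S + T)"
proof -
  have "S + T = {x + y |x y. x \<in> S \<and> y \<in> T}" by (auto simp: set_plus_def)
  then show ?thesis using compact_sums[OF assms] by simp
qed

lemma compact_set_sum:
  fixes S :: "'i \<Rightarrow> 'a::real_normed_vector set"
  assumes "\<And>i. i \<in> I \<Longrightarrow> compact (S i)"
  shows "compact (sum S I)"
  using assms by (induction I rule: infinite_finite_induct) (auto intro: compact_set_plus simp: set_zero)

lemma vol_mono: "compact T \<Longrightarrow> S \<subseteq> T \<Longrightarrow> compact S \<Longrightarrow> vol S \<le> vol T"
  using measure_mono_fmeasurable[of S T lborel] by (simp add: borel_compact fmeasurable_compact)

lemma mem_plus_segment: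
  fixes x :: "'a::real_normed_vector"
  assumes "0 \<le> t"
  shows "x \<in> K + closed_segment 0 (t *\<^sub>R e) \<longleftrightarrow> (\<exists>s. 0 \<le> s \<and> s \<le> t \<and> x - s *\<^sub>R e \<in> K)"
proof
  assume "x \<in> K + closed_segment 0 (t *\<^sub>R e)"
  then obtain k u where k: "k \<in> K" "0 \<le> u" "u \<le> 1" "x = k + (u * t) *\<^sub>R e"
    by (auto simp: set_plus_def closed_segment_def)
  then show "\<exists>s. 0 \<le> s \<and> s \<le> t \<and> x - s *\<^sub>R e \<in> K"
    using assms by (intro exI[of _ "u * t"]) (auto simp: mult_left_le_one_le)
next
  assume "\<exists>s. 0 \<le> s \<and> s \<le> t \<and> x - s *\<^sub>R e \<in> K"
  then obtain s where s: "0 \<le> s" "s \<le> t" "x - s *\<^sub>R e \<in> K" by blast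
  have "s *\<^sub>R e \<in> closed_segment 0 (t *\<^sub>R e)"
  proof (cases "t = 0")
    case True then show ?thesis using s by simp
  next
    case False
    then show ?thesis using s assms
      by (auto simp: closed_segment_def intro!: exI[of _ "s / t"])
  qed
  then have "(x - s *\<^sub>R e) + s *\<^sub>R e \<in> K + closed_segment 0 (t *\<^sub>R e)"
    using s(3) by (rule set_plus_intro[rotated])
  then show "x \<in> K + closed_segment 0 (t *\<^sub>R e)" by simp
qed

text \<open>Lengthening a segment always adds the same region, up to translation: by convexity, a line in
  direction \<open>e\<close> that has left \<open>K\<close> does not enter it again. So the volume of \<open>K\<close> plus a segment is an
  affine function of the length of the segment.\<close>

lemma segment_sum_increment:
  fixes K :: "'a::real_normed_vector set"
  assumes K: "convex K" and "0 \<le> t" "0 \<le> s"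
  shows "(K + closed_segment 0 ((t + s) *\<^sub>R e)) - (K + closed_segment 0 (t *\<^sub>R e))
       = (+) (t *\<^sub>R e) ` ((K + closed_segment 0 (s *\<^sub>R e)) - K)" (is "?A - ?B = ?C")
proof (intro set_eqI iffI)
  fix y assume y: "y \<in> ?A - ?B"
  then obtain r where r: "0 \<le> r" "r \<le> t + s" "y - r *\<^sub>R e \<in> K"
    using assms by (auto simp: mem_plus_segment)
  have nB: "y - u *\<^sub>R e \<notin> K" if "0 \<le> u" "u \<le> t" for u
    using y that assms by (auto simp: mem_plus_segment)
  have "r > t" using nB[of r] r by force
  then have "\<exists>u. 0 \<le> u \<and> u \<le> s \<and> (y - t *\<^sub>R e) - u *\<^sub>R e \<in> K"
    using r by (intro exI[of _ "r - t"]) (auto simp: algebra_simps)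
  then have "y - t *\<^sub>R e \<in> K + closed_segment 0 (s *\<^sub>R e)"
    using assms by (simp add: mem_plus_segment)
  moreover have "y - t *\<^sub>R e \<notin> K" using nB[of t] assms by simp
  ultimately show "y \<in> ?C" by (intro image_eqI[of _ _ "y - t *\<^sub>R e"]) auto
next
  fix y assume "y \<in> ?C"
  then obtain z where z: "y = t *\<^sub>R e + z" "z \<in> K + closed_segment 0 (s *\<^sub>R e)" "z \<notin> K" by auto
  obtain r where r: "0 \<le> r" "r \<le> s" "z - r *\<^sub>R e \<in> K"
    using z assms by (auto simp: mem_plus_segment)
  have "y \<in> ?A"
    unfolding mem_plus_segment[OF add_nonneg_nonneg[OF assms(2,3)]]
    using r z assms by (intro exI[of _ "r + t"]) (auto simp: algebra_simps)
  moreover have "y \<notin> ?B"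
  proof
    assume "y \<in> ?B"
    then obtain u where u: "0 \<le> u" "u \<le> t" "y - u *\<^sub>R e \<in> K"
      using assms by (auto simp: mem_plus_segment)
    define q where "q = t - u"
    have q: "0 \<le> q" "z + q *\<^sub>R e \<in> K" using u z by (auto simp: q_def algebra_simps)
    show False
    proof (cases "q + r = 0")
      case True then have "q = 0" using q r by auto
      then show False using q z by simp
    next
      case False
      then have pos: "q + r > 0" using q r by auto
      have "(r / (q + r)) *\<^sub>R (z + q *\<^sub>R e) + (q / (q + r)) *\<^sub>R (z - r *\<^sub>R e) \<in> K"
        using K q r pos by (intro convexD) (auto simp: add_divide_distrib[symmetric] add.commute)
      moreover have "(r / (q + r)) *\<^sub>R (z + q *\<^sub>R e) + (q / (q + r)) *\<^sub>R (z - r *\<^sub>R e)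
          = ((r + q) / (q + r)) *\<^sub>R z"
        unfolding add_divide_distrib by (simp add: algebra_simps)
      moreover have "(r + q) / (q + r) = 1" using pos by (simp add: add.commute)
      ultimately show False using z by simp
    qed
  qed
  ultimately show "y \<in> ?A - ?B" by blast
qed

lemma set_subset_plus_segment: "K \<subseteq> K + closed_segment 0 (e::'a::real_vector)"
proof
  fix x assume "x \<in> K"
  then have "x + 0 \<in> K + closed_segment 0 e" by (intro set_plus_intro) auto
  then show "x \<in> K + closed_segment 0 e" by simp
qed

lemma vol_Diff:
  assumes "compact S" "compact T" "T \<subseteq> S"
  shows "vol (S - T) = vol S - vol T"
  using assms emeasure_compact_finite[of S]
  by (subst measure_Diff) (auto simp: borel_compact)

lemma vol_translate_Diff:
  assumes "compact S" "compact T"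
  shows "vol ((+) a ` (S - T)) = vol (S - T)"
proof -
  have m: "S - T \<in> sets borel" using assms by (auto simp: borel_compact)
  have eq: "(+) a ` (S - T) = (+) a ` S - (+) a ` T" by (auto simp: image_iff)
  have m': "(+) a ` (S - T) \<in> sets borel"
    unfolding eq by (intro sets.Diff borel_compact compact_translation assms)
  show ?thesis using m m' measure_translation[of a "S - T"] by simp
qed

lemma set_plus_singleton_0: "K + {0} = (K :: 'a::comm_monoid_add set)" "{0} + K = K"
  by (auto simp: set_plus_def)

lemma vol_plus_segment_multiple:
  fixes K :: "(real^'n) set"
  assumes K: "convex K" "compact K"
  shows "vol (K + closed_segment 0 (real N *\<^sub>R e))
       = vol K + real N * (vol (K + closed_segment 0 e) - vol K)"
proof (induction N)
  case 0
  show ?case by (simp add: set_plus_singleton_0)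
next
  case (Suc N)
  let ?K = "\<lambda>t. K + closed_segment 0 (t *\<^sub>R e)"
  have c: "compact (?K t)" for t using K by (intro compact_set_plus) auto
  have sub: "?K (real N) \<subseteq> ?K (real N + 1)"
    unfolding subset_iff mem_plus_segment[OF of_nat_0_le_iff] mem_plus_segment[OF add_nonneg_nonneg[OF of_nat_0_le_iff zero_le_one]]
    by (meson le_add_same_cancel1 order_trans zero_le_one)
  have "vol (?K (real N + 1)) - vol (?K (real N)) = vol (?K (real N + 1) - ?K (real N))"
    by (rule vol_Diff[OF c c sub, symmetric])
  also have "\<dots> = vol ((+) (real N *\<^sub>R e) ` (?K 1 - K))"
    using segment_sum_increment[OF K(1), of "real N" 1 e] by simp
  also have "\<dots> = vol (?K 1 - K)" by (rule vol_translate_Diff[OF c K(2)])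
  also have "\<dots> = vol (?K 1) - vol K"
    using vol_Diff[OF c[of 1] K(2)] set_subset_plus_segment[of K e] by simp
  finally show ?case using Suc by (simp add: algebra_simps)
qed

text \<open>The coefficients of the polynomial that maps \<open>t\<close> to the volume of \<open>K\<close> plus the sum of the segments
  from \<open>0\<close> to \<open>t i *\<^sub>R y i\<close>. This polynomial is affine in each variable, so its coefficients come
  from its values at the vectors of zeros and ones by inclusion and exclusion.\<close>

definition seg_coeff :: "(real^'n) set \<Rightarrow> ('i \<Rightarrow> real^'n) \<Rightarrow> 'i set \<Rightarrow> real" where
  "seg_coeff K y J =
     (\<Sum>T\<in>Pow J. (-1) ^ (card J - card T) * vol (K + (\<Sum>i\<in>T. closed_segment 0 (y i))))"

lemma sum_Pow_insert:
  assumes "finite J" "i \<notin> J"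
  shows "(\<Sum>T\<in>Pow (insert i J). f T) = (\<Sum>T\<in>Pow J. f T) + (\<Sum>T\<in>Pow J. f (insert i T))"
proof -
  have "inj_on (insert i) (Pow J)" using assms by (auto simp: inj_on_def)
  moreover have "Pow J \<inter> insert i ` Pow J = {}" using assms by auto
  ultimately show ?thesis
    using assms by (simp add: Pow_insert sum.union_disjoint sum.reindex)
qed

lemma seg_coeff_insert:
  assumes "finite J" "i \<notin> J"
  shows "seg_coeff K y (insert i J) = seg_coeff (K + closed_segment 0 (y i)) y J - seg_coeff K y J"
proof -
  have fin: "finite T" if "T \<in> Pow J" for T using that assms finite_subset by auto
  have 1: "(-1) ^ (card (insert i J) - card T) = - ((-1::real) ^ (card J - card T))" if "T \<in> Pow J" for T
  proof -
    have "card T \<le> card J" using that assms by (auto intro: card_mono)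
    then have "card (insert i J) - card T = Suc (card J - card T)" using assms by simp
    then show ?thesis by simp
  qed
  have 2: "K + (\<Sum>j\<in>insert i T. closed_segment 0 (y j))
      = K + closed_segment 0 (y i) + (\<Sum>j\<in>T. closed_segment 0 (y j))" if "T \<in> Pow J" for T
    using that assms fin[OF that] by (subst sum.insert) (auto simp: add.assoc)
  have 3: "card (insert i J) - card (insert i T) = card J - card T" if "T \<in> Pow J" for T
    using that assms fin[OF that] by (subst (1 2) card_insert_disjoint) auto
  show ?thesis
    unfolding seg_coeff_def sum_Pow_insert[OF assms]
    by (simp add: 1 2 3 sum_negf)
qed

lemma vol_plus_segments_expansion:
  fixes K :: "(real^'n) set"
  assumes "finite I" "convex K" "compact K"
  shows "vol (K + (\<Sum>i\<in>I. closed_segment 0 (real N *\<^sub>R y i)))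
       = (\<Sum>J\<in>Pow I. real N ^ card J * seg_coeff K y J)"
  using assms
proof (induction I arbitrary: K rule: finite_induct)
  case empty
  show ?case by (simp add: seg_coeff_def)
next
  case (insert i I)
  let ?S = "\<Sum>j\<in>I. closed_segment 0 (real N *\<^sub>R y j)"
  let ?K' = "K + closed_segment 0 (y i)"
  have cc: "convex ?K'" "compact ?K'" "convex (K + ?S)" "compact (K + ?S)"
    using insert.prems by (auto intro!: convex_set_plus compact_set_plus convex_set_sum compact_set_sum)
  have "K + (\<Sum>j\<in>insert i I. closed_segment 0 (real N *\<^sub>R y j))
      = (K + ?S) + closed_segment 0 (real N *\<^sub>R y i)"
    using insert.hyps by (simp add: ac_simps)
  then have "vol (K + (\<Sum>j\<in>insert i I. closed_segment 0 (real N *\<^sub>R y j)))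
      = vol (K + ?S) + real N * (vol ((K + ?S) + closed_segment 0 (y i)) - vol (K + ?S))"
    using vol_plus_segment_multiple[OF cc(3,4)] by simp
  also have "(K + ?S) + closed_segment 0 (y i) = ?K' + ?S" by (simp add: ac_simps)
  also have "vol (K + ?S) + real N * (vol (?K' + ?S) - vol (K + ?S))
      = (\<Sum>J\<in>Pow I. real N ^ card J * seg_coeff K y J)
        + (\<Sum>J\<in>Pow I. real N ^ card (insert i J) * seg_coeff K y (insert i J))"
  proof -
    have "(\<Sum>J\<in>Pow I. real N ^ card (insert i J) * seg_coeff K y (insert i J))
        = (\<Sum>J\<in>Pow I. real N * (real N ^ card J * seg_coeff ?K' y J - real N ^ card J * seg_coeff K y J))"
    proof (rule sum.cong[OF refl])
      fix J assume "J \<in> Pow I"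
      then have "finite J" "i \<notin> J" using insert.hyps finite_subset by auto
      then show "real N ^ card (insert i J) * seg_coeff K y (insert i J)
          = real N * (real N ^ card J * seg_coeff ?K' y J - real N ^ card J * seg_coeff K y J)"
        by (simp add: seg_coeff_insert algebra_simps)
    qed
    then show ?thesis
      using insert.IH[OF insert.prems] insert.IH[OF cc(1,2)]
      by (simp add: sum_distrib_left[symmetric] sum_subtractf)
  qed
  also have "\<dots> = (\<Sum>J\<in>Pow (insert i I). real N ^ card J * seg_coeff K y J)"
    by (rule sum_Pow_insert[OF insert.hyps, symmetric])
  finally show ?case .
qed

lemma scale_set_plus:
  "(\<lambda>x. c *\<^sub>R x) ` (S + T) = (\<lambda>x. c *\<^sub>R x) ` S + (\<lambda>x. c *\<^sub>R x) ` (T :: 'a::real_vector set)"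
proof
  show "(\<lambda>x. c *\<^sub>R x) ` (S + T) \<subseteq> (\<lambda>x. c *\<^sub>R x) ` S + (\<lambda>x. c *\<^sub>R x) ` T"
    by (auto simp: set_plus_def scaleR_add_right) blast
  show "(\<lambda>x. c *\<^sub>R x) ` S + (\<lambda>x. c *\<^sub>R x) ` T \<subseteq> (\<lambda>x. c *\<^sub>R x) ` (S + T)"
  proof
    fix x assume "x \<in> (\<lambda>x. c *\<^sub>R x) ` S + (\<lambda>x. c *\<^sub>R x) ` T"
    then obtain a b where "a \<in> S" "b \<in> T" "x = c *\<^sub>R (a + b)"
      by (auto simp: set_plus_def scaleR_add_right)
    then show "x \<in> (\<lambda>x. c *\<^sub>R x) ` (S + T)" by blast
  qed
qed

lemma scale_set_sum:
  "finite I \<Longrightarrow> (\<lambda>x. c *\<^sub>R x) ` (\<Sum>i\<in>I. S i) = (\<Sum>i\<in>I. (\<lambda>x. c *\<^sub>R x) ` (S i :: 'a::real_vector set))"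
  by (induction I rule: finite_induct) (auto simp: scale_set_plus)

lemma scale_closed_segment: "(\<lambda>x. c *\<^sub>R x) ` closed_segment a b = closed_segment (c *\<^sub>R a) (c *\<^sub>R (b::'a::real_vector))"
  by (rule closed_segment_linear_image[symmetric]) (rule linear_scale_self)

lemma vol_scale:
  assumes "compact (S :: (real^'n) set)" "0 \<le> c"
  shows "vol ((\<lambda>x. c *\<^sub>R x) ` S) = c ^ CARD('n) * vol S"
  using assms measure_lebesgue_affine[of c 0 S]
  by (simp add: vol_eq_lebesgue compact_scaling)

text \<open>Scaling all segments by \<open>N\<close> multiplies the volume by \<open>N ^ CARD('n)\<close>. Comparing coefficients of
  polynomials in \<open>N\<close>, only the subsets of this size remain.\<close>

lemma vol_sum_segments_eq_coeff:
  assumes "finite I"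
  shows "vol (\<Sum>i\<in>I. closed_segment 0 (y i :: real^'n))
       = (\<Sum>J\<in>{J. J \<subseteq> I \<and> card J = CARD('n)}. seg_coeff {0} y J)"
proof -
  let ?n = "CARD('n)"
  define S where "S = (\<Sum>i\<in>I. closed_segment 0 (y i))"
  have cS: "compact S" unfolding S_def by (intro compact_set_sum) auto
  define p where "p = (\<Sum>J\<in>Pow I. monom (seg_coeff {0} y J) (card J)) - monom (vol S) ?n"
  have root: "poly p (real N) = 0" for N
  proof -
    have "{0} + (\<Sum>i\<in>I. closed_segment 0 (real N *\<^sub>R y i)) = (\<lambda>x. real N *\<^sub>R x) ` S"
      unfolding S_def using assms by (simp add: scale_set_sum scale_closed_segment set_plus_singleton_0)
    then have "(\<Sum>J\<in>Pow I. real N ^ card J * seg_coeff {0} y J) = real N ^ ?n * vol S"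
      using vol_plus_segments_expansion[OF assms, of "{0}" N y] vol_scale[OF cS, of "real N"] by simp
    then show ?thesis by (simp add: p_def poly_sum poly_monom mult.commute)
  qed
  have "p = 0"
  proof (rule ccontr)
    assume "p \<noteq> 0"
    then have "finite {x. poly p x = 0}" by (rule poly_roots_finite)
    moreover have "range real \<subseteq> {x. poly p x = 0}" using root by auto
    ultimately have "finite (range real)" by (rule finite_subset[rotated])
    then show False using finite_imageD[of real UNIV] by (auto simp: inj_on_def)
  qed
  then have "coeff p ?n = 0" by simp
  then have "vol S = (\<Sum>J\<in>Pow I. if card J = ?n then seg_coeff {0} y J else 0)"
    by (simp add: p_def coeff_sum)
  also have "\<dots> = (\<Sum>J\<in>{J\<in>Pow I. card J = ?n}. seg_coeff {0} y J)"
    using assms by (intro sum.inter_filter[symmetric]) auto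
  finally show ?thesis unfolding S_def by simp
qed

lemma vol_sum_segments_eq_parallelepipeds:
  assumes "finite I"
  shows "vol (\<Sum>i\<in>I. closed_segment 0 (y i :: real^'n))
       = (\<Sum>J\<in>{J. J \<subseteq> I \<and> card J = CARD('n)}. vol (\<Sum>i\<in>J. closed_segment 0 (y i)))"
proof -
  have "vol (\<Sum>i\<in>J. closed_segment 0 (y i)) = seg_coeff {0} y J"
    if "J \<subseteq> I" "card J = CARD('n)" for J
  proof -
    have fin: "finite J" using that assms finite_subset by auto
    have "{J'. J' \<subseteq> J \<and> card J' = CARD('n)} = {J}"
      using that(2) card_subset_eq[OF fin] by auto
    then show ?thesis using vol_sum_segments_eq_coeff[OF fin, of y] by simp
  qed
  then show ?thesis unfolding vol_sum_segments_eq_coeff[OF assms] by (intro sum.cong) auto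
qed

lemma vol_parallelepiped:
  "vol (\<Sum>k\<in>UNIV. closed_segment 0 (y k :: real^'n)) = \<bar>rdet y\<bar>"
proof -
  define f where "f t = (\<Sum>k\<in>UNIV. t $ k *\<^sub>R y k)" for t :: "real^'n"
  have lin: "linear f"
    by (rule linearI) (simp_all add: f_def scaleR_left_distrib sum.distrib scaleR_right.sum)
  have "(\<Sum>k\<in>UNIV. closed_segment 0 (y k)) = f ` cbox 0 1"
  proof (intro set_eqI iffI)
    fix x assume "x \<in> (\<Sum>k\<in>UNIV. closed_segment 0 (y k))"
    then obtain s where s: "x = (\<Sum>k\<in>UNIV. s k)" "\<And>k. s k \<in> closed_segment 0 (y k)"
      by (auto simp: set_sum_alt)
    then have "\<forall>k. \<exists>u. 0 \<le> u \<and> u \<le> 1 \<and> s k = u *\<^sub>R y k" by (auto simp: closed_segment_def)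
    then obtain u where u: "\<And>k. 0 \<le> u k \<and> u k \<le> 1 \<and> s k = u k *\<^sub>R y k" by metis
    then have "x = f (\<chi> k. u k)" using s by (simp add: f_def)
    moreover have "(\<chi> k. u k) \<in> cbox 0 1" using u by (simp add: mem_box_cart)
    ultimately show "x \<in> f ` cbox 0 1" by blast
  next
    fix x assume "x \<in> f ` cbox 0 1"
    then obtain t where "x = f t" "\<And>k. 0 \<le> t $ k \<and> t $ k \<le> 1" by (auto simp: mem_box_cart)
    then have "x = (\<Sum>k\<in>UNIV. t $ k *\<^sub>R y k) \<and> (\<forall>k\<in>UNIV. t $ k *\<^sub>R y k \<in> closed_segment 0 (y k))"
      by (auto simp: f_def closed_segment_def)
    then show "x \<in> (\<Sum>k\<in>UNIV. closed_segment 0 (y k))"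
      unfolding set_sum_alt[OF finite_class.finite_UNIV] by blast
  qed
  then have "vol (\<Sum>k\<in>UNIV. closed_segment 0 (y k)) = \<bar>det (matrix f)\<bar> * vol (cbox 0 1 :: (real^'n) set)"
    using vol_linear_image[OF lin compact_cbox] by simp
  also have "vol (cbox 0 1 :: (real^'n) set) = 1"
  proof -
    have "(0 :: real^'n) \<in> cbox 0 1" by (simp add: mem_box_cart)
    then have "cbox 0 (1 :: real^'n) \<noteq> {}" by blast
    from content_cbox_cart[OF this] show ?thesis by simp
  qed
  also have "matrix f = transpose (\<chi> k. y k)"
  proof -
    have "f (axis j 1) = y j" for j
    proof -
      have "f (axis j 1) = (\<Sum>k\<in>UNIV. if k = j then y k else 0)"
        unfolding f_def by (intro sum.cong) (auto simp: axis_def)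
      then show ?thesis by simp
    qed
    then show ?thesis by (simp add: matrix_def transpose_def vec_eq_iff)
  qed
  finally show ?thesis by simp
qed

lemma card_bij_betw_UNIV:
  assumes "finite J" "card J = CARD('n::finite)"
  shows "card {f :: 'n \<Rightarrow> 'i. bij_betw f UNIV J} = fact CARD('n)"
proof -
  obtain g :: "'n \<Rightarrow> 'i" where g: "bij_betw g UNIV J"
    using finite_same_card_bij[of "UNIV :: 'n set" J] assms by auto
  have "bij_betw (\<lambda>p. g \<circ> p) {p :: 'n \<Rightarrow> 'n. p permutes UNIV} {f. bij_betw f UNIV J}"
  proof (rule bij_betwI[where g = "\<lambda>f. inv_into UNIV g \<circ> f"])
    show "(\<lambda>p. g \<circ> p) \<in> {p :: 'n \<Rightarrow> 'n. p permutes UNIV} \<rightarrow> {f. bij_betw f UNIV J}"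
      using bij_betw_trans[OF permutes_imp_bij g] by auto
    show "(\<lambda>f. inv_into UNIV g \<circ> f) \<in> {f. bij_betw f UNIV J} \<rightarrow> {p. p permutes UNIV}"
      using bij_betw_inv_into[OF g] by (auto intro!: bij_imp_permutes intro: bij_betw_trans)
    show "inv_into UNIV g \<circ> (g \<circ> p) = p" for p
      using g by (auto simp: fun_eq_iff bij_betw_def)
    show "g \<circ> (inv_into UNIV g \<circ> f) = f" if "f \<in> {f. bij_betw f UNIV J}" for f
      using g that by (auto simp: fun_eq_iff bij_betw_def) (metis f_inv_into_f rangeI)
  qed
  then have "card {f :: 'n \<Rightarrow> 'i. bij_betw f UNIV J} = card {p :: 'n \<Rightarrow> 'n. p permutes UNIV}"
    by (simp add: bij_betw_same_card)
  then show ?thesis using card_permutations[of "UNIV :: 'n set"] by simp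
qed

lemma rdet_eq_0_if_not_inj:
  assumes "\<not> inj f" shows "rdet (\<lambda>k. y (f k)) = 0"
proof -
  obtain i j where "i \<noteq> j" "f i = f j" using assms by (auto simp: inj_on_def)
  then show ?thesis by (intro det_identical_rows[of i j]) (auto simp: row_def)
qed

text \<open>The volume is the sum of the volumes of the parallelepipeds spanned by \<open>CARD('n)\<close> distinct segments. The
  sum over all \<open>f\<close> counts each choice of segments once for every ordering, which the factorial
  compensates, and a repeated segment gives determinant zero.\<close>

theorem vol_zonotope:
  fixes x :: "'i \<Rightarrow> real^'n"
  assumes "finite I"
  shows "vol (\<Sum>i\<in>I. closed_segment (- x i) (x i))
       = 2 ^ CARD('n) / fact CARD('n) * (\<Sum>f\<in>UNIV \<rightarrow>\<^sub>E I. \<bar>rdet (\<lambda>k. x (f k))\<bar>)"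
proof -
  let ?n = "CARD('n)"
  let ?y = "\<lambda>i. 2 *\<^sub>R x i"
  let ?\<J> = "{J. J \<subseteq> I \<and> card J = ?n}"
  have fin: "finite ((UNIV :: 'n set) \<rightarrow>\<^sub>E I)" using assms by (intro finite_PiE) auto
  have sh: "closed_segment (- x i) (x i) = (+) (- x i) ` closed_segment 0 (?y i)" for i
    using closed_segment_translation[of "- x i" 0 "?y i"] by (simp add: scaleR_2)
  have "(\<Sum>i\<in>I. closed_segment (- x i) (x i)) = (+) (\<Sum>i\<in>I. - x i) ` (\<Sum>i\<in>I. closed_segment 0 (?y i))"
    using assms
  proof (induction I rule: finite_induct)
    case (insert i I)
    show ?case using insert sh[of i] by (auto simp: set_plus_def image_iff) (force simp: algebra_simps)+
  qed auto
  then have "vol (\<Sum>i\<in>I. closed_segment (- x i) (x i)) = vol (\<Sum>i\<in>I. closed_segment 0 (?y i))"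
    by (simp add: vol_translate compact_set_sum)
  also have "\<dots> = (\<Sum>J\<in>?\<J>. vol (\<Sum>i\<in>J. closed_segment 0 (?y i)))"
    by (rule vol_sum_segments_eq_parallelepipeds[OF assms])
  also have "\<dots> = (\<Sum>J\<in>?\<J>. 2 ^ ?n / fact ?n * (\<Sum>f\<in>{f. bij_betw f UNIV J}. \<bar>rdet (\<lambda>k. x (f k))\<bar>))"
  proof (rule sum.cong[OF refl])
    fix J assume "J \<in> ?\<J>"
    then have J: "finite J" "card J = ?n" using assms finite_subset by auto
    have "2 ^ ?n * \<bar>rdet (\<lambda>k. x (f k))\<bar> = vol (\<Sum>i\<in>J. closed_segment 0 (?y i))"
      if "f \<in> {f. bij_betw f UNIV J}" for f :: "'n \<Rightarrow> 'i"
    proof -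
      have "(\<Sum>i\<in>J. closed_segment 0 (?y i)) = (\<Sum>k\<in>UNIV. closed_segment 0 (?y (f k)))"
        using sum.reindex_bij_betw[of f UNIV J "\<lambda>i. closed_segment 0 (?y i)"] that by simp
      then have "vol (\<Sum>i\<in>J. closed_segment 0 (?y i)) = \<bar>rdet (\<lambda>k. 2 *s x (f k))\<bar>"
        using vol_parallelepiped[of "\<lambda>k. ?y (f k)"] by (simp add: scalar_mult_eq_scaleR)
      also have "\<dots> = 2 ^ ?n * \<bar>rdet (\<lambda>k. x (f k))\<bar>"
        using det_rows_mul[of "\<lambda>_. 2" "\<lambda>k. x (f k)"] by (simp add: abs_mult)
      finally show ?thesis by simp
    qed
    then have "(\<Sum>f\<in>{f :: 'n \<Rightarrow> 'i. bij_betw f UNIV J}. 2 ^ ?n * \<bar>rdet (\<lambda>k. x (f k))\<bar>)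
        = fact ?n * vol (\<Sum>i\<in>J. closed_segment 0 (?y i))"
      using card_bij_betw_UNIV[OF J] by simp
    then show "vol (\<Sum>i\<in>J. closed_segment 0 (?y i))
        = 2 ^ ?n / fact ?n * (\<Sum>f\<in>{f. bij_betw f UNIV J}. \<bar>rdet (\<lambda>k. x (f k))\<bar>)"
      by (simp add: sum_distrib_left[symmetric] field_simps)
  qed
  also have "\<dots> = 2 ^ ?n / fact ?n * (\<Sum>J\<in>?\<J>. \<Sum>f\<in>{f. bij_betw f UNIV J}. \<bar>rdet (\<lambda>k. x (f k))\<bar>)"
    by (simp add: sum_distrib_left)
  also have "(\<Sum>J\<in>?\<J>. \<Sum>f\<in>{f. bij_betw f UNIV J}. \<bar>rdet (\<lambda>k. x (f k))\<bar>)
      = (\<Sum>f\<in>{f\<in>UNIV \<rightarrow>\<^sub>E I. inj f}. \<bar>rdet (\<lambda>k. x (f k))\<bar>)"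
  proof -
    have "(\<Sum>J\<in>?\<J>. \<Sum>f\<in>{f. bij_betw f UNIV J}. \<bar>rdet (\<lambda>k. x (f k))\<bar>)
      = (\<Sum>J\<in>?\<J>. \<Sum>f\<in>{f\<in>{f\<in>UNIV \<rightarrow>\<^sub>E I. inj f}. range f = J}. \<bar>rdet (\<lambda>k. x (f k))\<bar>)"
      by (intro sum.cong refl) (auto simp: bij_betw_def PiE_def extensional_def)
    also have "\<dots> = (\<Sum>f\<in>{f\<in>UNIV \<rightarrow>\<^sub>E I. inj f}. \<bar>rdet (\<lambda>k. x (f k))\<bar>)"
      using assms fin by (intro sum.group) (auto simp: card_image)
    finally show ?thesis .
  qed
  also have "\<dots> = (\<Sum>f\<in>UNIV \<rightarrow>\<^sub>E I. \<bar>rdet (\<lambda>k. x (f k))\<bar>)"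
    using fin by (intro sum.mono_neutral_left) (auto simp: rdet_eq_0_if_not_inj)
  finally show ?thesis .
qed

section \<open>Support functions\<close>

lemma bdd_above_inner: "compact K \<Longrightarrow> bdd_above ((\<lambda>x. x \<bullet> u) ` (K :: (real^'n) set))"
  by (intro bounded_imp_bdd_above compact_imp_bounded compact_continuous_image continuous_intros)

lemma inner_le_support:
  assumes "compact K" "x \<in> K" shows "x \<bullet> u \<le> support_function K u"
  unfolding support_function_def using bdd_above_inner[OF assms(1)] assms(2) by (rule cSUP_upper[rotated])

lemma support_le:
  assumes "K \<noteq> {}" "\<And>x. x \<in> K \<Longrightarrow> x \<bullet> u \<le> b" shows "support_function K u \<le> b"
  unfolding support_function_def using assms by (rule cSUP_least)

lemma support_attained:
  assumes "compact K" "K \<noteq> {}" obtains x where "x \<in> K" "support_function K u = x \<bullet> u"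
proof -
  have "\<exists>x\<in>K. \<forall>y\<in>K. y \<bullet> u \<le> x \<bullet> u"
    using assms by (intro continuous_attains_sup continuous_intros)
  then obtain x where x: "x \<in> K" "\<forall>y\<in>K. y \<bullet> u \<le> x \<bullet> u" by blast
  then have "support_function K u = x \<bullet> u"
    using assms support_le[OF assms(2), of u "x \<bullet> u"] inner_le_support[OF assms(1) x(1), of u] by force
  with x(1) show ?thesis by (rule that)
qed

lemma set_plus_nonempty: "K \<noteq> {} \<Longrightarrow> L \<noteq> {} \<Longrightarrow> K + L \<noteq> {}"
  using set_plus_intro by fast

lemma support_plus:
  assumes "compact K" "K \<noteq> {}" "compact L" "L \<noteq> {}"
  shows "support_function (K + L) u = support_function K u + support_function L u"
proof (rule antisym)
  show "support_function (K + L) u \<le> support_function K u + support_function L u"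
  proof (rule support_le)
    show "K + L \<noteq> {}" using assms by (simp add: set_plus_nonempty)
    fix x assume "x \<in> K + L"
    then show "x \<bullet> u \<le> support_function K u + support_function L u"
      using inner_le_support[OF assms(1)] inner_le_support[OF assms(3)]
      by (auto simp: set_plus_def inner_add_left intro!: add_mono)
  qed
  obtain x y where "x \<in> K" "support_function K u = x \<bullet> u" "y \<in> L" "support_function L u = y \<bullet> u"
    using support_attained[OF assms(1,2)] support_attained[OF assms(3,4)] by metis
  then show "support_function K u + support_function L u \<le> support_function (K + L) u"
    using inner_le_support[OF compact_set_plus[OF assms(1,3)], of "x + y" u]
    by (auto simp: inner_add_left)
qed

lemma support_zero: "support_function {0} u = 0"
  by (simp add: support_function_def)

lemma support_sum:
  assumes "finite I" "\<And>i. i \<in> I \<Longrightarrow> compact (K i)" "\<And>i. i \<in> I \<Longrightarrow> K i \<noteq> {}"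
  shows "support_function (\<Sum>i\<in>I. K i) u = (\<Sum>i\<in>I. support_function (K i) u)"
    and "(\<Sum>i\<in>I. K i) \<noteq> ({} :: (real^'n) set)"
proof -
  have "support_function (\<Sum>i\<in>I. K i) u = (\<Sum>i\<in>I. support_function (K i) u)
      \<and> (\<Sum>i\<in>I. K i) \<noteq> ({} :: (real^'n) set)"
    using assms
  proof (induction I rule: finite_induct)
    case empty then show ?case using support_zero by (simp add: set_zero)
  next
    case (insert i I)
    then have "support_function (K i + (\<Sum>i\<in>I. K i)) u = support_function (K i) u + support_function (\<Sum>i\<in>I. K i) u"
      by (intro support_plus compact_set_sum) auto
    moreover have "K i + (\<Sum>i\<in>I. K i) \<noteq> {}" using insert by (intro set_plus_nonempty) auto
    ultimately show ?case using insert by simp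
  qed
  then show "support_function (\<Sum>i\<in>I. K i) u = (\<Sum>i\<in>I. support_function (K i) u)"
    "(\<Sum>i\<in>I. K i) \<noteq> ({} :: (real^'n) set)" by auto
qed

lemma support_scale:
  assumes "compact K" "K \<noteq> {}" "0 \<le> c"
  shows "support_function ((\<lambda>x. c *\<^sub>R x) ` K) u = c * support_function K u"
proof (rule antisym)
  show "support_function ((\<lambda>x. c *\<^sub>R x) ` K) u \<le> c * support_function K u"
    using assms inner_le_support[OF assms(1), of _ u] by (intro support_le) (auto intro!: mult_left_mono)
  obtain x where x: "x \<in> K" "support_function K u = x \<bullet> u" using support_attained[OF assms(1,2)] .
  then show "c * support_function K u \<le> support_function ((\<lambda>x. c *\<^sub>R x) ` K) u"
    using inner_le_support[OF compact_scaling[OF assms(1)], of "c *\<^sub>R x" c u] by auto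
qed

lemma support_segment: "support_function (closed_segment (- x) x) u = \<bar>u \<bullet> x\<bar>"
proof (rule antisym)
  show "support_function (closed_segment (- x) x) u \<le> \<bar>u \<bullet> x\<bar>"
  proof (rule support_le)
    fix y assume "y \<in> closed_segment (- x) x"
    then obtain t where t: "0 \<le> t" "t \<le> 1" "y = (1 - t) *\<^sub>R (- x) + t *\<^sub>R x"
      by (auto simp: closed_segment_def)
    have "y \<bullet> u = (2 * t - 1) * (u \<bullet> x)"
      unfolding t(3) inner_add_left inner_scaleR_left inner_minus_left inner_commute[of x u]
      by (simp add: algebra_simps)
    also have "\<dots> \<le> \<bar>2 * t - 1\<bar> * \<bar>u \<bullet> x\<bar>" by (metis abs_ge_self abs_mult)
    also have "\<dots> \<le> 1 * \<bar>u \<bullet> x\<bar>" using t by (intro mult_right_mono) auto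
    finally show "y \<bullet> u \<le> \<bar>u \<bullet> x\<bar>" by simp
  qed auto
  have "x \<in> closed_segment (- x) x" "- x \<in> closed_segment (- x) x" by auto
  from inner_le_support[OF compact_segment this(1), of u] inner_le_support[OF compact_segment this(2), of u]
  show "\<bar>u \<bullet> x\<bar> \<le> support_function (closed_segment (- x) x) u"
    unfolding inner_commute[of u x] inner_minus_left by (rule abs_leI)
qed

lemma subset_if_support_le:
  fixes K L :: "(real^'n) set"
  assumes K: "compact K" and L: "closed L" "convex L" "L \<noteq> {}" "compact L"
    and le: "\<And>u. support_function K u \<le> support_function L u"
  shows "K \<subseteq> L"
proof (rule ccontr)
  assume "\<not> K \<subseteq> L"
  then obtain z where z: "z \<in> K" "z \<notin> L" by blast
  obtain a b where ab: "a \<bullet> z < b" "\<forall>x\<in>L. b < a \<bullet> x"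
    using separating_hyperplane_closed_point[OF L(2,1) z(2)] by blast
  obtain x where x: "x \<in> L" "support_function L (- a) = x \<bullet> (- a)"
    using support_attained[OF L(4,3)] .
  have "z \<bullet> (- a) \<le> support_function K (- a)" by (rule inner_le_support[OF K z(1)])
  also have "\<dots> \<le> x \<bullet> (- a)" using le[of "- a"] x(2) by simp
  finally show False using ab x(1) by (force simp: inner_commute)
qed

section \<open>Generating measures of zonoids\<close>

text \<open>The generating measure of a zonoid is normalized to a probability measure by moving its mass into the
  lengths of the vectors. The integral formulas below are then expectations over independent random
  vectors, and product measures can be used freely.\<close>

definition gen_measure :: "(real^'n) measure \<Rightarrow> bool" where
  "gen_measure \<mu> \<longleftrightarrow> prob_space \<mu> \<and> sets \<mu> = sets borel \<and> integrable \<mu> norm"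

definition generates :: "(real^'n) measure \<Rightarrow> (real^'n) set \<Rightarrow> bool" where
  "generates \<mu> Z \<longleftrightarrow> gen_measure \<mu> \<and> (\<forall>u. support_function Z u = (\<integral>v. \<bar>u \<bullet> v\<bar> \<partial>\<mu>))"

lemma gen_measureD:
  assumes "gen_measure \<mu>"
  shows "prob_space \<mu>" "sets \<mu> = sets borel" "integrable \<mu> norm"
  using assms by (auto simp: gen_measure_def)

lemma gen_measurable: "gen_measure \<mu> \<Longrightarrow> f \<in> borel_measurable borel \<Longrightarrow> f \<in> borel_measurable \<mu>"
  using measurable_cong_sets[of \<mu> borel borel borel] by (auto dest: gen_measureD)

lemma gen_integrable_le:
  fixes f :: "real^'n \<Rightarrow> real"
  assumes "gen_measure \<mu>" "f \<in> borel_measurable borel" "\<And>x. \<bar>f x\<bar> \<le> C * norm x"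
  shows "integrable \<mu> f"
proof (rule Bochner_Integration.integrable_bound)
  show "integrable \<mu> (\<lambda>x. C * norm x)" using gen_measureD(3)[OF assms(1)] by simp
  show "f \<in> borel_measurable \<mu>" using assms gen_measurable by blast
  show "AE x in \<mu>. norm (f x) \<le> norm (C * norm x)"
    using assms(3) by (intro always_eventually allI) (metis abs_ge_self order_trans real_norm_def)
qed

lemma gen_integrable_inner: "gen_measure \<mu> \<Longrightarrow> integrable \<mu> (\<lambda>v. \<bar>u \<bullet> v\<bar>)"
  by (rule gen_integrable_le[where C="norm u"]) (auto simp: Cauchy_Schwarz_ineq2)

lemma product_prob_space_gen: "(\<And>k. gen_measure (\<mu> k)) \<Longrightarrow> product_prob_space \<mu>"
  by (rule product_prob_spaceI) (auto simp: gen_measure_def)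

lemma gen_component [measurable]:
  assumes "\<And>k. gen_measure (\<mu> k)"
  shows "(\<lambda>v. v k) \<in> borel_measurable (PiM UNIV \<mu>)"
  using measurable_component_singleton[of k UNIV \<mu>] gen_measureD(2)[OF assms[of k]]
  by (simp cong: measurable_cong_sets)

lemma gen_integrable_prod_norm:
  fixes \<mu> :: "'n::finite \<Rightarrow> (real^'n) measure"
  assumes "\<And>k. gen_measure (\<mu> k)"
  shows "integrable (PiM UNIV \<mu>) (\<lambda>v. \<Prod>k\<in>A. norm (v k))"
proof -
  interpret product_prob_space \<mu> UNIV by (rule product_prob_space_gen[OF assms])
  interpret p: prob_space "\<mu> k" for k by (rule gen_measureD[OF assms])
  have "integrable (PiM UNIV \<mu>) (\<lambda>v. \<Prod>k\<in>UNIV. (if k \<in> A then norm (v k) else 1))"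
  proof (rule product_integrable_prod)
    show "integrable (\<mu> k) (\<lambda>x. if k \<in> A then norm x else 1)" for k
      using gen_measureD(3)[OF assms] by (cases "k \<in> A") auto
  qed simp
  moreover have "(\<Prod>k\<in>UNIV. (if k \<in> A then norm (v k) else 1)) = (\<Prod>k\<in>A. norm (v k))" for v :: "'n \<Rightarrow> real^'n"
    by (simp add: prod.If_cases)
  ultimately show ?thesis by simp
qed

lemma gen_measurable_rdet:
  assumes "\<And>k. gen_measure (\<mu> k)" "\<And>k. F k \<in> borel_measurable borel"
  shows "(\<lambda>v. rdet (\<lambda>k. F k (v k))) \<in> borel_measurable (PiM UNIV \<mu>)"
  using assms measurable_compose[OF gen_component[OF assms(1)] assms(2)]
  by (intro borel_measurable_rdet) auto

lemma gen_integrable_rdet: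
  fixes \<mu> :: "'n::finite \<Rightarrow> (real^'n) measure"
  assumes "\<And>k. gen_measure (\<mu> k)"
  shows "integrable (PiM UNIV \<mu>) (\<lambda>v. \<bar>rdet v\<bar>)"
proof (rule Bochner_Integration.integrable_bound[OF gen_integrable_prod_norm[OF assms, where A=UNIV]])
  show "(\<lambda>v. \<bar>rdet v\<bar>) \<in> borel_measurable (PiM UNIV \<mu>)"
    using gen_measurable_rdet[OF assms, of "\<lambda>_ x. x"] by simp
  show "AE v in PiM UNIV \<mu>. norm \<bar>rdet v\<bar> \<le> norm (\<Prod>k\<in>UNIV. norm (v k))"
    using abs_rdet_le_prod_norm by (intro always_eventually allI) (simp add: prod_nonneg)
qed

lemma gen_measurable_pvol:
  assumes "\<And>k. gen_measure (\<mu> k)"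
  shows "(\<lambda>v. pvol A v) \<in> borel_measurable (PiM UNIV \<mu>)"
  using borel_measurable_pvol[of A "\<lambda>k v. v k" "PiM UNIV \<mu>", OF gen_component[OF assms]] by simp

lemma gen_integrable_pvol:
  fixes \<mu> :: "'n::finite \<Rightarrow> (real^'n) measure"
  assumes "\<And>k. gen_measure (\<mu> k)"
  shows "integrable (PiM UNIV \<mu>) (\<lambda>v. pvol A v)"
proof (rule Bochner_Integration.integrable_bound[OF gen_integrable_prod_norm[OF assms, where A=A]])
  show "(\<lambda>v. pvol A v) \<in> borel_measurable (PiM UNIV \<mu>)" by (rule gen_measurable_pvol[OF assms])
  show "AE v in PiM UNIV \<mu>. norm (pvol A v) \<le> norm (\<Prod>k\<in>A. norm (v k))"
    using pvol_le_prod_norm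
    by (intro always_eventually allI) (simp add: prod_nonneg abs_of_nonneg[OF pvol_nonneg])
qed

section \<open>The volume of a sum of zonoids\<close>

text \<open>A random vector with finitely many values: the integral becomes a finite sum as in the volume formula
  for zonotopes.\<close>

lemma integral_simple_rdet:
  fixes \<mu> :: "'n::finite \<Rightarrow> (real^'n) measure" and F :: "real^'n \<Rightarrow> real^'n"
  assumes \<mu>: "\<And>k. gen_measure (\<mu> k)" and F: "F \<in> borel_measurable borel" "finite (range F)"
  shows "(\<integral>v. \<bar>rdet (\<lambda>k. F (v k))\<bar> \<partial>PiM UNIV \<mu>)
       = (\<Sum>w\<in>UNIV \<rightarrow>\<^sub>E range F. (\<Prod>k\<in>UNIV. measure (\<mu> k) (F -` {w k})) * \<bar>rdet w\<bar>)"
proof -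
  interpret product_prob_space \<mu> UNIV by (rule product_prob_space_gen[OF \<mu>])
  interpret p: prob_space "\<mu> k" for k by (rule gen_measureD[OF \<mu>])
  have fin: "finite (UNIV \<rightarrow>\<^sub>E range F :: ('n \<Rightarrow> real^'n) set)" using F by (intro finite_PiE) auto
  have meas: "F -` {w} \<in> sets (\<mu> k)" for w k
    using measurable_sets[OF F(1), of "{w}"] gen_measureD(2)[OF \<mu>] by auto
  have int: "integrable (\<mu> k) (indicat_real (F -` {w}))" for w k
    using meas by (simp add: less_top[symmetric])
  have intp: "integrable (PiM UNIV \<mu>) (\<lambda>v. (\<Prod>k\<in>UNIV. indicat_real (F -` {w k}) (v k)))" for w
    using int by (intro product_integrable_prod) auto
  have "\<bar>rdet (\<lambda>k. F (v k))\<bar>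
      = (\<Sum>w\<in>UNIV \<rightarrow>\<^sub>E range F. (\<Prod>k\<in>UNIV. indicat_real (F -` {w k}) (v k)) * \<bar>rdet w\<bar>)" for v
  proof -
    have "(\<Sum>w\<in>UNIV \<rightarrow>\<^sub>E range F. (\<Prod>k\<in>UNIV. indicat_real (F -` {w k}) (v k)) * \<bar>rdet w\<bar>)
        = (\<Sum>w\<in>{\<lambda>k. F (v k)}. (\<Prod>k\<in>UNIV. indicat_real (F -` {w k}) (v k)) * \<bar>rdet w\<bar>)"
    proof (rule sum.mono_neutral_right[OF fin])
      show "{\<lambda>k. F (v k)} \<subseteq> UNIV \<rightarrow>\<^sub>E range F" by auto
      show "\<forall>w\<in>(UNIV \<rightarrow>\<^sub>E range F) - {\<lambda>k. F (v k)}. (\<Prod>k\<in>UNIV. indicat_real (F -` {w k}) (v k)) * \<bar>rdet w\<bar> = 0"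
      proof
        fix w assume "w \<in> (UNIV \<rightarrow>\<^sub>E range F) - {\<lambda>k. F (v k)}"
        then obtain k where "w k \<noteq> F (v k)" by auto
        then have "indicat_real (F -` {w k}) (v k) = 0" by auto
        then show "(\<Prod>k\<in>UNIV. indicat_real (F -` {w k}) (v k)) * \<bar>rdet w\<bar> = 0" by auto
      qed
    qed
    then show ?thesis by simp
  qed
  then have "(\<integral>v. \<bar>rdet (\<lambda>k. F (v k))\<bar> \<partial>PiM UNIV \<mu>)
      = (\<integral>v. (\<Sum>w\<in>UNIV \<rightarrow>\<^sub>E range F. (\<Prod>k\<in>UNIV. indicat_real (F -` {w k}) (v k)) * \<bar>rdet w\<bar>) \<partial>PiM UNIV \<mu>)"
    by simp
  also have "\<dots> = (\<Sum>w\<in>UNIV \<rightarrow>\<^sub>E range F. (\<integral>v. (\<Prod>k\<in>UNIV. indicat_real (F -` {w k}) (v k)) \<partial>PiM UNIV \<mu>) * \<bar>rdet w\<bar>)"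
    using intp by (subst Bochner_Integration.integral_sum) auto
  also have "\<dots> = (\<Sum>w\<in>UNIV \<rightarrow>\<^sub>E range F. (\<Prod>k\<in>UNIV. measure (\<mu> k) (F -` {w k})) * \<bar>rdet w\<bar>)"
  proof (rule sum.cong[OF refl])
    fix w
    have "(\<integral>v. (\<Prod>k\<in>UNIV. indicat_real (F -` {w k}) (v k)) \<partial>PiM UNIV \<mu>)
        = (\<Prod>k\<in>UNIV. \<integral>x. indicat_real (F -` {w k}) x \<partial>\<mu> k)"
      using int by (intro product_integral_prod) auto
    also have "\<dots> = (\<Prod>k\<in>UNIV. measure (\<mu> k) (F -` {w k}))"
      using meas by (simp add: sets.Int_space_eq1)
    finally show "(\<integral>v. (\<Prod>k\<in>UNIV. indicat_real (F -` {w k}) (v k)) \<partial>PiM UNIV \<mu>) * \<bar>rdet w\<bar>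
        = (\<Prod>k\<in>UNIV. measure (\<mu> k) (F -` {w k})) * \<bar>rdet w\<bar>" by simp
  qed
  finally show ?thesis .
qed

lemma integral_simple_inner:
  fixes \<mu> :: "(real^'n) measure" and F :: "real^'n \<Rightarrow> real^'n"
  assumes \<mu>: "gen_measure \<mu>" and F: "F \<in> borel_measurable borel" "finite (range F)"
  shows "(\<integral>v. \<bar>u \<bullet> F v\<bar> \<partial>\<mu>) = (\<Sum>w\<in>range F. measure \<mu> (F -` {w}) * \<bar>u \<bullet> w\<bar>)"
proof -
  interpret p: prob_space \<mu> by (rule gen_measureD[OF \<mu>])
  have meas: "F -` {w} \<in> sets \<mu>" for w
    using measurable_sets[OF F(1), of "{w}"] gen_measureD(2)[OF \<mu>] by auto
  have "\<bar>u \<bullet> F v\<bar> = (\<Sum>w\<in>range F. indicat_real (F -` {w}) v * \<bar>u \<bullet> w\<bar>)" for v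
  proof -
    have "(\<Sum>w\<in>range F. indicat_real (F -` {w}) v * \<bar>u \<bullet> w\<bar>)
        = (\<Sum>w\<in>{F v}. indicat_real (F -` {w}) v * \<bar>u \<bullet> w\<bar>)"
      by (rule sum.mono_neutral_right[OF F(2)]) auto
    then show ?thesis by simp
  qed
  then have "(\<integral>v. \<bar>u \<bullet> F v\<bar> \<partial>\<mu>) = (\<integral>v. (\<Sum>w\<in>range F. indicat_real (F -` {w}) v * \<bar>u \<bullet> w\<bar>) \<partial>\<mu>)"
    by simp
  also have "\<dots> = (\<Sum>w\<in>range F. measure \<mu> (F -` {w}) * \<bar>u \<bullet> w\<bar>)"
    using meas by (subst Bochner_Integration.integral_sum) (auto simp: less_top[symmetric] sets.Int_space_eq1)
  finally show ?thesis .
qed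

lemma bij_betw_PiE_prod:
  "bij_betw (\<lambda>(f, w) k. (f k, w k)) (((UNIV::'n set) \<rightarrow>\<^sub>E I) \<times> (UNIV \<rightarrow>\<^sub>E R)) (UNIV \<rightarrow>\<^sub>E I \<times> R)"
  by (rule bij_betwI[where g = "\<lambda>g. (\<lambda>k. fst (g k), \<lambda>k. snd (g k))"]) (auto simp: PiE_def Pi_def mem_Times_iff)

text \<open>Replacing the random vector \<open>v\<close> by a simple function \<open>F v\<close> replaces the zonoids by zonotopes, in which
  the segment from \<open>- w\<close> to \<open>w\<close> is weighted by the probability that \<open>F v = w\<close>.\<close>

lemma discretized_zonoid_sum:
  fixes \<mu> :: "'i \<Rightarrow> (real^'n) measure" and F :: "real^'n \<Rightarrow> real^'n"
  assumes I: "finite I" and \<mu>: "\<And>i. i \<in> I \<Longrightarrow> gen_measure (\<mu> i)"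
    and c: "\<And>i. i \<in> I \<Longrightarrow> 0 \<le> c i"
    and F: "F \<in> borel_measurable borel" "finite (range F)"
  obtains K where "compact K" "convex K" "K \<noteq> {}"
    "\<And>u. support_function K u = (\<Sum>i\<in>I. c i * (\<integral>v. \<bar>u \<bullet> F v\<bar> \<partial>\<mu> i))"
    "vol K = 2 ^ CARD('n) / fact CARD('n) * (\<Sum>f\<in>UNIV \<rightarrow>\<^sub>E I. (\<Prod>k\<in>UNIV. c (f k)) *
        (\<integral>v. \<bar>rdet (\<lambda>k. F (v k))\<bar> \<partial>PiM UNIV (\<lambda>k. \<mu> (f k))))"
proof -
  define x where "x = (\<lambda>(i, w). (c i * measure (\<mu> i) (F -` {w})) *\<^sub>R w)"
  define K where "K = (\<Sum>p\<in>I \<times> range F. closed_segment (- x p) (x p))"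
  have fin: "finite (I \<times> range F)" using I F by simp
  show ?thesis
  proof (rule that[of K])
    show "compact K" "convex K" "K \<noteq> {}"
      unfolding K_def using fin support_sum(2)[OF fin, of "\<lambda>p. closed_segment (- x p) (x p)"]
      by (auto intro!: compact_set_sum convex_set_sum)
    fix u
    have "support_function K u = (\<Sum>p\<in>I \<times> range F. \<bar>u \<bullet> x p\<bar>)"
      unfolding K_def using support_sum(1)[OF fin, of "\<lambda>p. closed_segment (- x p) (x p)" u]
      by (simp add: support_segment)
    also have "\<dots> = (\<Sum>i\<in>I. \<Sum>w\<in>range F. \<bar>u \<bullet> x (i, w)\<bar>)"
      by (simp add: sum.cartesian_product split_def)
    also have "\<dots> = (\<Sum>i\<in>I. \<Sum>w\<in>range F. c i * (measure (\<mu> i) (F -` {w}) * \<bar>u \<bullet> w\<bar>))"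
      using c by (intro sum.cong refl) (auto simp: x_def abs_mult)
    also have "\<dots> = (\<Sum>i\<in>I. c i * (\<integral>v. \<bar>u \<bullet> F v\<bar> \<partial>\<mu> i))"
      using integral_simple_inner[OF \<mu> F] by (intro sum.cong refl) (simp add: sum_distrib_left)
    finally show "support_function K u = (\<Sum>i\<in>I. c i * (\<integral>v. \<bar>u \<bullet> F v\<bar> \<partial>\<mu> i))" .
  next
    have "(\<Sum>g\<in>UNIV \<rightarrow>\<^sub>E I \<times> range F. \<bar>rdet (\<lambda>k. x (g k))\<bar>)
        = (\<Sum>(f, w)\<in>(UNIV \<rightarrow>\<^sub>E I) \<times> (UNIV \<rightarrow>\<^sub>E range F). \<bar>rdet (\<lambda>k. x (f k, w k))\<bar>)"
      by (subst sum.reindex_bij_betw[OF bij_betw_PiE_prod, symmetric]) (simp add: case_prod_beta)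
    also have "\<dots> = (\<Sum>f\<in>UNIV \<rightarrow>\<^sub>E I. \<Sum>w\<in>UNIV \<rightarrow>\<^sub>E range F. \<bar>rdet (\<lambda>k. x (f k, w k))\<bar>)"
      by (rule sum.cartesian_product[symmetric])
    also have "\<dots> = (\<Sum>f\<in>UNIV \<rightarrow>\<^sub>E I. (\<Prod>k\<in>UNIV. c (f k)) *
        (\<integral>v. \<bar>rdet (\<lambda>k. F (v k))\<bar> \<partial>PiM UNIV (\<lambda>k. \<mu> (f k))))"
    proof (rule sum.cong[OF refl])
      fix f :: "'n \<Rightarrow> 'i" assume f: "f \<in> UNIV \<rightarrow>\<^sub>E I"
      have "\<bar>rdet (\<lambda>k. x (f k, w k))\<bar>
          = (\<Prod>k\<in>UNIV. c (f k)) * ((\<Prod>k\<in>UNIV. measure (\<mu> (f k)) (F -` {w k})) * \<bar>rdet w\<bar>)" for w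
      proof -
        have "rdet (\<lambda>k. x (f k, w k)) = rdet (\<lambda>k. (c (f k) * measure (\<mu> (f k)) (F -` {w k})) *s w k)"
          by (simp add: x_def scalar_mult_eq_scaleR)
        also have "\<dots> = (\<Prod>k\<in>UNIV. c (f k) * measure (\<mu> (f k)) (F -` {w k})) * rdet w"
          by (rule det_rows_mul)
        finally show ?thesis
          using c f by (simp add: abs_mult prod.distrib abs_prod PiE_def Pi_def)
      qed
      then show "(\<Sum>w\<in>UNIV \<rightarrow>\<^sub>E range F. \<bar>rdet (\<lambda>k. x (f k, w k))\<bar>)
          = (\<Prod>k\<in>UNIV. c (f k)) * (\<integral>v. \<bar>rdet (\<lambda>k. F (v k))\<bar> \<partial>PiM UNIV (\<lambda>k. \<mu> (f k)))"
        using integral_simple_rdet[of "\<lambda>k. \<mu> (f k)" F] \<mu> f F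
        by (simp add: sum_distrib_left PiE_def Pi_def)
    qed
    finally show "vol K = 2 ^ CARD('n) / fact CARD('n) * (\<Sum>f\<in>UNIV \<rightarrow>\<^sub>E I. (\<Prod>k\<in>UNIV. c (f k)) *
        (\<integral>v. \<bar>rdet (\<lambda>k. F (v k))\<bar> \<partial>PiM UNIV (\<lambda>k. \<mu> (f k))))"
      unfolding K_def vol_zonotope[OF fin] by simp
  qed
qed

text \<open>For the hyperplane orthogonal to \<open>u\<close>, the bound by heights over facets dominates the determinant by a
  sum of products each of which has one factor \<open>\<bar>u \<bullet> v k\<bar>\<close>, and so has integral zero.\<close>

lemma integral_abs_rdet_null:
  fixes \<mu> :: "'n::finite \<Rightarrow> (real^'n) measure"
  assumes \<mu>: "\<And>k. gen_measure (\<mu> k)" and u: "norm u = 1"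
    and null: "\<And>k. (\<integral>v. \<bar>u \<bullet> v\<bar> \<partial>\<mu> k) = 0"
  shows "(\<integral>v. \<bar>rdet v\<bar> \<partial>PiM UNIV \<mu>) = 0"
proof -
  interpret product_prob_space \<mu> UNIV by (rule product_prob_space_gen[OF \<mu>])
  let ?F = "{x. u \<bullet> x = 0}"
  have F: "subspace ?F" by (rule subspace_hyperplane)
  have dF: "dim ?F < card (UNIV :: 'n set)"
    using dim_hyperplane[of u] u by (metis DIM_positive One_nat_def DIM_cart DIM_real diff_Suc_less mult.right_neutral norm_zero zero_neq_one)
  have inf: "infdist x ?F \<le> \<bar>u \<bullet> x\<bar>" for x
  proof -
    have "x - (u \<bullet> x) *\<^sub>R u \<in> ?F" using u by (simp add: inner_diff_right norm_eq_1)
    from infdist_le[OF this, of x] show ?thesis using u by (simp add: dist_norm)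
  qed
  let ?g = "\<lambda>i v. (\<Prod>k\<in>UNIV. if k = i then \<bar>u \<bullet> v k\<bar> else norm (v k))"
  have le: "\<bar>rdet v\<bar> \<le> (\<Sum>i\<in>UNIV. ?g i v)" for v :: "'n \<Rightarrow> real^'n"
  proof -
    have "\<bar>rdet v\<bar> \<le> (\<Sum>i\<in>UNIV. infdist (v i) ?F * pvol (UNIV - {i}) v)"
      using pvol_le_sum_infdist[OF F dF, of v] by (simp add: pvol_UNIV)
    also have "\<dots> \<le> (\<Sum>i\<in>UNIV. \<bar>u \<bullet> v i\<bar> * (\<Prod>k\<in>UNIV - {i}. norm (v k)))"
      using inf pvol_le_prod_norm by (intro sum_mono mult_mono) (auto simp: pvol_nonneg)
    also have "\<dots> = (\<Sum>i\<in>UNIV. ?g i v)"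
    proof (rule sum.cong[OF refl])
      fix i :: 'n
      show "\<bar>u \<bullet> v i\<bar> * (\<Prod>k\<in>UNIV - {i}. norm (v k)) = ?g i v"
        by (subst prod.remove[of UNIV i]) (auto intro!: prod.cong)
    qed
    finally show ?thesis .
  qed
  have int: "integrable (\<mu> k) (\<lambda>x. if k = i then \<bar>u \<bullet> x\<bar> else norm x)" for k i
    using gen_integrable_inner[OF \<mu>] gen_measureD(3)[OF \<mu>] by (cases "k = i") auto
  have intg: "integrable (PiM UNIV \<mu>) (?g i)" for i
    using int by (intro product_integrable_prod) auto
  have "(\<integral>v. ?g i v \<partial>PiM UNIV \<mu>) = 0" for i
  proof -
    have "(\<integral>v. ?g i v \<partial>PiM UNIV \<mu>) = (\<Prod>k\<in>UNIV. \<integral>x. (if k = i then \<bar>u \<bullet> x\<bar> else norm x) \<partial>\<mu> k)"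
      using int by (intro product_integral_prod) auto
    also have "\<dots> = 0" using null[of i] by (intro prod_zero bexI[of _ i]) auto
    finally show ?thesis .
  qed
  then have "(\<integral>v. (\<Sum>i\<in>UNIV. ?g i v) \<partial>PiM UNIV \<mu>) = 0"
    using intg by (subst Bochner_Integration.integral_sum) auto
  moreover have "(\<integral>v. \<bar>rdet v\<bar> \<partial>PiM UNIV \<mu>) \<le> (\<integral>v. (\<Sum>i\<in>UNIV. ?g i v) \<partial>PiM UNIV \<mu>)"
    using intg le gen_integrable_rdet[OF \<mu>] by (intro integral_mono) auto
  moreover have "0 \<le> (\<integral>v. \<bar>rdet v\<bar> \<partial>PiM UNIV \<mu>)" by simp
  ultimately show ?thesis by linarith
qed

text \<open>Approximate by zonotopes. If the support function of the sum vanishes at some unit vector, the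
  sum lies in a hyperplane and both sides are zero. Otherwise it is at least some \<open>r > 0\<close> on the unit
  sphere; an approximating zonotope whose support function has uniform error \<open>\<delta>\<close> then lies between the
  dilates of the sum by \<open>1 - \<delta> / r\<close> and \<open>1 + \<delta> / r\<close>, which gives convergence of the volumes. The
  determinant integrals converge by dominated convergence.\<close>

theorem vol_zonoid_sum:
  fixes K :: "'i \<Rightarrow> (real^'n) set"
  assumes I: "finite I" and body: "\<And>i. i \<in> I \<Longrightarrow> convex_body (K i)"
    and gen: "\<And>i. i \<in> I \<Longrightarrow> generates (\<mu> i) (K i)" and c: "\<And>i. i \<in> I \<Longrightarrow> 0 \<le> c i"
  shows "vol (\<Sum>i\<in>I. (\<lambda>x. c i *\<^sub>R x) ` K i) = 2 ^ CARD('n) / fact CARD('n) *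
    (\<Sum>f\<in>UNIV \<rightarrow>\<^sub>E I. (\<Prod>k\<in>UNIV. c (f k)) * (\<integral>v. \<bar>rdet v\<bar> \<partial>PiM UNIV (\<lambda>k. \<mu> (f k))))"
    (is "vol ?S = ?rhs")
proof -
  let ?n = "CARD('n)"
  define S where "S = ?S"
  have \<mu>: "gen_measure (\<mu> i)" if "i \<in> I" for i using gen[OF that] by (simp add: generates_def)
  have cK: "compact ((\<lambda>x. c i *\<^sub>R x) ` K i)" "convex ((\<lambda>x. c i *\<^sub>R x) ` K i)" "(\<lambda>x. c i *\<^sub>R x) ` K i \<noteq> {}"
    if "i \<in> I" for i
    using body[OF that] by (auto simp: convex_body_def compact_scaling convex_scaling)
  have S: "compact S" "convex S" "S \<noteq> {}"
    unfolding S_def using cK support_sum(2)[OF I cK(1,3)]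
    by (auto intro!: compact_set_sum convex_set_sum)
  have hS: "support_function S u = (\<Sum>i\<in>I. c i * (\<integral>v. \<bar>u \<bullet> v\<bar> \<partial>\<mu> i))" for u
  proof -
    have "support_function S u = (\<Sum>i\<in>I. support_function ((\<lambda>x. c i *\<^sub>R x) ` K i) u)"
      unfolding S_def using cK I by (intro support_sum) auto
    also have "\<dots> = (\<Sum>i\<in>I. c i * (\<integral>v. \<bar>u \<bullet> v\<bar> \<partial>\<mu> i))"
      using body gen c by (intro sum.cong refl) (auto simp: support_scale convex_body_def generates_def)
    finally show ?thesis .
  qed
  have hS_nonneg: "0 \<le> support_function S u" for u
    unfolding hS using c by (intro sum_nonneg) auto
  show ?thesis
  proof (cases "\<exists>u. norm u = 1 \<and> support_function S u = 0")
    case True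
    then obtain u where u: "norm u = 1" "support_function S u = 0" by blast
    have "support_function S (- u) = 0" using u(2) unfolding hS by simp
    then have "u \<bullet> x = 0" if "x \<in> S" for x
      using inner_le_support[OF S(1) that, of u] inner_le_support[OF S(1) that, of "- u"] u(2)
      by (simp add: inner_commute)
    then have "negligible S"
      using u(1) by (intro negligible_subset[OF negligible_hyperplane[of u 0]]) auto
    then have v0: "vol S = 0" using negligible_imp_measure0 S(1) by (simp add: vol_eq_lebesgue)
    have "(\<Prod>k\<in>UNIV. c (f k)) * (\<integral>v. \<bar>rdet v\<bar> \<partial>PiM UNIV (\<lambda>k. \<mu> (f k))) = 0"
      if f: "f \<in> (UNIV :: 'n set) \<rightarrow>\<^sub>E I" for f
    proof (cases "\<exists>k. c (f k) = 0")
      case True then show ?thesis by (auto intro!: prod_zero)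
    next
      case False
      have nn: "\<forall>i\<in>I. 0 \<le> c i * (\<integral>v. \<bar>u \<bullet> v\<bar> \<partial>\<mu> i)" using c by auto
      have "\<forall>i\<in>I. c i * (\<integral>v. \<bar>u \<bullet> v\<bar> \<partial>\<mu> i) = 0"
        using u(2) nn sum_nonneg_eq_0_iff[OF I, of "\<lambda>i. c i * (\<integral>v. \<bar>u \<bullet> v\<bar> \<partial>\<mu> i)"] unfolding hS by blast
      then have "(\<integral>v. \<bar>u \<bullet> v\<bar> \<partial>\<mu> (f k)) = 0" for k using False f by (auto simp: PiE_def Pi_def)
      then have "(\<integral>v. \<bar>rdet v\<bar> \<partial>PiM UNIV (\<lambda>k. \<mu> (f k))) = 0"
        using \<mu> f u(1) by (intro integral_abs_rdet_null) (auto simp: PiE_def Pi_def)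
      then show ?thesis by simp
    qed
    then have "(\<Sum>f\<in>(UNIV :: 'n set) \<rightarrow>\<^sub>E I. (\<Prod>k\<in>UNIV. c (f k)) * (\<integral>v. \<bar>rdet v\<bar> \<partial>PiM UNIV (\<lambda>k. \<mu> (f k)))) = 0"
      by (intro sum.neutral) blast
    then show ?thesis using v0 unfolding S_def by (simp only: mult_zero_right)
  next
    case False
    \<comment> \<open>the support function is positive and continuous on the unit sphere\<close>
    have cont: "continuous_on (sphere 0 1) (support_function S)"
    proof -
      obtain B where B: "\<And>x. x \<in> S \<Longrightarrow> norm x \<le> B" "0 < B"
        using compact_imp_bounded[OF S(1)] by (auto simp: bounded_pos)
      have lip: "support_function S u - support_function S w \<le> B * norm (u - w)" for u w
      proof -
        obtain x where x: "x \<in> S" "support_function S u = x \<bullet> u" using support_attained[OF S(1,3)] .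
        have "x \<bullet> u - support_function S w \<le> x \<bullet> u - x \<bullet> w"
          using inner_le_support[OF S(1) x(1), of w] by simp
        also have "\<dots> = x \<bullet> (u - w)" by (simp add: inner_diff_right)
        also have "\<dots> \<le> norm x * norm (u - w)" by (rule norm_cauchy_schwarz)
        also have "\<dots> \<le> B * norm (u - w)" using B(1)[OF x(1)] by (intro mult_right_mono) auto
        finally show ?thesis using x(2) by simp
      qed
      have "B-lipschitz_on (sphere 0 1) (support_function S)"
      proof (rule lipschitz_onI)
        fix u w show "dist (support_function S u) (support_function S w) \<le> B * dist u w"
          using lip[of u w] lip[of w u] by (simp add: dist_norm norm_minus_commute abs_le_iff)
      qed (use B in simp)
      then show ?thesis by (rule lipschitz_on_continuous_on)
    qed
    have "sphere 0 1 \<noteq> ({} :: (real^'n) set)"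
      using norm_axis_1 by (metis dist_0_norm empty_iff mem_sphere)
    then obtain u0 where u0: "u0 \<in> sphere 0 1" "\<And>u. u \<in> sphere 0 1 \<Longrightarrow> support_function S u0 \<le> support_function S u"
      using continuous_attains_inf[OF compact_sphere _ cont] by blast
    define r where "r = support_function S u0"
    have r: "r > 0" using False u0(1) hS_nonneg[of u0] by (force simp: r_def less_le)
    have hr: "r * norm u \<le> support_function S u" for u
    proof (cases "u = 0")
      case True then show ?thesis using hS_nonneg[of 0] by simp
    next
      case False
      define w where "w = (1 / norm u) *\<^sub>R u"
      have "r \<le> support_function S w" using u0(2)[of w] False by (simp add: w_def r_def)
      moreover have "support_function S u = norm u * support_function S w"
        unfolding hS w_def using False by (simp add: sum_distrib_left abs_mult mult.left_commute)
      ultimately show ?thesis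
        using mult_left_mono[of r "support_function S w" "norm u"] by (simp add: mult.commute)
    qed
    obtain F :: "nat \<Rightarrow> real^'n \<Rightarrow> real^'n" where F: "\<And>N. simple_function borel (F N)"
        "\<And>x. (\<lambda>N. F N x) \<longlonglongrightarrow> x" "\<And>N x. norm (F N x) \<le> 2 * norm x"
      using borel_measurable_implies_sequence_metric[of "\<lambda>x::real^'n. x" borel 0] by auto
    have Fm: "F N \<in> borel_measurable borel" "finite (range (F N))" for N
      using F(1)[of N] borel_measurable_simple_function[OF F(1)] by (auto simp: simple_function_def)
    let ?D = "\<lambda>f N. (\<integral>v. \<bar>rdet (\<lambda>k. F N (v k))\<bar> \<partial>PiM UNIV (\<lambda>k. \<mu> (f k)))"
    define P where "P N X \<longleftrightarrow> compact X \<and> convex X \<and> X \<noteq> {} \<and>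
        (\<forall>u. support_function X u = (\<Sum>i\<in>I. c i * (\<integral>v. \<bar>u \<bullet> F N v\<bar> \<partial>\<mu> i))) \<and>
        vol X = 2 ^ ?n / fact ?n * (\<Sum>f\<in>UNIV \<rightarrow>\<^sub>E I. (\<Prod>k\<in>UNIV. c (f k)) * ?D f N)" for N X
    have "\<exists>X. P N X" for N
      unfolding P_def by (rule discretized_zonoid_sum[OF I \<mu> c Fm[of N]]) blast+
    then obtain L where PL: "\<And>N. P N (L N)" by metis
    have L: "\<And>N. compact (L N)" "\<And>N. convex (L N)" "\<And>N. L N \<noteq> {}"
        "\<And>N u. support_function (L N) u = (\<Sum>i\<in>I. c i * (\<integral>v. \<bar>u \<bullet> F N v\<bar> \<partial>\<mu> i))"
        "\<And>N. vol (L N) = 2 ^ ?n / fact ?n * (\<Sum>f\<in>UNIV \<rightarrow>\<^sub>E I. (\<Prod>k\<in>UNIV. c (f k)) * ?D f N)"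
      using PL unfolding P_def by blast+
    have limD: "?D f \<longlonglongrightarrow> (\<integral>v. \<bar>rdet v\<bar> \<partial>PiM UNIV (\<lambda>k. \<mu> (f k)))"
      if f: "f \<in> (UNIV :: 'n set) \<rightarrow>\<^sub>E I" for f
    proof -
      have g: "gen_measure (\<mu> (f k))" for k using \<mu> f by (auto simp: PiE_def Pi_def)
      show ?thesis
      proof (rule integral_dominated_convergence[where w = "\<lambda>v. \<Prod>k\<in>UNIV. 2 * norm (v k)"])
        show "(\<lambda>v. \<bar>rdet v\<bar>) \<in> borel_measurable (PiM UNIV (\<lambda>k. \<mu> (f k)))"
          using gen_measurable_rdet[of "\<lambda>k. \<mu> (f k)" "\<lambda>_ x. x"] g by simp
        show "(\<lambda>v. \<bar>rdet (\<lambda>k. F N (v k))\<bar>) \<in> borel_measurable (PiM UNIV (\<lambda>k. \<mu> (f k)))" for N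
          using gen_measurable_rdet[of "\<lambda>k. \<mu> (f k)" "\<lambda>_. F N"] g Fm by simp
        show "integrable (PiM UNIV (\<lambda>k. \<mu> (f k))) (\<lambda>v. \<Prod>k\<in>UNIV. 2 * norm (v k))"
          using gen_integrable_prod_norm[of "\<lambda>k. \<mu> (f k)" UNIV] g by (simp add: prod.distrib)
        have "(\<lambda>N. \<bar>rdet (\<lambda>k. F N (v k))\<bar>) \<longlonglongrightarrow> \<bar>rdet v\<bar>" for v :: "'n \<Rightarrow> real^'n"
          unfolding det_def by (auto intro!: tendsto_intros F(2))
        then show "AE v in PiM UNIV (\<lambda>k. \<mu> (f k)). (\<lambda>N. \<bar>rdet (\<lambda>k. F N (v k))\<bar>) \<longlonglongrightarrow> \<bar>rdet v\<bar>"
          by (intro always_eventually allI)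
        have "\<bar>rdet (\<lambda>k. F N (v k))\<bar> \<le> (\<Prod>k\<in>UNIV. 2 * norm (v k))" for N and v :: "'n \<Rightarrow> real^'n"
          by (rule order_trans[OF abs_rdet_le_prod_norm]) (auto intro!: prod_mono F(3))
        then show "AE v in PiM UNIV (\<lambda>k. \<mu> (f k)). norm \<bar>rdet (\<lambda>k. F N (v k))\<bar> \<le> (\<Prod>k\<in>UNIV. 2 * norm (v k))" for N
          by simp
      qed
    qed
    have lim1: "(\<lambda>N. vol (L N)) \<longlonglongrightarrow> ?rhs"
      unfolding L(5) by (intro tendsto_mult tendsto_const tendsto_sum limD) auto
    define \<delta> where "\<delta> N = (\<Sum>i\<in>I. c i * (\<integral>v. norm (F N v - v) \<partial>\<mu> i))" for N
    have int_diff: "integrable (\<mu> i) (\<lambda>v. norm (F N v - v))" if "i \<in> I" for i N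
    proof (rule gen_integrable_le[OF \<mu>[OF that], where C=3])
      show "(\<lambda>v. norm (F N v - v)) \<in> borel_measurable borel" using Fm by simp
      show "\<bar>norm (F N x - x)\<bar> \<le> 3 * norm x" for x
        using norm_triangle_ineq4[of "F N x" x] F(3)[of N x] by simp
    qed
    have lim\<delta>: "\<delta> \<longlonglongrightarrow> 0"
    proof -
      have "(\<lambda>N. \<integral>v. norm (F N v - v) \<partial>\<mu> i) \<longlonglongrightarrow> (\<integral>v. 0 \<partial>\<mu> i)" if i: "i \<in> I" for i
      proof (rule integral_dominated_convergence[where w = "\<lambda>v. 3 * norm v"])
        show "integrable (\<mu> i) (\<lambda>v. 3 * norm v)" using gen_measureD(3)[OF \<mu>[OF i]] by simp
        show "(\<lambda>v. norm (F N v - v)) \<in> borel_measurable (\<mu> i)" for N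
          using int_diff[OF i] by (rule borel_measurable_integrable)
        have "(\<lambda>N. norm (F N v - v)) \<longlonglongrightarrow> norm (v - v)" for v by (intro tendsto_intros F(2))
        then show "AE v in \<mu> i. (\<lambda>N. norm (F N v - v)) \<longlonglongrightarrow> 0" by simp
        have "norm (norm (F N v - v)) \<le> 3 * norm v" for N v
          using norm_triangle_ineq4[of "F N v" v] F(3)[of N v] by simp
        then show "AE v in \<mu> i. norm (norm (F N v - v)) \<le> 3 * norm v" for N by simp
      qed simp
      then have "\<delta> \<longlonglongrightarrow> (\<Sum>i\<in>I. c i * (\<integral>v. 0 \<partial>\<mu> i))"
        unfolding \<delta>_def by (intro tendsto_intros)
      then show ?thesis by simp
    qed
    have close: "\<bar>support_function (L N) u - support_function S u\<bar> \<le> \<delta> N * norm u" for N u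
    proof -
      have "\<bar>(\<integral>v. \<bar>u \<bullet> F N v\<bar> \<partial>\<mu> i) - (\<integral>v. \<bar>u \<bullet> v\<bar> \<partial>\<mu> i)\<bar> \<le> norm u * (\<integral>v. norm (F N v - v) \<partial>\<mu> i)"
        if i: "i \<in> I" for i
      proof -
        have i1: "integrable (\<mu> i) (\<lambda>v. \<bar>u \<bullet> F N v\<bar>)"
        proof (rule gen_integrable_le[OF \<mu>[OF i], where C="2 * norm u"])
          show "(\<lambda>v. \<bar>u \<bullet> F N v\<bar>) \<in> borel_measurable borel" using Fm by simp
          fix x show "\<bar>\<bar>u \<bullet> F N x\<bar>\<bar> \<le> 2 * norm u * norm x"
            using Cauchy_Schwarz_ineq2[of u "F N x"] mult_left_mono[OF F(3)[of N x], of "norm u"] by simp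
        qed
        note i2 = gen_integrable_inner[OF \<mu>[OF i], of u]
        have "(\<integral>v. \<bar>u \<bullet> F N v\<bar> \<partial>\<mu> i) - (\<integral>v. \<bar>u \<bullet> v\<bar> \<partial>\<mu> i) = (\<integral>v. \<bar>u \<bullet> F N v\<bar> - \<bar>u \<bullet> v\<bar> \<partial>\<mu> i)"
          using i1 i2 by simp
        also have "\<bar>\<dots>\<bar> \<le> (\<integral>v. norm u * norm (F N v - v) \<partial>\<mu> i)"
        proof -
          have pt: "norm (\<bar>u \<bullet> F N v\<bar> - \<bar>u \<bullet> v\<bar>) \<le> norm u * norm (F N v - v)" for v
            using Cauchy_Schwarz_ineq2[of u "F N v - v"] by (simp add: inner_diff_right)
          have "norm (\<integral>v. \<bar>u \<bullet> F N v\<bar> - \<bar>u \<bullet> v\<bar> \<partial>\<mu> i)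
              \<le> (\<integral>v. norm (\<bar>u \<bullet> F N v\<bar> - \<bar>u \<bullet> v\<bar>) \<partial>\<mu> i)"
            by (rule integral_norm_bound)
          also have "\<dots> \<le> (\<integral>v. norm u * norm (F N v - v) \<partial>\<mu> i)"
            using i1 i2 int_diff[OF i] pt by (intro integral_mono) auto
          finally have "norm (\<integral>v. \<bar>u \<bullet> F N v\<bar> - \<bar>u \<bullet> v\<bar> \<partial>\<mu> i)
              \<le> (\<integral>v. norm u * norm (F N v - v) \<partial>\<mu> i)" .
          then show ?thesis by simp
        qed
        finally show ?thesis by simp
      qed
      note one = this
      have "\<bar>support_function (L N) u - support_function S u\<bar>
          = \<bar>\<Sum>i\<in>I. c i * ((\<integral>v. \<bar>u \<bullet> F N v\<bar> \<partial>\<mu> i) - (\<integral>v. \<bar>u \<bullet> v\<bar> \<partial>\<mu> i))\<bar>"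
        unfolding L(4) hS by (simp add: sum_subtractf right_diff_distrib)
      also have "\<dots> \<le> (\<Sum>i\<in>I. c i * (norm u * (\<integral>v. norm (F N v - v) \<partial>\<mu> i)))"
        using c one by (intro order_trans[OF sum_abs] sum_mono) (auto simp: abs_mult intro!: mult_left_mono)
      also have "\<dots> = \<delta> N * norm u"
        unfolding \<delta>_def sum_distrib_right by (intro sum.cong refl) (simp add: mult_ac)
      finally show ?thesis .
    qed
    have \<delta>_nonneg: "0 \<le> \<delta> N" for N unfolding \<delta>_def using c by (intro sum_nonneg) auto
    have upper: "vol (L N) \<le> (1 + \<delta> N / r) ^ ?n * vol S" for N
    proof -
      have "L N \<subseteq> (\<lambda>x. (1 + \<delta> N / r) *\<^sub>R x) ` S"
      proof (rule subset_if_support_le)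
        fix u
        have "support_function (L N) u \<le> support_function S u + (\<delta> N / r) * (r * norm u)"
          using close[of N u] r by simp
        also have "\<dots> \<le> support_function S u + (\<delta> N / r) * support_function S u"
          using hr[of u] r \<delta>_nonneg by (intro add_left_mono mult_left_mono) auto
        also have "\<dots> = support_function ((\<lambda>x. (1 + \<delta> N / r) *\<^sub>R x) ` S) u"
          using S r \<delta>_nonneg[of N] by (subst support_scale) (auto simp: algebra_simps)
        finally show "support_function (L N) u \<le> support_function ((\<lambda>x. (1 + \<delta> N / r) *\<^sub>R x) ` S) u" .
      qed (use L S in \<open>auto simp: compact_imp_closed compact_scaling convex_scaling\<close>)
      then show ?thesis
        using vol_mono[of "(\<lambda>x. (1 + \<delta> N / r) *\<^sub>R x) ` S" "L N"] vol_scale[OF S(1), of "1 + \<delta> N / r"] L S r \<delta>_nonneg[of N]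
        by (simp add: compact_scaling)
    qed
    have lower: "(1 - \<delta> N / r) ^ ?n * vol S \<le> vol (L N)" if "\<delta> N < r" for N
    proof -
      have q: "0 \<le> 1 - \<delta> N / r" using that r by simp
      have "(\<lambda>x. (1 - \<delta> N / r) *\<^sub>R x) ` S \<subseteq> L N"
      proof (rule subset_if_support_le)
        fix u
        have "support_function ((\<lambda>x. (1 - \<delta> N / r) *\<^sub>R x) ` S) u
            = support_function S u - (\<delta> N / r) * support_function S u"
          using S q by (subst support_scale) (auto simp: algebra_simps)
        also have "\<dots> \<le> support_function S u - (\<delta> N / r) * (r * norm u)"
          using hr[of u] r \<delta>_nonneg by (intro diff_left_mono mult_left_mono) auto
        also have "\<dots> \<le> support_function (L N) u" using close[of N u] r by simp
        finally show "support_function ((\<lambda>x. (1 - \<delta> N / r) *\<^sub>R x) ` S) u \<le> support_function (L N) u" .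
      qed (use L S in \<open>auto simp: compact_imp_closed compact_scaling convex_scaling\<close>)
      then show ?thesis
        using vol_mono[of "L N" "(\<lambda>x. (1 - \<delta> N / r) *\<^sub>R x) ` S"] vol_scale[OF S(1) q] L S
        by (simp add: compact_scaling)
    qed
    have "(\<lambda>N. vol (L N)) \<longlonglongrightarrow> vol S"
    proof (rule tendsto_sandwich)
      have "\<forall>\<^sub>F N in sequentially. \<delta> N < r" using order_tendstoD(2)[OF lim\<delta> r] .
      then show "\<forall>\<^sub>F N in sequentially. (1 - \<delta> N / r) ^ ?n * vol S \<le> vol (L N)"
        by (rule eventually_mono) (rule lower)
      show "\<forall>\<^sub>F N in sequentially. vol (L N) \<le> (1 + \<delta> N / r) ^ ?n * vol S"
        using upper by simp
      have "(\<lambda>N. (1 - \<delta> N / r) ^ ?n * vol S) \<longlonglongrightarrow> (1 - 0 / r) ^ ?n * vol S"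
        using r by (intro tendsto_intros lim\<delta>) auto
      then show "(\<lambda>N. (1 - \<delta> N / r) ^ ?n * vol S) \<longlonglongrightarrow> vol S" by simp
      have "(\<lambda>N. (1 + \<delta> N / r) ^ ?n * vol S) \<longlonglongrightarrow> (1 + 0 / r) ^ ?n * vol S"
        using r by (intro tendsto_intros lim\<delta>) auto
      then show "(\<lambda>N. (1 + \<delta> N / r) ^ ?n * vol S) \<longlonglongrightarrow> vol S" by simp
    qed
    from LIMSEQ_unique[OF this lim1] show ?thesis unfolding S_def .
  qed
qed

section \<open>Mixed volumes of zonoids\<close>

lemma integral_abs_rdet_permute:
  fixes \<mu> :: "'n::finite \<Rightarrow> (real^'n) measure"
  assumes \<mu>: "\<And>k. gen_measure (\<mu> k)" and p: "p permutes UNIV"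
  shows "(\<integral>v. \<bar>rdet v\<bar> \<partial>PiM UNIV (\<lambda>k. \<mu> (p k))) = (\<integral>v. \<bar>rdet v\<bar> \<partial>PiM UNIV \<mu>)"
proof -
  have inj: "inj p" using p by (rule permutes_inj)
  have meas: "(\<lambda>v. \<lambda>n\<in>UNIV. v (p n)) \<in> measurable (PiM UNIV \<mu>) (PiM UNIV (\<lambda>k. \<mu> (p k)))"
    by (rule measurable_restrict) (auto intro: measurable_component_singleton)
  have "PiM UNIV (\<lambda>k. \<mu> (p k)) = distr (PiM UNIV \<mu>) (PiM UNIV (\<lambda>k. \<mu> (p k))) (\<lambda>v. \<lambda>n\<in>UNIV. v (p n))"
    using distr_PiM_reindex[of UNIV \<mu> p UNIV] gen_measureD(1)[OF \<mu>] inj by simp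
  then have "(\<integral>v. \<bar>rdet v\<bar> \<partial>PiM UNIV (\<lambda>k. \<mu> (p k)))
      = (\<integral>v. \<bar>rdet v\<bar> \<partial>distr (PiM UNIV \<mu>) (PiM UNIV (\<lambda>k. \<mu> (p k))) (\<lambda>v. \<lambda>n\<in>UNIV. v (p n)))"
    by simp
  also have "\<dots> = (\<integral>v. \<bar>rdet (\<lambda>n\<in>UNIV. v (p n))\<bar> \<partial>PiM UNIV \<mu>)"
    using gen_measurable_rdet[of "\<lambda>k. \<mu> (p k)" "\<lambda>_ x. x"] \<mu> by (intro integral_distr[OF meas]) auto
  also have "\<dots> = (\<integral>v. \<bar>rdet v\<bar> \<partial>PiM UNIV \<mu>)"
  proof (rule Bochner_Integration.integral_cong[OF refl])
    fix v :: "'n \<Rightarrow> real^'n"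
    have "rdet (\<lambda>n. v (p n)) = of_int (sign p) * rdet v"
      using det_permute_rows[OF p, of "\<chi> k. v k"] by simp
    then show "\<bar>rdet (\<lambda>n\<in>UNIV. v (p n))\<bar> = \<bar>rdet v\<bar>" by (simp add: abs_mult sign_def)
  qed
  finally show ?thesis .
qed

text \<open>The volume of the sum of the bodies in \<open>S\<close> is a sum over all maps \<open>f\<close> of the rows into \<open>S\<close>. By Moebius
  inversion the alternating sum in the polarization formula keeps exactly the bijective \<open>f\<close>, and these all
  contribute the same integral, because a permutation of the rows changes only the sign of the determinant.\<close>

theorem mixed_volume_zonoids:
  fixes Ks :: "(real^'n) set list"
  assumes idx: "bij_betw idx (UNIV :: 'n set) {..<CARD('n)}"
    and body: "\<And>k. convex_body (Ks ! idx k)" and gen: "\<And>k. generates (\<mu> k) (Ks ! idx k)"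
  shows "mixed_volume Ks = 2 ^ CARD('n) / fact CARD('n) * (\<integral>v. \<bar>rdet v\<bar> \<partial>PiM UNIV \<mu>)"
proof -
  define n where "n = CARD('n)"
  define j where "j = inv_into UNIV idx"
  define D where "D f = (\<integral>v. \<bar>rdet v\<bar> \<partial>PiM UNIV (\<lambda>k. \<mu> (j (f k))))" for f :: "'n \<Rightarrow> nat"
  define F where "F = ((UNIV :: 'n set) \<rightarrow>\<^sub>E {..<n})"
  define h where "h U = 2 ^ n / fact n * (\<Sum>f\<in>{f\<in>F. range f = U}. D f)" for U
  have j: "idx (j i) = i" if "i < n" for i
    using idx that unfolding j_def n_def by (intro f_inv_into_f) (auto simp: bij_betw_def)
  have j': "j (idx k) = k" for k
    using idx unfolding j_def bij_betw_def by simp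
  have \<mu>: "gen_measure (\<mu> k)" for k using gen by (simp add: generates_def)
  have finF: "finite F" unfolding F_def by (intro finite_PiE) auto
  have volS: "vol (\<Sum>i\<in>S. Ks ! i) = sum h (Pow S)" if S: "S \<subseteq> {..<n}" for S
  proof -
    have fS: "finite S" using S finite_subset by auto
    have bi: "convex_body (Ks ! i)" "generates (\<mu> (j i)) (Ks ! i)" if "i \<in> S" for i
    proof -
      have "idx (j i) = i" using that S j by auto
      then show "convex_body (Ks ! i)" "generates (\<mu> (j i)) (Ks ! i)"
        using body[of "j i"] gen[of "j i"] by auto
    qed
    have one: "(\<lambda>x. 1 *\<^sub>R x) ` T = T" for T :: "(real^'n) set" by simp
    have "vol (\<Sum>i\<in>S. Ks ! i) = 2 ^ n / fact n * (\<Sum>f\<in>UNIV \<rightarrow>\<^sub>E S. (\<Prod>k\<in>(UNIV :: 'n set). 1) * D f)"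
      using vol_zonoid_sum[where I=S and K="\<lambda>i. Ks ! i" and \<mu>="\<lambda>i. \<mu> (j i)" and c="\<lambda>_. 1",
          OF fS bi zero_le_one]
      unfolding D_def n_def one by simp
    also have "(\<Sum>f\<in>UNIV \<rightarrow>\<^sub>E S. (\<Prod>k\<in>(UNIV :: 'n set). 1) * D f) = (\<Sum>f\<in>{f\<in>F. range f \<subseteq> S}. D f)"
      using S by (intro sum.cong) (auto simp: F_def PiE_def Pi_def)
    also have "\<dots> = (\<Sum>U\<in>Pow S. \<Sum>f\<in>{g\<in>{f\<in>F. range f \<subseteq> S}. range g = U}. D f)"
      using finF fS by (intro sum.group[symmetric]) auto
    also have "\<dots> = (\<Sum>U\<in>Pow S. \<Sum>f\<in>{f\<in>F. range f = U}. D f)"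
      by (intro sum.cong refl) auto
    finally show ?thesis unfolding h_def by (simp add: sum_distrib_left)
  qed
  have "(\<Sum>S\<in>Pow {..<n}. (-1) ^ (n - card S) * vol (\<Sum>i\<in>S. Ks ! i))
      = (\<Sum>S\<in>Pow {..<n}. (-1) ^ (card {..<n} - card S) * sum h (Pow S))"
    by (intro sum.cong refl) (auto simp: volS)
  also have "\<dots> = h {..<n}"
    by (rule inclusion_exclusion_mobius[symmetric]) auto
  also have "{f\<in>F. range f = {..<n}} = {f :: 'n \<Rightarrow> nat. bij_betw f UNIV {..<n}}"
  proof -
    have "inj f" if "range f = {..<n}" for f :: "'n \<Rightarrow> nat"
      using that by (intro eq_card_imp_inj_on) (auto simp: n_def)
    then show ?thesis by (auto simp: F_def bij_betw_def)
  qed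
  then have "h {..<n} = 2 ^ n / fact n * (\<Sum>f\<in>{f :: 'n \<Rightarrow> nat. bij_betw f UNIV {..<n}}. D f)"
    unfolding h_def by simp
  also have "(\<Sum>f\<in>{f :: 'n \<Rightarrow> nat. bij_betw f UNIV {..<n}}. D f)
      = (\<Sum>f\<in>{f :: 'n \<Rightarrow> nat. bij_betw f UNIV {..<n}}. \<integral>v. \<bar>rdet v\<bar> \<partial>PiM UNIV \<mu>)"
  proof (rule sum.cong[OF refl])
    fix f :: "'n \<Rightarrow> nat" assume f: "f \<in> {f. bij_betw f UNIV {..<n}}"
    have "bij_betw j {..<n} UNIV" unfolding j_def n_def using idx by (rule bij_betw_inv_into)
    then have "bij_betw (j \<circ> f) UNIV UNIV" using f by (auto intro: bij_betw_trans)
    then have "(j \<circ> f) permutes UNIV" by (rule bij_imp_permutes) auto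
    from integral_abs_rdet_permute[of \<mu>, OF \<mu> this] show "D f = (\<integral>v. \<bar>rdet v\<bar> \<partial>PiM UNIV \<mu>)"
      unfolding D_def by simp
  qed
  also have "\<dots> = fact n * (\<integral>v. \<bar>rdet v\<bar> \<partial>PiM UNIV \<mu>)"
    using card_bij_betw_UNIV[where 'n='n, of "{..<n}"] by (simp add: n_def)
  finally show ?thesis unfolding mixed_volume_def n_def by simp
qed

section \<open>Splitting product measures\<close>

text \<open>Taking the coordinates in \<open>A\<close> and those outside \<open>A\<close> from two independent families gives an independent
  family. All statements below on conditioning and independence derive from this.\<close>

lemma PiM_merge:
  fixes M M' N :: "'n::finite \<Rightarrow> 'a measure"
  assumes M: "\<And>k. prob_space (M k)" "\<And>k. prob_space (M' k)"
    and N: "\<And>k. k \<in> A \<Longrightarrow> N k = M k" "\<And>k. k \<notin> A \<Longrightarrow> N k = M' k"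
  defines "g \<equiv> (\<lambda>(v, w) k. if k \<in> A then v k else w k)"
  shows "g \<in> measurable (PiM UNIV M \<Otimes>\<^sub>M PiM UNIV M') (PiM UNIV N)"
    and "distr (PiM UNIV M \<Otimes>\<^sub>M PiM UNIV M') (PiM UNIV N) g = PiM UNIV N"
proof -
  have Np: "prob_space (N k)" for k using M N by (cases "k \<in> A") auto
  interpret M: product_prob_space M UNIV by (rule product_prob_spaceI) (rule M)
  interpret M': product_prob_space M' UNIV by (rule product_prob_spaceI) (rule M)
  interpret N: product_prob_space N UNIV by (rule product_prob_spaceI) (rule Np)
  let ?P = "PiM UNIV M \<Otimes>\<^sub>M PiM UNIV M'"
  show g: "g \<in> measurable ?P (PiM UNIV N)"
  proof (rule measurable_PiM_single')
    fix k
    show "(\<lambda>p. g p k) \<in> measurable ?P (N k)"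
    proof (cases "k \<in> A")
      case True
      have "(\<lambda>p. fst p k) \<in> measurable ?P (M k)"
        using measurable_compose[OF measurable_fst measurable_component_singleton[of k UNIV M]] by simp
      then show ?thesis using True N by (simp add: g_def case_prod_beta)
    next
      case False
      have "(\<lambda>p. snd p k) \<in> measurable ?P (M' k)"
        using measurable_compose[OF measurable_snd measurable_component_singleton[of k UNIV M']] by simp
      then show ?thesis using False N by (simp add: g_def case_prod_beta)
    qed
  next
    show "g \<in> space ?P \<rightarrow> (\<Pi>\<^sub>E i\<in>UNIV. space (N i))"
      using N by (auto simp: g_def space_pair_measure space_PiM PiE_def Pi_def)
  qed
  show "distr ?P (PiM UNIV N) g = PiM UNIV N"
  proof (rule N.PiM_eqI)
    fix X assume X: "\<And>i. i \<in> UNIV \<Longrightarrow> X i \<in> sets (N i)"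
    let ?X1 = "\<Pi>\<^sub>E k\<in>UNIV. if k \<in> A then X k else space (M k)"
    let ?X2 = "\<Pi>\<^sub>E k\<in>UNIV. if k \<in> A then space (M' k) else X k"
    have sX: "X k \<subseteq> space (N k)" for k using X[of k] sets.sets_into_space by auto
    have vim: "g -` (Pi\<^sub>E UNIV X) \<inter> space ?P = ?X1 \<times> ?X2"
    proof (rule set_eqI, rule iffI)
      fix p assume "p \<in> g -` (Pi\<^sub>E UNIV X) \<inter> space ?P"
      then obtain v w where p: "p = (v, w)" and a: "(v, w) \<in> g -` (Pi\<^sub>E UNIV X)" "(v, w) \<in> space ?P"
        by (cases p) auto
      from a(1) have m: "(if k \<in> A then v k else w k) \<in> X k" for k by (auto simp: g_def PiE_def Pi_def)
      have sp: "v k \<in> space (M k)" "w k \<in> space (M' k)" for k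
        using a(2) by (auto simp: space_pair_measure space_PiM PiE_def Pi_def)
      have "v k \<in> (if k \<in> A then X k else space (M k))" "w k \<in> (if k \<in> A then space (M' k) else X k)" for k
        using m[of k] sp[of k] by auto
      then show "p \<in> ?X1 \<times> ?X2" by (auto simp: p PiE_def Pi_def)
    next
      fix p assume "p \<in> ?X1 \<times> ?X2"
      then obtain v w where p: "p = (v, w)" and a: "v \<in> ?X1" "w \<in> ?X2" by auto
      then have v: "v k \<in> (if k \<in> A then X k else space (M k))"
        and w: "w k \<in> (if k \<in> A then space (M' k) else X k)" for k by (auto simp: PiE_def Pi_def)
      have "v k \<in> space (M k)" "w k \<in> space (M' k)" for k
        using v[of k] w[of k] sX[of k] N[of k] by (cases "k \<in> A"; force)+
      moreover have "(if k \<in> A then v k else w k) \<in> X k" for k using v[of k] w[of k] by auto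
      ultimately show "p \<in> g -` (Pi\<^sub>E UNIV X) \<inter> space ?P"
        by (auto simp: p g_def space_pair_measure space_PiM)
    qed
    have s1: "(if k \<in> A then X k else space (M k)) \<in> sets (M k)"
      and s2: "(if k \<in> A then space (M' k) else X k) \<in> sets (M' k)" for k
      using X[of k] N[of k] by auto
    have "emeasure (distr ?P (PiM UNIV N) g) (Pi\<^sub>E UNIV X) = emeasure ?P (?X1 \<times> ?X2)"
      using X by (subst emeasure_distr[OF g]) (auto simp: vim intro: sets_PiM_I_finite)
    also have "\<dots> = emeasure (PiM UNIV M) ?X1 * emeasure (PiM UNIV M') ?X2"
      using s1 s2 by (intro M'.emeasure_pair_measure_Times sets_PiM_I_finite) auto
    also have "\<dots> = (\<Prod>k\<in>UNIV. emeasure (M k) (if k \<in> A then X k else space (M k)))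
        * (\<Prod>k\<in>UNIV. emeasure (M' k) (if k \<in> A then space (M' k) else X k))"
      using s1 s2 by (simp add: M.emeasure_PiM M'.emeasure_PiM)
    also have "\<dots> = (\<Prod>k\<in>UNIV. emeasure (N k) (X k))"
      unfolding prod.distrib[symmetric]
      using N by (intro prod.cong refl) (auto simp: prob_space.emeasure_space_1[OF M(1)] prob_space.emeasure_space_1[OF M(2)])
    finally show "emeasure (distr ?P (PiM UNIV N) g) (Pi\<^sub>E UNIV X) = (\<Prod>k\<in>UNIV. emeasure (N k) (X k))" .
  qed auto
qed

lemma nn_integral_PiM_merge:
  fixes M M' N :: "'n::finite \<Rightarrow> 'a measure"
  assumes M: "\<And>k. prob_space (M k)" "\<And>k. prob_space (M' k)"
    and N: "\<And>k. k \<in> A \<Longrightarrow> N k = M k" "\<And>k. k \<notin> A \<Longrightarrow> N k = M' k"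
    and f: "f \<in> borel_measurable (PiM UNIV N)"
  shows "(\<integral>\<^sup>+v. f v \<partial>PiM UNIV N)
       = (\<integral>\<^sup>+v. (\<integral>\<^sup>+w. f (\<lambda>k. if k \<in> A then v k else w k) \<partial>PiM UNIV M') \<partial>PiM UNIV M)"
proof -
  interpret M': prob_space "PiM UNIV M'" by (rule prob_space_PiM) (rule M)
  have g: "(\<lambda>(v, w) k. if k \<in> A then v k else w k)
      \<in> measurable (PiM UNIV M \<Otimes>\<^sub>M PiM UNIV M') (PiM UNIV N)"
    "distr (PiM UNIV M \<Otimes>\<^sub>M PiM UNIV M') (PiM UNIV N) (\<lambda>(v, w) k. if k \<in> A then v k else w k) = PiM UNIV N"
    by (rule PiM_merge; simp add: M N)+
  have "(\<integral>\<^sup>+v. f v \<partial>PiM UNIV N)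
      = (\<integral>\<^sup>+v. f v \<partial>distr (PiM UNIV M \<Otimes>\<^sub>M PiM UNIV M') (PiM UNIV N) (\<lambda>(v, w) k. if k \<in> A then v k else w k))"
    using g(2) by simp
  also have "\<dots> = (\<integral>\<^sup>+p. f ((\<lambda>(v, w) k. if k \<in> A then v k else w k) p) \<partial>(PiM UNIV M \<Otimes>\<^sub>M PiM UNIV M'))"
    by (rule nn_integral_distr[OF g(1)]) (subst measurable_cong_sets[OF sets_distr refl], rule f)
  also have "\<dots> = (\<integral>\<^sup>+v. (\<integral>\<^sup>+w. f (\<lambda>k. if k \<in> A then v k else w k) \<partial>PiM UNIV M') \<partial>PiM UNIV M)"
    using measurable_compose[OF g(1) f] by (subst M'.nn_integral_fst[symmetric]) auto
  finally show ?thesis .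
qed

lemma integral_PiM_merge:
  fixes M M' N :: "'n::finite \<Rightarrow> 'a measure" and f :: "('n \<Rightarrow> 'a) \<Rightarrow> real"
  assumes M: "\<And>k. prob_space (M k)" "\<And>k. prob_space (M' k)"
    and N: "\<And>k. k \<in> A \<Longrightarrow> N k = M k" "\<And>k. k \<notin> A \<Longrightarrow> N k = M' k"
    and f: "integrable (PiM UNIV N) f"
  shows "(\<integral>v. f v \<partial>PiM UNIV N)
       = (\<integral>v. (\<integral>w. f (\<lambda>k. if k \<in> A then v k else w k) \<partial>PiM UNIV M') \<partial>PiM UNIV M)"
proof -
  interpret M: prob_space "PiM UNIV M" by (rule prob_space_PiM) (rule M)
  interpret M': prob_space "PiM UNIV M'" by (rule prob_space_PiM) (rule M)
  interpret pair_sigma_finite "PiM UNIV M" "PiM UNIV M'" by standard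
  have g: "(\<lambda>(v, w) k. if k \<in> A then v k else w k)
      \<in> measurable (PiM UNIV M \<Otimes>\<^sub>M PiM UNIV M') (PiM UNIV N)"
    "distr (PiM UNIV M \<Otimes>\<^sub>M PiM UNIV M') (PiM UNIV N) (\<lambda>(v, w) k. if k \<in> A then v k else w k) = PiM UNIV N"
    by (rule PiM_merge; simp add: M N)+
  let ?g = "\<lambda>(v, w) k. if k \<in> A then v k else w k"
  have "(\<integral>v. f v \<partial>PiM UNIV N) = (\<integral>v. f v \<partial>distr (PiM UNIV M \<Otimes>\<^sub>M PiM UNIV M') (PiM UNIV N) ?g)"
    using g(2) by simp
  also have "\<dots> = (\<integral>p. f (?g p) \<partial>(PiM UNIV M \<Otimes>\<^sub>M PiM UNIV M'))"
    by (rule integral_distr[OF g(1) borel_measurable_integrable[OF f]])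
  also have "\<dots> = (\<integral>v. (\<integral>w. f (?g (v, w)) \<partial>PiM UNIV M') \<partial>PiM UNIV M)"
  proof (rule integral_fst'[symmetric])
    have "integrable (distr (PiM UNIV M \<Otimes>\<^sub>M PiM UNIV M') (PiM UNIV N) ?g) f" using g(2) f by simp
    then show "integrable (PiM UNIV M \<Otimes>\<^sub>M PiM UNIV M') (\<lambda>p. f (?g p))"
      using g(1) f by (subst (asm) integrable_distr_eq) auto
  qed
  finally show ?thesis by simp
qed

lemma nn_integral_PiM_marginal:
  fixes M N :: "'n::finite \<Rightarrow> 'a measure"
  assumes M: "\<And>k. prob_space (M k)" "\<And>k. prob_space (N k)"
    and N: "\<And>k. k \<in> A \<Longrightarrow> N k = M k"
    and f: "f \<in> borel_measurable (PiM UNIV N)"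
    and dep: "\<And>v w. (\<And>k. k \<in> A \<Longrightarrow> v k = w k) \<Longrightarrow> f v = f w"
  shows "(\<integral>\<^sup>+v. f v \<partial>PiM UNIV N) = (\<integral>\<^sup>+v. f v \<partial>PiM UNIV M)"
proof -
  interpret N: prob_space "PiM UNIV N" by (rule prob_space_PiM) (rule M)
  have "f (\<lambda>k. if k \<in> A then v k else w k) = f v" for v w by (rule dep) simp
  then show ?thesis
    using nn_integral_PiM_merge[of M N A N f] M N f by (simp add: N.emeasure_space_1)
qed

lemma nn_integral_PiM_resample:
  fixes M :: "'n::finite \<Rightarrow> 'a measure"
  assumes M: "\<And>k. prob_space (M k)" and f: "f \<in> borel_measurable (PiM UNIV M)"
  shows "(\<integral>\<^sup>+v. f v \<partial>PiM UNIV M) = (\<integral>\<^sup>+v. (\<integral>\<^sup>+x. f (v(a := x)) \<partial>M a) \<partial>PiM UNIV M)"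
proof -
  have "(\<integral>\<^sup>+w. f (\<lambda>k. if k \<in> - {a} then v k else w k) \<partial>PiM UNIV M) = (\<integral>\<^sup>+x. f (v(a := x)) \<partial>M a)"
    if v: "v \<in> space (PiM UNIV M)" for v
  proof -
    have upd: "(\<lambda>k. if k \<in> - {a} then v k else w k) = v(a := w a)" for w by auto
    have "(\<lambda>x. v(a := x)) \<in> measurable (M a) (PiM UNIV M)"
    proof (rule measurable_PiM_single')
      fix k show "(\<lambda>x. (v(a := x)) k) \<in> measurable (M a) (M k)"
        using v by (cases "k = a") (auto simp: space_PiM PiE_def Pi_def)
    next
      show "(\<lambda>x. v(a := x)) \<in> space (M a) \<rightarrow> (\<Pi>\<^sub>E i\<in>UNIV. space (M i))"
        using v by (auto simp: space_PiM PiE_def Pi_def)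
    qed
    then have m: "(\<lambda>x. f (v(a := x))) \<in> borel_measurable (M a)"
      using f by (rule measurable_compose)
    have "(\<integral>\<^sup>+w. f (v(a := w a)) \<partial>PiM UNIV M) = (\<integral>\<^sup>+x. f (v(a := x)) \<partial>distr (PiM UNIV M) (M a) (\<lambda>w. w a))"
      by (rule nn_integral_distr[symmetric, OF measurable_component_singleton])
        (auto simp: measurable_cong_sets[OF sets_distr refl] m)
    also have "\<dots> = (\<integral>\<^sup>+x. f (v(a := x)) \<partial>M a)" using distr_PiM_component[of UNIV M a] M by simp
    finally show ?thesis by (simp only: upd)
  qed
  then show ?thesis
    using nn_integral_PiM_merge[of M M "- {a}" M f] M f by (simp cong: nn_integral_cong)
qed

lemma nn_integral_PiM_indep2:
  fixes M :: "'n::finite \<Rightarrow> 'a measure"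
  assumes M: "\<And>k. prob_space (M k)"
    and f: "f \<in> borel_measurable (PiM UNIV M)" "\<And>v w. (\<And>k. k \<in> A \<Longrightarrow> v k = w k) \<Longrightarrow> f v = f w"
    and g: "g \<in> borel_measurable (PiM UNIV M)" "\<And>v w. (\<And>k. k \<notin> A \<Longrightarrow> v k = w k) \<Longrightarrow> g v = g w"
  shows "(\<integral>\<^sup>+v. f v * g v \<partial>PiM UNIV M) = (\<integral>\<^sup>+v. f v \<partial>PiM UNIV M) * (\<integral>\<^sup>+v. g v \<partial>PiM UNIV M)"
proof -
  have fe: "f (\<lambda>k. if k \<in> A then v k else w k) = f v" for v w by (rule f(2)) simp
  have ge: "g (\<lambda>k. if k \<in> A then v k else w k) = g w" for v w by (rule g(2)) simp
  have "(\<integral>\<^sup>+v. f v * g v \<partial>PiM UNIV M)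
      = (\<integral>\<^sup>+v. (\<integral>\<^sup>+w. f v * g w \<partial>PiM UNIV M) \<partial>PiM UNIV M)"
    using nn_integral_PiM_merge[of M M A M "\<lambda>v. f v * g v"] M f(1) g(1)
    by (simp add: fe ge)
  then show ?thesis using f(1) g(1) by (simp add: nn_integral_cmult nn_integral_multc)
qed

lemma nn_integral_PiM_indep:
  fixes M :: "'n::finite \<Rightarrow> 'a measure"
  assumes M: "\<And>k. prob_space (M k)" and I: "finite I" "disjoint_family_on B I"
    and f: "\<And>i. i \<in> I \<Longrightarrow> f i \<in> borel_measurable (PiM UNIV M)"
      "\<And>i v w. i \<in> I \<Longrightarrow> (\<And>k. k \<in> B i \<Longrightarrow> v k = w k) \<Longrightarrow> f i v = f i w"
  shows "(\<integral>\<^sup>+v. (\<Prod>i\<in>I. f i v) \<partial>PiM UNIV M) = (\<Prod>i\<in>I. \<integral>\<^sup>+v. f i v \<partial>PiM UNIV M)"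
  using I f
proof (induction I rule: finite_induct)
  case empty
  interpret prob_space "PiM UNIV M" by (rule prob_space_PiM) (rule M)
  show ?case by (simp add: emeasure_space_1)
next
  case (insert a I)
  have dj: "B i \<inter> B a = {}" if "i \<in> I" for i
    using insert.prems(1) that insert.hyps by (auto simp: disjoint_family_on_def)
  have "(\<integral>\<^sup>+v. f a v * (\<Prod>i\<in>I. f i v) \<partial>PiM UNIV M)
      = (\<integral>\<^sup>+v. f a v \<partial>PiM UNIV M) * (\<integral>\<^sup>+v. (\<Prod>i\<in>I. f i v) \<partial>PiM UNIV M)"
  proof (rule nn_integral_PiM_indep2[where A = "B a", OF M])
    show "f a \<in> borel_measurable (PiM UNIV M)" by (rule insert.prems(2)) simp
    show "(\<lambda>v. \<Prod>i\<in>I. f i v) \<in> borel_measurable (PiM UNIV M)"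
      by (intro borel_measurable_prod_ennreal insert.prems(2)) simp
    show "f a v = f a w" if "\<And>k. k \<in> B a \<Longrightarrow> v k = w k" for v w
      by (rule insert.prems(3)[OF insertI1]) (rule that)
    show "(\<Prod>i\<in>I. f i v) = (\<Prod>i\<in>I. f i w)" if eq: "\<And>k. k \<notin> B a \<Longrightarrow> v k = w k" for v w
    proof (rule prod.cong[OF refl])
      fix i assume i: "i \<in> I"
      show "f i v = f i w" by (rule insert.prems(3)[of i]) (use dj[OF i] eq i in auto)
    qed
  qed
  also have "(\<integral>\<^sup>+v. (\<Prod>i\<in>I. f i v) \<partial>PiM UNIV M) = (\<Prod>i\<in>I. \<integral>\<^sup>+v. f i v \<partial>PiM UNIV M)"
  proof (rule insert.IH)
    show "disjoint_family_on B I" using insert.prems(1) by (auto simp: disjoint_family_on_def)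
    show "f i \<in> borel_measurable (PiM UNIV M)" if "i \<in> I" for i
      by (rule insert.prems(2)) (simp add: that)
    show "f i v = f i w" if "i \<in> I" "\<And>k. k \<in> B i \<Longrightarrow> v k = w k" for i v w
      by (rule insert.prems(3)[OF insertI2[OF that(1)]]) (rule that(2))
  qed
  finally show ?case using insert.hyps by simp
qed

section \<open>The Euclidean ball as a zonoid\<close>

lemma abs_det_orthogonal_transformation:
  fixes f :: "real^'n \<Rightarrow> real^'n"
  assumes "orthogonal_transformation f" shows "\<bar>det (matrix f)\<bar> = 1"
  using assms det_orthogonal_matrix[of "matrix f"] by (auto simp: orthogonal_transformation_matrix)

lemma lborel_distr_orthogonal:
  fixes f :: "real^'n \<Rightarrow> real^'n"
  assumes f: "orthogonal_transformation f"
  shows "distr lborel borel f = lborel"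
proof (rule lborel_eqI[symmetric])
  have fm: "f \<in> borel_measurable borel"
    using orthogonal_transformation_linear[OF f]
    by (intro borel_measurable_continuous_onI linear_continuous_on linear_conv_bounded_linear[THEN iffD1])
  define g where "g = inv f"
  have g: "orthogonal_transformation g" unfolding g_def using f by (rule orthogonal_transformation_inv)
  have lin: "linear g" using g by (rule orthogonal_transformation_linear)
  have bij: "bij f" using f by (rule orthogonal_transformation_bij)
  fix l u :: "real^'n" assume le: "\<And>b. b \<in> Basis \<Longrightarrow> l \<bullet> b \<le> u \<bullet> b"
  have vim: "f -` box l u = g ` box l u"
    unfolding g_def using bij by (simp add: bij_vimage_eq_inv_image)
  have im: "measure lebesgue (g ` cbox a b) = 1 * measure lebesgue (cbox a b)" for a b
  proof -
    have "compact (g ` cbox a b)"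
      using lin by (intro compact_continuous_image linear_continuous_on linear_conv_bounded_linear[THEN iffD1]) auto
    then show ?thesis
      using vol_linear_image[OF lin, of "cbox a b"] abs_det_orthogonal_transformation[OF g]
      by (simp add: vol_eq_lebesgue[symmetric])
  qed
  have g_box: "g ` box l u \<in> lmeasurable" "measure lebesgue (g ` box l u) = measure lebesgue (box l u)"
    using measure_linear_sufficient[OF lin lmeasurable_box im] by auto
  have "g ` box l u \<in> sets borel"
    using measurable_sets[OF fm, of "box l u"] by (simp add: vim)
  then have "emeasure lborel (g ` box l u) = emeasure lebesgue (g ` box l u)" by simp
  also have "\<dots> = ennreal (measure lebesgue (box l u))"
    using g_box by (simp add: emeasure_eq_measure2)
  also have "\<dots> = (\<Prod>b\<in>Basis. (u - l) \<bullet> b)"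
    using le by (simp add: measure_lborel_box_eq inner_diff_left)
  finally show "emeasure (distr lborel borel f) (box l u) = (\<Prod>b\<in>Basis. (u - l) \<bullet> b)"
    using fm by (simp add: emeasure_distr vim)
qed simp

text \<open>For the uniform distribution on the ball the integral of \<open>\<bar>u \<bullet> v\<bar>\<close> is invariant under rotations of
  \<open>u\<close> and positively homogeneous, so it is a multiple \<open>c * norm u\<close> of the norm. The factor \<open>c\<close> is positive
  because hyperplanes are null sets, and rescaling the vectors by \<open>1 / c\<close> removes it.\<close>

lemma ball_generator_exists:
  "\<exists>\<beta> :: (real^'n) measure. gen_measure \<beta> \<and> (\<forall>u. (\<integral>v. \<bar>u \<bullet> v\<bar> \<partial>\<beta>) = norm u)"
proof -
  define B where "B = cball 0 (1::real) \<inter> (UNIV :: (real^'n) set)"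
  define \<kappa> where "\<kappa> = vol B"
  have \<kappa>: "\<kappa> > 0" unfolding \<kappa>_def B_def using content_cball_pos[of 1 "0 :: real^'n"] by simp
  have Bs: "B \<in> sets lborel" by (simp add: B_def)
  have Bf: "emeasure lborel B = ennreal \<kappa>"
    unfolding \<kappa>_def B_def using emeasure_compact_finite[of "cball (0::real^'n) 1"]
    by (simp add: emeasure_eq_ennreal_measure)
  define h where "h v = indicat_real B v / \<kappa>" for v
  have hm: "h \<in> borel_measurable lborel" unfolding h_def using Bs by simp
  have h0: "0 \<le> h v" for v unfolding h_def using \<kappa> by (simp add: indicator_def)
  define \<mu> where "\<mu> = density lborel (\<lambda>v. ennreal (h v))"
  have "emeasure \<mu> (space \<mu>) = (\<integral>\<^sup>+v. ennreal (h v) \<partial>lborel)"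
    unfolding \<mu>_def using hm by (subst emeasure_density) auto
  also have "\<dots> = (\<integral>\<^sup>+v. ennreal (1 / \<kappa>) * indicator B v \<partial>lborel)"
    using \<kappa> by (intro nn_integral_cong) (auto simp: h_def indicator_def)
  also have "\<dots> = ennreal (1 / \<kappa>) * ennreal \<kappa>" using Bs Bf by (simp add: nn_integral_cmult)
  also have "\<dots> = 1" using \<kappa> by (simp add: ennreal_mult[symmetric])
  finally have prob: "prob_space \<mu>" by (rule prob_spaceI)
  interpret prob_space \<mu> by (rule prob)
  have bnd: "AE v in \<mu>. norm v \<le> 1"
    unfolding \<mu>_def using hm by (subst AE_density) (auto simp: h_def B_def indicator_def)
  have int_norm: "integrable \<mu> norm"
    by (rule integrable_const_bound[where B=1]) (use bnd in \<open>auto simp: \<mu>_def\<close>)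
  have gen: "gen_measure \<mu>" using prob int_norm by (simp add: gen_measure_def \<mu>_def)
  define G where "G u = (\<integral>v. \<bar>u \<bullet> v\<bar> \<partial>\<mu>)" for u
  have Geq: "G u = (\<integral>v. h v * \<bar>u \<bullet> v\<bar> \<partial>lborel)" for u
    unfolding G_def \<mu>_def using hm h0 by (subst integral_density) auto
  have Ginv: "G (f u) = G u" if f: "orthogonal_transformation f" for f u
  proof -
    have fm: "f \<in> borel_measurable borel"
      using orthogonal_transformation_linear[OF f]
      by (intro borel_measurable_continuous_onI linear_continuous_on linear_conv_bounded_linear[THEN iffD1])
    have "G (f u) = (\<integral>v. h v * \<bar>f u \<bullet> v\<bar> \<partial>distr lborel borel f)"
      unfolding Geq by (simp add: lborel_distr_orthogonal[OF f])
    also have "\<dots> = (\<integral>v. h (f v) * \<bar>f u \<bullet> f v\<bar> \<partial>lborel)"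
      using hm fm by (subst integral_distr) auto
    also have "\<dots> = G u"
      unfolding Geq using f
      by (simp add: orthogonal_transformation_def h_def B_def indicator_def orthogonal_transformation_norm[OF f])
    finally show ?thesis .
  qed
  fix i0 :: 'n
  define c where "c = G (axis i0 1)"
  have Gnorm: "G u = c * norm u" for u
  proof -
    have "norm (norm u *\<^sub>R axis i0 1 :: real^'n) = norm u" by (simp add: norm_axis_1)
    then obtain f :: "real^'n \<Rightarrow> real^'n"
      where f: "orthogonal_transformation f" "f (norm u *\<^sub>R axis i0 1) = u"
      using orthogonal_transformation_exists by blast
    have "G u = G (norm u *\<^sub>R axis i0 1)" using Ginv[OF f(1), of "norm u *\<^sub>R axis i0 1"] f(2) by simp
    then show ?thesis by (simp add: G_def c_def abs_mult)
  qed
  have c: "c > 0"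
  proof (rule ccontr)
    assume "\<not> c > 0"
    moreover have "0 \<le> c" by (simp add: c_def G_def)
    ultimately have "G (axis i0 1) = 0" by (simp add: c_def)
    then have "AE v in \<mu>. \<bar>axis i0 1 \<bullet> v\<bar> = 0"
      unfolding G_def using gen_integrable_inner[OF gen] by (subst (asm) integral_nonneg_eq_0_iff_AE) auto
    then have "AE v in lborel. 0 < h v \<longrightarrow> axis i0 1 \<bullet> v = 0"
      unfolding \<mu>_def using hm by (subst (asm) AE_density) auto
    moreover have "negligible {v :: real^'n. axis i0 1 \<bullet> v = 0}"
      by (rule negligible_hyperplane) (simp add: axis_eq_0_iff)
    then have "{v :: real^'n. axis i0 1 \<bullet> v = 0} \<in> null_sets lborel"
      by (simp add: negligible_iff_null_sets null_sets_completion_iff closed_hyperplane)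
    then have "AE v in lborel. axis i0 1 \<bullet> (v :: real^'n) \<noteq> 0"
      using AE_not_in[of "{v :: real^'n. axis i0 1 \<bullet> v = 0}" lborel] by simp
    ultimately have "AE v in lborel. v \<notin> B"
      by eventually_elim (use \<kappa> in \<open>auto simp: h_def\<close>)
    then have "emeasure lborel B = 0" using Bs by (subst (asm) AE_iff_measurable[OF _ refl]) auto
    then show False using Bf \<kappa> by simp
  qed
  define \<beta> where "\<beta> = distr \<mu> borel (\<lambda>v. (1 / c) *\<^sub>R v)"
  have m: "(\<lambda>v. (1 / c) *\<^sub>R v) \<in> measurable \<mu> borel" by (simp add: \<mu>_def)
  have "prob_space \<beta>" unfolding \<beta>_def using m by (rule prob_space_distr)
  moreover have "integrable \<beta> norm"
    unfolding \<beta>_def using int_norm by (subst integrable_distr_eq[OF m]) auto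
  moreover have "(\<integral>v. \<bar>u \<bullet> v\<bar> \<partial>\<beta>) = norm u" for u
  proof -
    have "(\<integral>v. \<bar>u \<bullet> v\<bar> \<partial>\<beta>) = (\<integral>v. (1 / c) * \<bar>u \<bullet> v\<bar> \<partial>\<mu>)"
      unfolding \<beta>_def using c by (subst integral_distr[OF m]) (auto simp: abs_mult)
    also have "\<dots> = norm u" using Gnorm[of u] c by (simp add: G_def)
    finally show ?thesis .
  qed
  ultimately show ?thesis by (intro exI[of _ \<beta>]) (simp add: gen_measure_def \<beta>_def)
qed

section \<open>The volume of a cylinder\<close>

text \<open>The product of a cube in the coordinates in \<open>A\<close> and a ball of radius \<open>t\<close> in the other coordinates.\<close>

definition std_cylinder :: "'n set \<Rightarrow> real \<Rightarrow> (real^'n) set" where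
  "std_cylinder A t = {y. (\<forall>k\<in>A. \<bar>y $ k\<bar> \<le> 1) \<and> sqrt (\<Sum>k\<in>-A. (y $ k)\<^sup>2) \<le> t}"

lemma compact_std_cylinder:
  fixes A :: "'n::finite set"
  shows "compact (std_cylinder A t)"
proof -
  have "norm y \<le> real CARD('n) * (1 + \<bar>t\<bar>)" if y: "y \<in> std_cylinder A t" for y :: "real^'n"
  proof -
    have "\<bar>y $ k\<bar> \<le> 1 + \<bar>t\<bar>" for k
    proof (cases "k \<in> A")
      case True then show ?thesis using y by (auto simp: std_cylinder_def)
    next
      case False
      then have "(y $ k)\<^sup>2 \<le> (\<Sum>k\<in>-A. (y $ k)\<^sup>2)" by (intro member_le_sum) auto
      then have "\<bar>y $ k\<bar> \<le> sqrt (\<Sum>k\<in>-A. (y $ k)\<^sup>2)" using real_le_rsqrt real_sqrt_abs real_sqrt_le_mono by metis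
      also have "\<dots> \<le> t" using y by (simp add: std_cylinder_def)
      finally show ?thesis by simp
    qed
    then have "(\<Sum>k\<in>UNIV. \<bar>y $ k\<bar>) \<le> (\<Sum>k\<in>(UNIV :: 'n set). 1 + \<bar>t\<bar>)" by (intro sum_mono)
    then show ?thesis using norm_le_l1_cart[of y] by simp
  qed
  then have "bounded (std_cylinder A t)" by (auto simp: bounded_iff)
  moreover have "closed (std_cylinder A t)"
    unfolding std_cylinder_def Ball_def
    by (intro closed_Collect_conj closed_Collect_all closed_Collect_imp closed_Collect_le continuous_intros open_Collect_const)
  ultimately show ?thesis by (simp add: compact_eq_bounded_closed)
qed

lemma vol_std_cylinder:
  fixes A :: "'n::finite set"
  assumes "0 \<le> t"
  shows "vol (std_cylinder A t) = 2 ^ card A * unit_ball_vol (real (card (-A))) * t ^ card (-A)"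
proof (cases "t = 0 \<and> - A \<noteq> {}")
  case True
  then obtain k where k: "k \<notin> A" by auto
  have "y $ k = 0" if "y \<in> std_cylinder A t" for y
  proof -
    have "sqrt (\<Sum>k\<in>-A. (y $ k)\<^sup>2) \<le> 0" using that True by (simp add: std_cylinder_def)
    then have "(\<Sum>k\<in>-A. (y $ k)\<^sup>2) = 0" using real_sqrt_le_0_iff sum_nonneg[of "-A" "\<lambda>k. (y $ k)\<^sup>2"] by force
    then show ?thesis using k by (subst (asm) sum_nonneg_eq_0_iff) auto
  qed
  then have "negligible (std_cylinder A t)"
    by (intro negligible_subset[OF negligible_hyperplane[of "axis k 1" 0]]) (auto simp: inner_axis' axis_eq_0_iff)
  then have "vol (std_cylinder A t) = 0"
    using compact_std_cylinder[of A t] negligible_imp_measure0 by (simp add: vol_eq_lebesgue)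
  moreover have "0 < card (- A)" using True by (simp add: card_gt_0_iff)
  ultimately show ?thesis using True by simp
next
  case False
  \<comment> \<open>For \<open>A = UNIV\<close> the exponent of the radius is zero; the value one serves the formula for balls, which requires a positive radius.\<close>
  let ?t = "if - A = {} then 1 else t"
  have t: "0 < ?t" using False assms by auto
  have same: "std_cylinder A t = std_cylinder A ?t" "t ^ card (-A) = ?t ^ card (-A)"
    using assms by (auto simp: std_cylinder_def)
  interpret product_sigma_finite "\<lambda>_::'n. lborel :: real measure" by standard
  let ?P = "\<lambda>I. (\<Pi>\<^sub>M i\<in>(I :: 'n set). (lborel :: real measure))"
  interpret PA: sigma_finite_measure "?P (-A)" by (rule sigma_finite) simp
  have vec[measurable]: "(\<lambda>w. (\<chi> i. w i) :: real^'n) \<in> measurable (?P UNIV) borel"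
    by (rule borel_measurable_vecI) auto
  have UA: "A \<union> - A = UNIV" by auto
  let ?E1 = "\<Pi>\<^sub>E k\<in>A. {-1..1::real}"
  let ?E2 = "{f. sqrt (\<Sum>i\<in>-A. (f i)\<^sup>2) \<le> ?t} \<inter> space (?P (-A))"
  let ?C = "(\<lambda>w. (\<chi> i. w i) :: real^'n) -` std_cylinder A ?t \<inter> space (?P UNIV)"
  have E2: "?E2 \<in> sets (?P (-A))" by measurable
  have cyl: "std_cylinder A ?t \<in> sets borel" by (rule borel_compact[OF compact_std_cylinder])
  have C: "?C \<in> sets (?P UNIV)" using measurable_sets[OF vec cyl] .
  have "emeasure lborel (std_cylinder A ?t) = emeasure (?P UNIV) ?C"
    by (subst lborel_vec_eq) (rule emeasure_distr[OF vec cyl])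
  also have "\<dots> = emeasure (distr (?P A \<Otimes>\<^sub>M ?P (-A)) (?P (A \<union> -A)) (merge A (-A))) ?C"
    using distr_merge[of A "- A"] by (simp add: UA)
  also have "\<dots> = emeasure (?P A \<Otimes>\<^sub>M ?P (-A)) (merge A (-A) -` ?C \<inter> space (?P A \<Otimes>\<^sub>M ?P (-A)))"
    using C measurable_merge[of A "-A" "\<lambda>_. lborel"] by (subst emeasure_distr) (auto simp: UA)
  also have "merge A (-A) -` ?C \<inter> space (?P A \<Otimes>\<^sub>M ?P (-A)) = ?E1 \<times> ?E2"
  proof (rule set_eqI)
    fix p :: "('n \<Rightarrow> real) \<times> ('n \<Rightarrow> real)"
    obtain v w where p: "p = (v, w)" by (cases p)
    have s: "(\<Sum>k\<in>-A. (merge A (-A) (v, w) k)\<^sup>2) = (\<Sum>k\<in>-A. (w k)\<^sup>2)"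
      by (intro sum.cong) auto
    have a: "(\<forall>k\<in>A. \<bar>merge A (-A) (v, w) k\<bar> \<le> 1) \<longleftrightarrow> (\<forall>k\<in>A. v k \<in> {-1..1})"
      by (auto simp: abs_le_iff)
    show "p \<in> merge A (-A) -` ?C \<inter> space (?P A \<Otimes>\<^sub>M ?P (-A)) \<longleftrightarrow> p \<in> ?E1 \<times> ?E2"
      using s a by (auto simp: p space_pair_measure space_PiM std_cylinder_def PiE_def Pi_def extensional_def)
  qed
  also have "emeasure (?P A \<Otimes>\<^sub>M ?P (-A)) (?E1 \<times> ?E2) = emeasure (?P A) ?E1 * emeasure (?P (-A)) ?E2"
    using E2 by (intro PA.emeasure_pair_measure_Times sets_PiM_I_finite) auto
  also have "emeasure (?P A) ?E1 = ennreal (2 ^ card A)"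
    by (subst emeasure_PiM) (auto simp: prod_constant ennreal_power[symmetric])
  also have "emeasure (?P (-A)) ?E2 = ennreal (unit_ball_vol (real (card (-A))) * ?t ^ card (-A))"
    by (rule emeasure_cball_aux) (use t in auto)
  also have "ennreal (2 ^ card A) * ennreal (unit_ball_vol (real (card (-A))) * ?t ^ card (-A))
      = ennreal (2 ^ card A * unit_ball_vol (real (card (-A))) * ?t ^ card (-A))"
    using t by (simp add: ennreal_mult[symmetric] mult.assoc)
  finally have "vol (std_cylinder A ?t) = 2 ^ card A * unit_ball_vol (real (card (-A))) * ?t ^ card (-A)"
    using t by (intro measure_eq_emeasure_eq_ennreal) auto
  then show ?thesis using same by simp
qed

section \<open>Counting surjections\<close>

text \<open>The power \<open>card T ^ card X\<close> counts the maps from \<open>X\<close> to \<open>T\<close>, so the alternating sum counts the maps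
  from \<open>X\<close> onto \<open>X\<close>.\<close>

lemma alternating_sum_powers:
  assumes "finite X"
  shows "(\<Sum>T\<in>Pow X. (-1) ^ (card X - card T) * real (card T) ^ card X) = fact (card X)"
proof -
  define F where "F = (X \<rightarrow>\<^sub>E X)"
  define h where "h U = real (card {f\<in>F. f ` X = U})" for U
  have finF: "finite F" unfolding F_def using assms by (intro finite_PiE) auto
  have cnt: "real (card T) ^ card X = sum h (Pow T)" if T: "T \<subseteq> X" for T
  proof -
    have fT: "finite T" using T assms finite_subset by auto
    have "real (card T) ^ card X = real (card (X \<rightarrow>\<^sub>E T))" using assms by (simp add: card_PiE)
    also have "X \<rightarrow>\<^sub>E T = {f\<in>F. f ` X \<subseteq> T}" using T by (auto simp: F_def PiE_def Pi_def)
    also have "real (card {f\<in>F. f ` X \<subseteq> T}) = (\<Sum>f\<in>{f\<in>F. f ` X \<subseteq> T}. 1)" by simp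
    also have "\<dots> = (\<Sum>U\<in>Pow T. \<Sum>f\<in>{g\<in>{f\<in>F. f ` X \<subseteq> T}. g ` X = U}. 1)"
      using finF fT by (intro sum.group[symmetric]) auto
    also have "\<dots> = (\<Sum>U\<in>Pow T. \<Sum>f\<in>{f\<in>F. f ` X = U}. 1)"
      by (intro sum.cong refl) auto
    finally show ?thesis by (simp add: h_def)
  qed
  have "(\<Sum>T\<in>Pow X. (-1) ^ (card X - card T) * real (card T) ^ card X)
      = (\<Sum>T\<in>Pow X. (-1) ^ (card X - card T) * sum h (Pow T))"
    using cnt by (intro sum.cong refl) auto
  also have "\<dots> = h X" by (rule inclusion_exclusion_mobius[symmetric]) (use assms in auto)
  also have "card {f\<in>F. f ` X = X} = card {p. p permutes X}"
  proof (rule bij_betw_same_card[symmetric], rule bij_betwI[where g = "\<lambda>f x. if x \<in> X then f x else x"])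
    show "(\<lambda>p. restrict p X) \<in> {p. p permutes X} \<rightarrow> {f\<in>F. f ` X = X}"
      by (auto simp: F_def permutes_image permutes_in_image)
    show "(\<lambda>f x. if x \<in> X then f x else x) \<in> {f\<in>F. f ` X = X} \<rightarrow> {p. p permutes X}"
    proof
      fix f assume "f \<in> {f\<in>F. f ` X = X}"
      then have "bij_betw f X X" using assms by (simp add: bij_betw_def finite_surj_inj)
      then have "bij_betw (\<lambda>x. if x \<in> X then f x else x) X X" by (subst bij_betw_cong[where g=f]) auto
      then show "(\<lambda>x. if x \<in> X then f x else x) \<in> {p. p permutes X}"
        by (intro CollectI bij_imp_permutes) auto
    qed
    show "(\<lambda>x. if x \<in> X then restrict p X x else x) = p" if "p \<in> {p. p permutes X}" for p
      using that by (auto simp: permutes_def fun_eq_iff)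
    show "restrict (\<lambda>x. if x \<in> X then f x else x) X = f" if "f \<in> {f\<in>F. f ` X = X}" for f
      using that by (auto simp: F_def fun_eq_iff PiE_def extensional_def)
  qed
  then have "h X = fact (card X)" unfolding h_def by (simp add: card_permutations[OF refl assms])
  finally show ?thesis .
qed

section \<open>Intrinsic volumes of zonoids\<close>

lemma mixed_volume_indexed:
  fixes Ks :: "(real^'n) set list"
  assumes idx: "bij_betw idx (UNIV :: 'n set) {..<CARD('n)}"
  shows "mixed_volume Ks
    = (\<Sum>S\<in>Pow UNIV. (-1) ^ (CARD('n) - card S) * vol (\<Sum>k\<in>S. Ks ! idx k)) / fact CARD('n)"
proof -
  have inj: "inj idx" using idx by (simp add: bij_betw_def)
  have "(\<Sum>S\<in>Pow {..<CARD('n)}. (-1) ^ (CARD('n) - card S) * vol (\<Sum>i\<in>S. Ks ! i))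
      = (\<Sum>S\<in>Pow UNIV. (-1) ^ (CARD('n) - card (idx ` S)) * vol (\<Sum>i\<in>idx ` S. Ks ! i))"
    by (rule sum.reindex_bij_betw[OF bij_betw_Pow[OF idx], symmetric])
  also have "\<dots> = (\<Sum>S\<in>Pow UNIV. (-1) ^ (CARD('n) - card S) * vol (\<Sum>k\<in>S. Ks ! idx k))"
  proof (rule sum.cong[OF refl])
    fix S :: "'n set"
    have "inj_on idx S" using inj by (rule inj_on_subset) simp
    then show "(-1) ^ (CARD('n) - card (idx ` S)) * vol (\<Sum>i\<in>idx ` S. Ks ! i)
        = (-1) ^ (CARD('n) - card S) * vol (\<Sum>k\<in>S. Ks ! idx k)"
      by (simp add: card_image sum.reindex)
  qed
  finally show ?thesis by (simp add: mixed_volume_def)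
qed

lemma PiM_distr:
  fixes \<beta> :: "'n::finite \<Rightarrow> 'a measure"
  assumes \<beta>: "\<And>k. prob_space (\<beta> k)" and G: "\<And>k. G k \<in> measurable (\<beta> k) (\<nu> k)"
  shows "PiM UNIV (\<lambda>k. distr (\<beta> k) (\<nu> k) (G k)) = distr (PiM UNIV \<beta>) (PiM UNIV \<nu>) (\<lambda>w k. G k (w k))"
    and "(\<lambda>w k. G k (w k)) \<in> measurable (PiM UNIV \<beta>) (PiM UNIV \<nu>)"
proof -
  interpret B: product_prob_space \<beta> UNIV by (rule product_prob_spaceI) (rule \<beta>)
  interpret N: product_prob_space "\<lambda>k. distr (\<beta> k) (\<nu> k) (G k)" UNIV
    by (rule product_prob_spaceI) (rule prob_space.prob_space_distr[OF \<beta> G])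
  show T: "(\<lambda>w k. G k (w k)) \<in> measurable (PiM UNIV \<beta>) (PiM UNIV \<nu>)"
  proof (rule measurable_PiM_single')
    show "(\<lambda>w. G k (w k)) \<in> measurable (PiM UNIV \<beta>) (\<nu> k)" for k
      by (rule measurable_compose[OF measurable_component_singleton[of k UNIV \<beta>] G[of k]]) simp
    show "(\<lambda>w k. G k (w k)) \<in> space (PiM UNIV \<beta>) \<rightarrow> (\<Pi>\<^sub>E i\<in>UNIV. space (\<nu> i))"
      using measurable_space[OF G] by (auto simp: space_PiM PiE_def Pi_def)
  qed
  have "distr (PiM UNIV \<beta>) (PiM UNIV \<nu>) (\<lambda>w k. G k (w k)) = PiM UNIV (\<lambda>k. distr (\<beta> k) (\<nu> k) (G k))"
  proof (rule N.PiM_eqI)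
    show "sets (distr (PiM UNIV \<beta>) (PiM UNIV \<nu>) (\<lambda>w k. G k (w k))) = sets (PiM UNIV (\<lambda>k. distr (\<beta> k) (\<nu> k) (G k)))"
      by (simp cong: sets_PiM_cong)
    fix X assume "\<And>i. i \<in> UNIV \<Longrightarrow> X i \<in> sets (distr (\<beta> i) (\<nu> i) (G i))"
    then have X: "X i \<in> sets (\<nu> i)" for i by simp
    have "(\<lambda>w k. G k (w k)) -` (Pi\<^sub>E UNIV X) \<inter> space (PiM UNIV \<beta>)
        = (\<Pi>\<^sub>E k\<in>UNIV. G k -` X k \<inter> space (\<beta> k))"
      by (auto simp: space_PiM PiE_def Pi_def)
    then have "emeasure (distr (PiM UNIV \<beta>) (PiM UNIV \<nu>) (\<lambda>w k. G k (w k))) (Pi\<^sub>E UNIV X)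
        = emeasure (PiM UNIV \<beta>) (\<Pi>\<^sub>E k\<in>UNIV. G k -` X k \<inter> space (\<beta> k))"
      using X by (subst emeasure_distr[OF T]) (auto intro: sets_PiM_I_finite)
    also have "\<dots> = (\<Prod>k\<in>UNIV. emeasure (\<beta> k) (G k -` X k \<inter> space (\<beta> k)))"
      using measurable_sets[OF G X] by (intro B.emeasure_PiM) auto
    also have "\<dots> = (\<Prod>k\<in>UNIV. emeasure (distr (\<beta> k) (\<nu> k) (G k)) (X k))"
      using G X by (intro prod.cong refl) (simp add: emeasure_distr)
    finally show "emeasure (distr (PiM UNIV \<beta>) (PiM UNIV \<nu>) (\<lambda>w k. G k (w k))) (Pi\<^sub>E UNIV X)
        = (\<Prod>k\<in>UNIV. emeasure (distr (\<beta> k) (\<nu> k) (G k)) (X k))" .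
  qed simp
  then show "PiM UNIV (\<lambda>k. distr (\<beta> k) (\<nu> k) (G k)) = distr (PiM UNIV \<beta>) (PiM UNIV \<nu>) (\<lambda>w k. G k (w k))"
    by simp
qed

lemma support_cball: "support_function (cball 0 1 :: (real^'n) set) u = norm u"
proof (rule antisym)
  show "support_function (cball 0 1) u \<le> norm u"
  proof (rule support_le)
    fix x :: "real^'n" assume "x \<in> cball 0 1"
    then have "norm x * norm u \<le> 1 * norm u" by (intro mult_right_mono) auto
    then show "x \<bullet> u \<le> norm u" using norm_cauchy_schwarz[of x u] by simp
  qed simp
  show "norm u \<le> support_function (cball 0 1) u"
  proof (cases "u = 0")
    case True
    then show ?thesis using inner_le_support[OF compact_cball, of 0 0 1 u] by simp
  next
    case False
    then show ?thesis
      using inner_le_support[OF compact_cball, of "(1 / norm u) *\<^sub>R u" 0 1 u]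
      by (simp add: dot_square_norm power2_eq_square)
  qed
qed

definition orthonormal :: "('n \<Rightarrow> real^'n) \<Rightarrow> bool" where
  "orthonormal e \<longleftrightarrow> (\<forall>i j. e i \<bullet> e j = (if i = j then 1 else 0))"

lemma orthonormal_det: "orthonormal e \<Longrightarrow> \<bar>rdet e\<bar> = 1"
  using orthonormal_on_pvol[of UNIV e] by (simp add: orthonormal_def pvol_UNIV)

lemma orthonormal_expand:
  assumes "orthonormal e" shows "(\<Sum>k\<in>UNIV. (x \<bullet> e k) *\<^sub>R e k) = (x :: real^'n)"
proof -
  have "pvol UNIV e > 0" using orthonormal_det[OF assms] by (simp add: pvol_UNIV)
  note ind = pvol_pos_independent[OF this]
  have "span (range e) = UNIV"
    using ind(3) dim_eq_full[of "range e"] by simp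
  then have x: "x \<in> span (range e)" by simp
  have "(\<Sum>v\<in>range e. (x \<bullet> v) *\<^sub>R v) = x"
    using assms x
    by (intro orthonormal_basis_expand) (auto simp: orthonormal_def pairwise_def orthogonal_def norm_eq_1)
  then show ?thesis using ind(1) by (simp add: sum.reindex)
qed

text \<open>Let \<open>T\<close> be the projection to the orthogonal complement of the vectors \<open>e k\<close>, \<open>k \<in> A\<close>, of an orthonormal
  frame, and \<open>BE\<close> the unit ball of this complement. The mixed volume of the segments from \<open>- e k\<close> to
  \<open>e k\<close>, \<open>k \<in> A\<close>, and of copies of \<open>BE\<close> is computed in two ways: as a determinant integral, since all these
  bodies are zonoids, and from the definition, since their partial sums are cylinders. This gives
  the constant that relates intrinsic volumes to determinant integrals.\<close>

context
  fixes e :: "'n::finite \<Rightarrow> real^'n" and A :: "'n set" and T :: "real^'n \<Rightarrow> real^'n" and BE :: "(real^'n) set"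
  assumes e: "orthonormal e"
  defines "T \<equiv> \<lambda>x. \<Sum>k\<in>-A. (x \<bullet> e k) *\<^sub>R e k"
    and "BE \<equiv> {x. norm x \<le> 1 \<and> (\<forall>k\<in>A. x \<bullet> e k = 0)}"
begin

lemma frame_proj_expand: "T x = x - (\<Sum>k\<in>A. (x \<bullet> e k) *\<^sub>R e k)"
proof -
  have "x = (\<Sum>k\<in>A. (x \<bullet> e k) *\<^sub>R e k) + T x"
    unfolding T_def using orthonormal_expand[OF e, of x]
      sum.union_disjoint[of A "-A" "\<lambda>k. (x \<bullet> e k) *\<^sub>R e k"] by simp
  then show ?thesis by (simp add: algebra_simps)
qed

lemma frame_proj_inner: "T x \<bullet> e k = (if k \<in> A then 0 else x \<bullet> e k)"
proof -
  have "T x \<bullet> e k = (\<Sum>i\<in>-A. if i = k then x \<bullet> e k else 0)"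
    unfolding T_def inner_sum_left using e by (intro sum.cong) (auto simp: orthonormal_def)
  then show ?thesis by simp
qed

lemma frame_proj_sym: "T x \<bullet> y = x \<bullet> T y"
  unfolding T_def by (simp add: inner_sum_left inner_sum_right inner_commute mult.commute)

lemma frame_proj_fixed: "(\<forall>k\<in>A. x \<bullet> e k = 0) \<Longrightarrow> T x = x"
  by (simp add: frame_proj_expand)

lemma frame_proj_borel: "T \<in> borel_measurable borel"
  unfolding T_def by measurable

lemma norm_frame_proj_le: "norm (T x) \<le> norm x"
proof -
  have "T x \<bullet> T x = x \<bullet> T x"
    using frame_proj_sym[of x "T x"] frame_proj_fixed[of "T x"] by (simp add: frame_proj_inner)
  then have "norm (T x) * norm (T x) \<le> norm x * norm (T x)"
    using norm_cauchy_schwarz[of x "T x"] by (simp add: dot_square_norm power2_eq_square)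
  then show ?thesis by (metis mult_right_le_imp_le norm_ge_zero order_le_less)
qed

lemma complement_ball_body: "convex_body BE"
proof -
  have "closed {x. \<forall>k\<in>A. x \<bullet> e k = 0}"
    unfolding Ball_def by (intro closed_Collect_all closed_Collect_imp closed_Collect_eq continuous_intros open_Collect_const)
  moreover have "BE = cball 0 1 \<inter> {x. \<forall>k\<in>A. x \<bullet> e k = 0}" by (auto simp: BE_def)
  ultimately have "compact BE" by (simp add: compact_Int_closed)
  moreover have "convex BE"
  proof -
    have "convex {x. \<forall>k\<in>A. x \<bullet> e k = 0}"
      by (rule subspace_imp_convex) (auto simp: subspace_def inner_add_left)
    then show ?thesis using \<open>BE = _\<close> by (simp add: convex_Int)
  qed
  moreover have "0 \<in> BE" by (simp add: BE_def)
  ultimately show ?thesis by (auto simp: convex_body_def)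
qed

lemma complement_ball_support: "support_function BE u = norm (T u)"
proof (rule antisym)
  have b: "compact BE" "BE \<noteq> {}" using complement_ball_body by (auto simp: convex_body_def)
  show "support_function BE u \<le> norm (T u)"
  proof (rule support_le[OF b(2)])
    fix x assume x: "x \<in> BE"
    then have "x \<bullet> u = x \<bullet> T u" using frame_proj_fixed[of x] frame_proj_sym[of x u] by (simp add: BE_def)
    also have "\<dots> \<le> norm x * norm (T u)" by (rule norm_cauchy_schwarz)
    also have "\<dots> \<le> 1 * norm (T u)" using x by (intro mult_right_mono) (auto simp: BE_def)
    finally show "x \<bullet> u \<le> norm (T u)" by simp
  qed
  show "norm (T u) \<le> support_function BE u"
  proof (cases "T u = 0")
    case True
    have "0 \<in> BE" by (simp add: BE_def)
    from inner_le_support[OF b(1) this, of u] True show ?thesis by simp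
  next
    case False
    define w where "w = (1 / norm (T u)) *\<^sub>R T u"
    have "w \<in> BE" using False by (simp add: w_def BE_def frame_proj_inner)
    moreover have "T u \<bullet> u = T u \<bullet> T u"
      using frame_proj_sym[of u "T u"] frame_proj_fixed[of "T u"] by (simp add: frame_proj_inner inner_commute)
    then have "w \<bullet> u = norm (T u)"
      using False by (simp add: w_def dot_square_norm power2_eq_square)
    ultimately show ?thesis using inner_le_support[OF b(1), of w u] by simp
  qed
qed

text \<open>Row operations: the rows \<open>e k\<close> with \<open>k \<in> A\<close> absorb the components that the projection removes.\<close>

lemma rdet_project: "rdet (\<lambda>k. if k \<in> A then e k else T (w k)) = rdet (\<lambda>k. if k \<in> A then e k else w k)"
proof -
  have "rdet (\<lambda>k. if k \<in> A then e k else if k \<in> B then T (w k) else w k)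
      = rdet (\<lambda>k. if k \<in> A then e k else w k)" if "B \<subseteq> - A" for B
  proof -
    have "finite B" by simp
    then show ?thesis using that
    proof (induction B rule: finite_induct)
      case (insert b B)
      let ?v = "\<lambda>k. if k \<in> A then e k else if k \<in> B then T (w k) else w k"
      have b: "b \<notin> A" using insert by auto
      have "e k \<in> span (?v ` (UNIV - {b}))" if "k \<in> A" for k
        using that b by (intro span_base image_eqI[of _ _ k]) auto
      then have "- (\<Sum>k\<in>A. (w b \<bullet> e k) *\<^sub>R e k) \<in> span (?v ` (UNIV - {b}))"
        by (intro span_neg span_sum span_scale)
      from rdet_upd_span[OF this]
      have "rdet (?v(b := T (w b))) = rdet ?v"
        using b insert.hyps by (simp add: frame_proj_expand)
      moreover have "?v(b := T (w b)) = (\<lambda>k. if k \<in> A then e k else if k \<in> insert b B then T (w k) else w k)"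
        using b by auto
      ultimately show ?case using insert by simp
    qed (simp cong: if_cong)
  qed
  from this[of "- A"] show ?thesis by (simp cong: if_cong)
qed

text \<open>If a segment is missing, the sum lies in a hyperplane. Otherwise the coordinates with respect to the
  frame identify it with a cylinder whose radius is the number of balls that are added.\<close>

lemma vol_partial_sum:
  "vol (\<Sum>k\<in>S. if k \<in> A then closed_segment (- e k) (e k) else BE)
    = (if A \<subseteq> S then 2 ^ card A * unit_ball_vol (real (card (-A))) * real (card (S - A)) ^ card (-A) else 0)"
proof (cases "A \<subseteq> S")
  case False
  then obtain a where a: "a \<in> A" "a \<notin> S" by blast
  let ?K = "\<lambda>k. if k \<in> A then closed_segment (- e k) (e k) else BE"
  have "x \<bullet> e a = 0" if "k \<in> S" "x \<in> ?K k" for k x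
  proof (cases "k \<in> A")
    case True
    then have "e k \<bullet> e a = 0" using e a that by (auto simp: orthonormal_def)
    then show ?thesis using that True by (auto simp: closed_segment_def inner_add_left inner_diff_left)
  next
    case False then show ?thesis using that a by (simp add: BE_def)
  qed
  then have "x \<bullet> e a = 0" if "x \<in> (\<Sum>k\<in>S. ?K k)" for x
    using that by (auto simp: set_sum_alt inner_sum_left intro!: sum.neutral)
  moreover have "e a \<noteq> 0" using e by (auto simp: orthonormal_def) (metis inner_zero_left zero_neq_one)
  ultimately have "negligible (\<Sum>k\<in>S. ?K k)"
    by (intro negligible_subset[OF negligible_hyperplane[of "e a" 0]]) (auto simp: inner_commute)
  moreover have "compact (\<Sum>k\<in>S. ?K k)"
    using complement_ball_body by (intro compact_set_sum) (auto simp: convex_body_def)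
  ultimately have "vol (\<Sum>k\<in>S. ?K k) = 0" using negligible_imp_measure0 by (simp add: vol_eq_lebesgue)
  then show ?thesis using False by simp
next
  case True
  let ?K = "\<lambda>k. if k \<in> A then closed_segment (- e k) (e k) else BE"
  let ?t = "real (card (S - A))"
  define f where "f y = (\<Sum>k\<in>UNIV. y $ k *\<^sub>R e k)" for y :: "real^'n"
  have lin: "linear f"
    by (rule linearI) (simp_all add: f_def scaleR_left_distrib sum.distrib scaleR_right.sum)
  have f_inner: "f y \<bullet> e k = y $ k" for y k
  proof -
    have "f y \<bullet> e k = (\<Sum>i\<in>UNIV. if i = k then y $ k else 0)"
      unfolding f_def inner_sum_left using e by (intro sum.cong) (auto simp: orthonormal_def)
    then show ?thesis by simp
  qed
  have f_coord: "f (\<chi> k. x \<bullet> e k) = x" for x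
    unfolding f_def using orthonormal_expand[OF e, of x] by simp
  have norm_T: "norm (T x) = sqrt (\<Sum>k\<in>-A. (x \<bullet> e k)\<^sup>2)" for x
  proof -
    have "T x \<bullet> T x = x \<bullet> T x"
      using frame_proj_sym[of x "T x"] frame_proj_fixed[of "T x"] by (simp add: frame_proj_inner)
    also have "\<dots> = (\<Sum>k\<in>-A. (x \<bullet> e k)\<^sup>2)"
      unfolding T_def inner_sum_right by (intro sum.cong) (auto simp: power2_eq_square)
    finally show ?thesis by (simp add: norm_eq_sqrt_inner)
  qed
  have BE': "BE \<noteq> {}" "convex BE" using complement_ball_body by (auto simp: convex_body_def)
  have one: "(\<lambda>x. 1 *\<^sub>R x) ` BE = BE" by simp
  have "(\<Sum>k\<in>S. ?K k) = (\<Sum>k\<in>A. ?K k) + (\<Sum>k\<in>S - A. ?K k)"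
    using sum.subset_diff[OF True, of ?K] by (simp add: add.commute del: sum.If_cases)
  also have "(\<Sum>k\<in>A. ?K k) = (\<Sum>k\<in>A. closed_segment (- e k) (e k))" by simp
  also have "(\<Sum>k\<in>S - A. ?K k) = (\<Sum>k\<in>S - A. (\<lambda>x. 1 *\<^sub>R x) ` BE)"
    by (intro sum.cong) (simp_all only: one Diff_iff if_False)
  also have "\<dots> = (\<lambda>x. ?t *\<^sub>R x) ` BE"
    using sum_scaled_convex_set[OF BE'(2,1), of "S - A" "\<lambda>_. 1"] by simp
  finally have dec: "(\<Sum>k\<in>S. ?K k) = (\<Sum>k\<in>A. closed_segment (- e k) (e k)) + (\<lambda>x. ?t *\<^sub>R x) ` BE" .
  have "(\<Sum>k\<in>S. ?K k) = f ` std_cylinder A ?t"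
  proof (intro set_eqI iffI)
    fix x assume "x \<in> (\<Sum>k\<in>S. ?K k)"
    then obtain p b where p: "p \<in> (\<Sum>k\<in>A. closed_segment (- e k) (e k))" and b: "b \<in> BE" and x: "x = p + ?t *\<^sub>R b"
      unfolding dec by (auto simp: set_plus_def)
    obtain s where s: "p = (\<Sum>k\<in>A. s k)" "\<And>k. k \<in> A \<Longrightarrow> s k \<in> closed_segment (- e k) (e k)"
      using p by (auto simp: set_sum_alt)
    have "\<exists>c. \<bar>c\<bar> \<le> 1 \<and> s k = c *\<^sub>R e k" if k: "k \<in> A" for k
    proof -
      obtain u where u: "0 \<le> u" "u \<le> 1" "s k = (1 - u) *\<^sub>R (- e k) + u *\<^sub>R e k"
        using s(2)[OF k] by (auto simp: closed_segment_def)
      have "s k = u *\<^sub>R e k - (1 - u) *\<^sub>R e k" unfolding u(3) by simp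
      also have "\<dots> = (u - (1 - u)) *\<^sub>R e k" by (simp only: scaleR_left_diff_distrib)
      finally show ?thesis using u by (intro exI[of _ "u - (1 - u)"]) auto
    qed
    then obtain c where c: "\<And>k. k \<in> A \<Longrightarrow> \<bar>c k\<bar> \<le> 1 \<and> s k = c k *\<^sub>R e k" by metis
    have p_inner: "p \<bullet> e k = (if k \<in> A then c k else 0)" for k
    proof -
      have "p \<bullet> e k = (\<Sum>i\<in>A. if i = k then c k else 0)"
        unfolding s(1) inner_sum_left using c e by (intro sum.cong) (auto simp: orthonormal_def)
      then show ?thesis by simp
    qed
    have xin: "x \<bullet> e k = (if k \<in> A then c k else ?t * (b \<bullet> e k))" for k
      using p_inner[of k] b by (auto simp: x inner_add_left BE_def)
    have "(\<Sum>k\<in>-A. (x \<bullet> e k)\<^sup>2) = ?t\<^sup>2 * (\<Sum>k\<in>-A. (b \<bullet> e k)\<^sup>2)"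
      by (simp add: xin sum_distrib_left power_mult_distrib)
    then have "sqrt (\<Sum>k\<in>-A. (x \<bullet> e k)\<^sup>2) = ?t * norm (T b)"
      by (simp add: norm_T real_sqrt_mult)
    also have "\<dots> \<le> ?t * 1" using b frame_proj_fixed[of b] by (intro mult_left_mono) (auto simp: BE_def)
    finally have "(\<chi> k. x \<bullet> e k) \<in> std_cylinder A ?t" using c xin by (simp add: std_cylinder_def)
    then show "x \<in> f ` std_cylinder A ?t" using f_coord[of x] by (metis image_eqI)
  next
    fix x assume "x \<in> f ` std_cylinder A ?t"
    then obtain y where y: "x = f y" "y \<in> std_cylinder A ?t" by blast
    have xT: "x = (\<Sum>k\<in>A. (x \<bullet> e k) *\<^sub>R e k) + T x" by (simp add: frame_proj_expand)
    have "(x \<bullet> e k) *\<^sub>R e k \<in> closed_segment (- e k) (e k)" if "k \<in> A" for k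
    proof -
      have "\<bar>x \<bullet> e k\<bar> \<le> 1" using y that f_inner by (auto simp: std_cylinder_def)
      define u where "u = (1 + x \<bullet> e k) / 2"
      have "x \<bullet> e k = u - (1 - u)" by (simp add: u_def field_simps)
      then have "(x \<bullet> e k) *\<^sub>R e k = u *\<^sub>R e k - (1 - u) *\<^sub>R e k"
        by (simp only: scaleR_left_diff_distrib)
      also have "\<dots> = (1 - u) *\<^sub>R (- e k) + u *\<^sub>R e k" by simp
      finally have "(x \<bullet> e k) *\<^sub>R e k = (1 - u) *\<^sub>R (- e k) + u *\<^sub>R e k" .
      moreover have "0 \<le> u" "u \<le> 1" using \<open>\<bar>x \<bullet> e k\<bar> \<le> 1\<close> by (auto simp: u_def)
      ultimately show ?thesis unfolding closed_segment_def by blast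
    qed
    then have 1: "(\<Sum>k\<in>A. (x \<bullet> e k) *\<^sub>R e k) \<in> (\<Sum>k\<in>A. closed_segment (- e k) (e k))"
      by (auto simp: set_sum_alt)
    have nT: "norm (T x) \<le> ?t" unfolding norm_T using y f_inner by (simp add: std_cylinder_def)
    have "T x \<in> (\<lambda>x. ?t *\<^sub>R x) ` BE"
    proof (cases "?t = 0")
      case True
      with nT have "norm (T x) \<le> 0" by linarith
      then have "T x = 0" by simp
      moreover have "0 \<in> BE" by (simp add: BE_def)
      ultimately show ?thesis by (intro image_eqI[of _ _ 0]) auto
    next
      case False
      then have tp: "0 < ?t" using of_nat_0_le_iff[of "card (S - A)", where 'a = real] by linarith
      have "norm (T x) / ?t \<le> 1" using nT tp by (simp only: divide_le_eq_1_pos)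
      then have "(1 / ?t) *\<^sub>R T x \<in> BE" by (simp add: BE_def frame_proj_inner)
      then show ?thesis using False by (intro image_eqI[of _ _ "(1 / ?t) *\<^sub>R T x"]) auto
    qed
    then show "x \<in> (\<Sum>k\<in>S. ?K k)" unfolding dec using 1 xT by (metis set_plus_intro)
  qed
  then have "vol (\<Sum>k\<in>S. ?K k) = \<bar>det (matrix f)\<bar> * vol (std_cylinder A ?t)"
    using vol_linear_image[OF lin compact_std_cylinder] by simp
  also have "matrix f = transpose (\<chi> k. e k)"
  proof -
    have "f (axis j 1) = e j" for j
    proof -
      have "f (axis j 1) = (\<Sum>k\<in>UNIV. if k = j then e k else 0)"
        unfolding f_def by (intro sum.cong) (auto simp: axis_def)
      then show ?thesis by simp
    qed
    then show ?thesis by (simp add: matrix_def transpose_def vec_eq_iff)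
  qed
  also have "\<bar>det (transpose (\<chi> k. e k))\<bar> = 1" using orthonormal_det[OF e] by simp
  finally show ?thesis using True vol_std_cylinder[of ?t A] by simp
qed

lemma integral_abs_rdet_frame:
  assumes \<beta>: "gen_measure \<beta>" "\<And>u. (\<integral>v. \<bar>u \<bullet> v\<bar> \<partial>\<beta>) = norm u"
  shows "(\<integral>w. \<bar>rdet (\<lambda>k. if k \<in> A then e k else w k)\<bar> \<partial>PiM UNIV (\<lambda>_. \<beta>))
    = fact (card (-A)) * 2 ^ card A * unit_ball_vol (real (card (-A))) / 2 ^ CARD('n)"
proof -
  define n where "n = CARD('n)"
  define G where "G k = (if k \<in> A then (\<lambda>_. e k) else T)" for k
  define \<mu> where "\<mu> k = distr \<beta> borel (G k)" for k
  define K where "K k = (if k \<in> A then closed_segment (- e k) (e k) else BE)" for k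
  interpret prob_space \<beta> by (rule gen_measureD[OF \<beta>(1)])
  have Gm: "G k \<in> measurable \<beta> borel" for k
    using gen_measurable[OF \<beta>(1)] frame_proj_borel by (auto simp: G_def)
  have nG: "norm (G k x) \<le> 1 + norm x" for k x
    using norm_frame_proj_le[of x] e by (auto simp: G_def orthonormal_def norm_eq_1[THEN iffD2])
  have g\<mu>: "gen_measure (\<mu> k)" for k
  proof -
    have "integrable \<beta> (\<lambda>x. norm (G k x))"
    proof (rule Bochner_Integration.integrable_bound)
      show "integrable \<beta> (\<lambda>x. 1 + norm x)" using gen_measureD(3)[OF \<beta>(1)] by simp
      show "(\<lambda>x. norm (G k x)) \<in> borel_measurable \<beta>" using Gm by simp
      show "AE x in \<beta>. norm (norm (G k x)) \<le> norm (1 + norm x)" using nG by (auto intro!: always_eventually)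
    qed
    then show ?thesis
      unfolding gen_measure_def \<mu>_def using Gm prob_space_distr[OF Gm]
      by (simp add: integrable_distr_eq)
  qed
  have gen: "generates (\<mu> k) (K k)" for k
  proof -
    have "(\<integral>v. \<bar>u \<bullet> v\<bar> \<partial>\<mu> k) = support_function (K k) u" for u
    proof -
      have "(\<integral>v. \<bar>u \<bullet> v\<bar> \<partial>\<mu> k) = (\<integral>v. \<bar>u \<bullet> G k v\<bar> \<partial>\<beta>)"
        unfolding \<mu>_def by (subst integral_distr[OF Gm]) auto
      also have "\<dots> = support_function (K k) u"
      proof (cases "k \<in> A")
        case True then show ?thesis by (simp add: G_def K_def support_segment prob_space)
      next
        case False
        have "(\<integral>v. \<bar>u \<bullet> T v\<bar> \<partial>\<beta>) = (\<integral>v. \<bar>T u \<bullet> v\<bar> \<partial>\<beta>)" by (simp only: frame_proj_sym)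
        then show ?thesis using False \<beta>(2)[of "T u"] by (simp add: G_def K_def complement_ball_support)
      qed
      finally show ?thesis .
    qed
    then show ?thesis using g\<mu> by (simp add: generates_def)
  qed
  have body: "convex_body (K k)" for k using complement_ball_body by (auto simp: K_def convex_body_def)
  obtain idx :: "'n \<Rightarrow> nat" where idx: "bij_betw idx UNIV {..<CARD('n)}"
    using finite_same_card_bij[of "UNIV :: 'n set" "{..<CARD('n)}"] by auto
  define Ks where "Ks = map (\<lambda>i. K (inv_into UNIV idx i)) [0..<n]"
  have Ks: "Ks ! idx k = K k" for k
    using idx bij_betwE[OF idx] by (auto simp: Ks_def n_def bij_betw_def)
  have "mixed_volume Ks = 2 ^ n / fact n * (\<integral>v. \<bar>rdet v\<bar> \<partial>PiM UNIV \<mu>)"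
    unfolding n_def using body gen by (intro mixed_volume_zonoids[OF idx]) (auto simp: Ks)
  also have "(\<integral>v. \<bar>rdet v\<bar> \<partial>PiM UNIV \<mu>)
      = (\<integral>w. \<bar>rdet (\<lambda>k. if k \<in> A then e k else w k)\<bar> \<partial>PiM UNIV (\<lambda>_. \<beta>))"
  proof -
    note pd = PiM_distr[where \<beta>="\<lambda>_. \<beta>" and G=G and \<nu>="\<lambda>_. borel", OF prob_space_axioms Gm]
    have sb: "sets (PiM UNIV (\<lambda>_. borel)) = sets (PiM UNIV \<mu>)"
      by (rule sets_PiM_cong) (auto simp: \<mu>_def)
    have "(\<lambda>v. \<bar>rdet v\<bar>) \<in> borel_measurable (PiM UNIV \<mu>)"
      using gen_measurable_rdet[of \<mu> "\<lambda>_ x. x"] g\<mu> by simp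
    then have m: "(\<lambda>v. \<bar>rdet v\<bar>) \<in> borel_measurable (PiM UNIV (\<lambda>_. borel))"
      using measurable_cong_sets[OF sb refl, where N = borel] by simp
    have "(\<integral>v. \<bar>rdet v\<bar> \<partial>PiM UNIV \<mu>) = (\<integral>w. \<bar>rdet (\<lambda>k. G k (w k))\<bar> \<partial>PiM UNIV (\<lambda>_. \<beta>))"
      unfolding \<mu>_def pd(1) by (rule integral_distr[OF pd(2) m])
    also have "(\<lambda>w. rdet (\<lambda>k. G k (w k))) = (\<lambda>w. rdet (\<lambda>k. if k \<in> A then e k else w k))"
    proof
      fix w
      have "(\<lambda>k. G k (w k)) = (\<lambda>k. if k \<in> A then e k else T (w k))" by (auto simp: G_def)
      then show "rdet (\<lambda>k. G k (w k)) = rdet (\<lambda>k. if k \<in> A then e k else w k)"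
        using rdet_project[of w] by simp
    qed
    finally show ?thesis .
  qed
  finally have mv: "mixed_volume Ks = 2 ^ n / fact n *
      (\<integral>w. \<bar>rdet (\<lambda>k. if k \<in> A then e k else w k)\<bar> \<partial>PiM UNIV (\<lambda>_. \<beta>))" .
  let ?c = "2 ^ card A * unit_ball_vol (real (card (-A)))"
  have cA: "card A + card (-A) = n" unfolding n_def using card_Un_disjoint[of A "-A"] by simp
  have "mixed_volume Ks * fact n = (\<Sum>S\<in>Pow UNIV. (-1) ^ (n - card S) * vol (\<Sum>k\<in>S. K k))"
    unfolding mixed_volume_indexed[OF idx] n_def by (simp add: Ks)
  also have "\<dots> = (\<Sum>S\<in>Pow UNIV. (-1) ^ (n - card S) * (if A \<subseteq> S then ?c * real (card (S - A)) ^ card (-A) else 0))"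
    unfolding K_def vol_partial_sum ..
  also have "\<dots> = (\<Sum>S\<in>{S. A \<subseteq> S}. (-1) ^ (n - card S) * (?c * real (card (S - A)) ^ card (-A)))"
    by (rule sum.mono_neutral_cong_right) auto
  also have "\<dots> = (\<Sum>X\<in>Pow (-A). (-1) ^ (card (-A) - card X) * (?c * real (card X) ^ card (-A)))"
  proof (rule sum.reindex_bij_witness[of _ "\<lambda>X. A \<union> X" "\<lambda>S. S - A"])
    fix S assume "S \<in> {S. A \<subseteq> S}"
    then have S: "A \<subseteq> S" by simp
    then have "card S = card A + card (S - A)"
      using card_Un_disjoint[of A "S - A"] by (simp add: Un_absorb1)
    then have "n - card S = card (-A) - card (S - A)" using cA by simp
    then show "(-1) ^ (card (-A) - card (S - A)) * (?c * real (card (S - A)) ^ card (-A))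
        = (-1) ^ (n - card S) * (?c * real (card (S - A)) ^ card (-A))" by simp
  qed auto
  also have "\<dots> = ?c * (\<Sum>X\<in>Pow (-A). (-1) ^ (card (-A) - card X) * real (card X) ^ card (-A))"
    unfolding sum_distrib_left by (intro sum.cong refl) (simp add: mult_ac)
  also have "\<dots> = ?c * fact (card (-A))" by (subst alternating_sum_powers) auto
  finally have "2 ^ n * (\<integral>w. \<bar>rdet (\<lambda>k. if k \<in> A then e k else w k)\<bar> \<partial>PiM UNIV (\<lambda>_. \<beta>)) = ?c * fact (card (-A))"
    using mv by simp
  then show ?thesis unfolding n_def by (simp add: field_simps)
qed

end

text \<open>The mixed volume that defines the intrinsic volume is a determinant integral in which the rows in
  \<open>A\<close> come from \<open>\<mu>\<close> and the others from a generator of the ball. With the rows in \<open>A\<close> held fixed, they may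
  be replaced by an orthonormal frame of their span at the cost of the factor \<open>pvol A v\<close>; the remaining
  integral is a constant.\<close>

theorem intrinsic_volume_zonoid:
  fixes Z :: "(real^'n) set" and A :: "'n set"
  assumes body: "convex_body Z" and gen: "generates \<mu> Z"
  shows "intrinsic_volume (card A) Z
    = 2 ^ card A / fact (card A) * (\<integral>v. pvol A v \<partial>PiM UNIV (\<lambda>_. \<mu>))"
proof -
  define n where "n = CARD('n)"
  obtain \<beta> :: "(real^'n) measure" where \<beta>: "gen_measure \<beta>" "\<And>u. (\<integral>v. \<bar>u \<bullet> v\<bar> \<partial>\<beta>) = norm u"
    using ball_generator_exists by blast
  have g\<mu>: "gen_measure \<mu>" using gen by (simp add: generates_def)
  define N where "N k = (if k \<in> A then \<mu> else \<beta>)" for k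
  define K where "K k = (if k \<in> A then Z else cball 0 1)" for k
  have gN: "gen_measure (N k)" for k using g\<mu> \<beta> by (simp add: N_def)
  have cA: "card A + card (-A) = n" unfolding n_def using card_Un_disjoint[of A "-A"] by simp
  have C: "- A = UNIV - A" by auto
  obtain i1 where i1: "bij_betw i1 A {..<card A}"
    using finite_same_card_bij[of A "{..<card A}"] by auto
  obtain i2 where i2: "bij_betw i2 (-A) {card A..<n}"
    using finite_same_card_bij[of "-A" "{card A..<n}"] cA by auto
  define idx where "idx k = (if k \<in> A then i1 k else i2 k)" for k
  have "bij_betw idx (A \<union> -A) ({..<card A} \<union> {card A..<n})"
  proof (rule bij_betw_combine)
    show "bij_betw idx A {..<card A}" using i1 by (subst bij_betw_cong[where g=i1]) (auto simp: idx_def)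
    show "bij_betw idx (-A) {card A..<n}" using i2 by (subst bij_betw_cong[where g=i2]) (auto simp: idx_def)
  qed auto
  moreover have "{..<card A} \<union> {card A..<n} = {..<CARD('n)}" using cA by (auto simp: n_def)
  ultimately have idx: "bij_betw idx UNIV {..<CARD('n)}" by simp
  let ?Ks = "replicate (card A) Z @ replicate (n - card A) (cball 0 1)"
  have Ks: "?Ks ! idx k = K k" for k
  proof (cases "k \<in> A")
    case True
    then have "idx k < card A" using bij_betwE[OF i1] by (auto simp: idx_def)
    then show ?thesis using True by (simp add: nth_append K_def)
  next
    case False
    then have "card A \<le> idx k" "idx k < n" using bij_betwE[OF i2] by (auto simp: idx_def)
    then show ?thesis using False by (simp add: nth_append K_def)
  qed
  have "mixed_volume ?Ks = 2 ^ n / fact n * (\<integral>v. \<bar>rdet v\<bar> \<partial>PiM UNIV N)"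
    unfolding n_def
  proof (rule mixed_volume_zonoids[OF idx])
    fix k
    show "convex_body ((replicate (card A) Z @ replicate (CARD('n) - card A) (cball 0 1)) ! idx k)"
      using Ks[of k] body by (auto simp: n_def K_def convex_body_def)
    show "generates (N k) ((replicate (card A) Z @ replicate (CARD('n) - card A) (cball 0 1)) ! idx k)"
      using Ks[of k] gen \<beta> by (auto simp: n_def K_def N_def generates_def support_cball)
  qed
  also have "(\<integral>v. \<bar>rdet v\<bar> \<partial>PiM UNIV N)
      = (\<integral>v. (\<integral>w. \<bar>rdet (\<lambda>k. if k \<in> A then v k else w k)\<bar> \<partial>PiM UNIV (\<lambda>_. \<beta>)) \<partial>PiM UNIV (\<lambda>_. \<mu>))"
    by (rule integral_PiM_merge)
      (use gen_integrable_rdet[of N] gN gen_measureD(1)[OF g\<mu>] gen_measureD(1)[OF \<beta>(1)] in \<open>auto simp: N_def\<close>)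
  also have "(\<lambda>v. \<integral>w. \<bar>rdet (\<lambda>k. if k \<in> A then v k else w k)\<bar> \<partial>PiM UNIV (\<lambda>_. \<beta>))
      = (\<lambda>v. pvol A v * (fact (card (-A)) * 2 ^ card A * unit_ball_vol (real (card (-A))) / 2 ^ n))"
  proof
    fix v :: "'n \<Rightarrow> real^'n"
    let ?m = "\<lambda>v w k. if k \<in> A then v k else (w k :: real^'n)"
    show "(\<integral>w. \<bar>rdet (?m v w)\<bar> \<partial>PiM UNIV (\<lambda>_. \<beta>))
        = pvol A v * (fact (card (-A)) * 2 ^ card A * unit_ball_vol (real (card (-A))) / 2 ^ n)"
    proof (cases "pvol A v > 0")
      case False
      then have p0: "pvol A v = 0" using pvol_nonneg[of A v] by simp
      have "\<bar>rdet (?m v w)\<bar> = 0" for w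
      proof -
        have "\<bar>rdet (?m v w)\<bar> \<le> pvol A (?m v w) * pvol (-A) (?m v w)"
          using pvol_Un_le[of A "-A" "?m v w"] by (simp add: pvol_UNIV)
        also have "pvol A (?m v w) = pvol A v" by (rule pvol_cong) simp
        finally show ?thesis using p0 by simp
      qed
      then show ?thesis using p0 by simp
    next
      case True
      obtain u where u: "\<And>i j. i \<in> A \<Longrightarrow> j \<in> A \<Longrightarrow> u i \<bullet> u j = (if i = j then 1 else 0)"
        "span (u ` A) = span (v ` A)" using orthonormal_reframe[OF True] by blast
      obtain c where c: "completes A u c" using completes_exists by blast
      define e where "e k = (if k \<in> A then u k else c k)" for k
      have e: "orthonormal e"
        using u(1) c unfolding orthonormal_def completes_def e_def by (auto simp: inner_commute)
      have "\<bar>rdet (?m v w)\<bar> = pvol A v * \<bar>rdet (?m e w)\<bar>" for w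
      proof -
        have im: "?m v w ` A = v ` A" "?m e w ` A = u ` A" by (auto simp: e_def)
        have "pvol (A \<union> -A) (?m e w) * pvol A (?m v w) = pvol (A \<union> -A) (?m v w) * pvol A (?m e w)"
          by (rule pvol_span_ratio) (use im u(2) in auto)
        moreover have "pvol A (?m v w) = pvol A v" by (rule pvol_cong) simp
        moreover have "pvol A (?m e w) = 1" using u(1) by (intro orthonormal_on_pvol) (auto simp: e_def)
        ultimately show ?thesis by (simp add: pvol_UNIV mult.commute)
      qed
      then show ?thesis using integral_abs_rdet_frame[OF e \<beta>, of A] by (simp add: n_def)
    qed
  qed
  finally have mv: "mixed_volume ?Ks = 2 ^ n / fact n * ((\<integral>v. pvol A v \<partial>PiM UNIV (\<lambda>_. \<mu>)) *
      (fact (card (-A)) * 2 ^ card A * unit_ball_vol (real (card (-A))) / 2 ^ n))" by simp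
  have le: "card A \<le> n" and sub: "n - card A = card (-A)" using cA by auto
  have "real (n choose card A) = fact n / (fact (card A) * fact (n - card A))"
    using le by (rule binomial_fact)
  moreover have "unit_ball_vol (real (card (-A))) \<noteq> 0"
    by (rule less_imp_neq[symmetric]) simp
  ultimately show ?thesis
    unfolding intrinsic_volume_def n_def[symmetric] mv unfolding sub
    by (simp add: field_simps)
qed

section \<open>The inradius and nearby subspaces\<close>

lemma inradius_ge:
  fixes K :: "(real^'n) set"
  assumes K: "compact K" and r: "0 \<le> r" and L: "subspace L" "dim L = i" "1 \<le> i"
    and sub: "(\<lambda>x. c + x) ` (L \<inter> cball 0 r) \<subseteq> K"
  shows "r \<le> inradius i K"
  unfolding inradius_def
proof (rule cSup_upper)
  show "r \<in> {r. 0 \<le> r \<and> (\<exists>c L. subspace L \<and> dim L = i \<and> (\<lambda>x. c + x) ` (L \<inter> cball 0 r) \<subseteq> K)}"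
    using r L sub by blast
  obtain b where b: "\<And>x. x \<in> K \<Longrightarrow> norm x \<le> b"
    using compact_imp_bounded[OF K] by (auto simp: bounded_iff)
  show "bdd_above {r. 0 \<le> r \<and> (\<exists>c L. subspace L \<and> dim L = i \<and> (\<lambda>x. c + x) ` (L \<inter> cball 0 r) \<subseteq> K)}"
  proof (rule bdd_aboveI[of _ b], safe)
    fix s c and L :: "(real^'n) set"
    assume s: "0 \<le> s" and L: "subspace L" "i = dim L" and sub: "(\<lambda>x. c + x) ` (L \<inter> cball 0 s) \<subseteq> K"
    have "\<not> L \<subseteq> {0}"
    proof
      assume "L \<subseteq> {0}"
      then have "dim L = 0" by (rule dim_eq_0[THEN iffD2])
      then show False using L(2) assms(5) by linarith
    qed
    then obtain w where w: "w \<in> L" "w \<noteq> 0" by auto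
    define z where "z = (s / norm w) *\<^sub>R w"
    have nz: "norm z = s" "z \<in> L" "- z \<in> L"
      using w s L by (auto simp: z_def subspace_scale subspace_neg)
    then have "z \<in> L \<inter> cball 0 s" "- z \<in> L \<inter> cball 0 s" by auto
    then have "c + z \<in> K" "c + - z \<in> K" using sub by blast+
    then have "norm (c + z) \<le> b" "norm (c - z) \<le> b" using b by auto
    moreover have "(c + z) - (c - z) = 2 *\<^sub>R z" by (simp add: scaleR_2)
    then have "2 * norm z \<le> norm (c + z) + norm (c - z)"
      using norm_triangle_ineq4[of "c + z" "c - z"] by simp
    ultimately show "s \<le> b" using nz by simp
  qed
qed

lemma pvol_pos_if_independent:
  fixes A :: "'n::finite set"
  assumes "inj_on v A" "independent (v ` A)"
  shows "pvol A v > 0"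
proof -
  have "finite A" by simp
  then show ?thesis using assms
  proof (induction A rule: finite_induct)
    case (insert a A)
    have ind: "independent (v ` A)" by (rule independent_mono[OF insert.prems(2)]) auto
    have "v a \<notin> v ` A" using insert by (auto simp: inj_on_def)
    then have "v a \<notin> span (v ` A)"
      using insert.prems(2) by (simp add: independent_insert)
    moreover obtain p where "p \<in> span (v ` A)" "infdist (v a) (span (v ` A)) = norm (v a - p)"
      using subspace_residual[OF subspace_span] by metis
    ultimately have "infdist (v a) (span (v ` A)) > 0" by auto
    then show ?case using insert ind by (simp add: pvol_insert)
  qed simp
qed

lemma continuous_on_pvol: "continuous_on S (\<lambda>x :: real^'n^'n. pvol A (\<lambda>i. x $ i))"
proof -
  have "continuous_on S (\<lambda>x :: real^'n^'n. if i \<in> A \<and> j \<in> A then x $ i \<bullet> x $ j else if i = j then 1 else 0)" for i j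
    by (cases "i \<in> A \<and> j \<in> A") (auto intro!: continuous_intros)
  then show ?thesis unfolding pvol_def det_def
    by (auto intro!: continuous_intros)
qed

lemma symmetric_body_mem:
  fixes Z :: "(real^'n) set"
  assumes Z: "convex_body Z" and sym: "\<And>u. support_function Z (- u) = support_function Z u"
    and x: "x \<in> Z" and c: "\<bar>c\<bar> \<le> 1"
  shows "c *\<^sub>R x \<in> Z"
proof -
  have b: "compact Z" "convex Z" "Z \<noteq> {}" using Z by (auto simp: convex_body_def)
  have "uminus ` Z \<subseteq> Z"
  proof (rule subset_if_support_le)
    show "compact (uminus ` Z)" using b by (intro compact_negations)
    fix u
    show "support_function (uminus ` Z) u \<le> support_function Z u"
    proof (rule support_le)
      fix y assume "y \<in> uminus ` Z"
      then obtain z where "z \<in> Z" "y = - z" by auto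
      then show "y \<bullet> u \<le> support_function Z u"
        using inner_le_support[OF b(1), of z "- u"] sym[of u] by simp
    qed (use b in auto)
  qed (use b in \<open>auto simp: compact_imp_closed\<close>)
  then have "- x \<in> Z" using x by auto
  then have "((1 - c) / 2) *\<^sub>R (- x) + ((1 + c) / 2) *\<^sub>R x \<in> Z"
    using x b c by (intro convexD) (auto simp: add_divide_distrib[symmetric])
  moreover have "((1 - c) / 2) *\<^sub>R (- x) + ((1 + c) / 2) *\<^sub>R x = ((1 + c) / 2 - (1 - c) / 2) *\<^sub>R x"
    unfolding scaleR_left_diff_distrib by simp
  moreover have "(1 + c) / 2 - (1 - c) / 2 = c" by (simp add: field_simps)
  ultimately show ?thesis by simp
qed

text \<open>Choose points \<open>v i\<close> of \<open>Z\<close>, \<open>i \<in> A\<close>, that span the largest possible volume, let \<open>j\<close> be the index with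
  the smallest height \<open>d\<close> over the other points, and let \<open>F\<close> be the span of these. No point of \<open>Z\<close> is
  farther than \<open>d\<close> from \<open>F\<close>, as it would give a larger volume in place of \<open>v j\<close>. On the other hand a
  vector of the span with norm at most \<open>d / card A\<close> has coefficients at most \<open>1 / card A\<close>, because all
  heights are at least \<open>d\<close>, so by symmetry and convexity it belongs to \<open>Z\<close>. If \<open>Z\<close> has too small a
  dimension, its own span serves as \<open>F\<close>, with \<open>d = 0\<close>.\<close>

lemma subspace_near_symmetric_body:
  fixes Z :: "(real^'n) set" and A :: "'n set"
  assumes Z: "convex_body Z" and sym: "\<And>u. support_function Z (- u) = support_function Z u"
    and A: "A \<noteq> {}"
  obtains F d where "subspace F" "dim F < card A" "0 \<le> d" "d \<le> real (card A) * inradius (card A) Z"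
    "\<And>u. norm u \<le> 1 \<Longrightarrow> (\<And>z. z \<in> F \<Longrightarrow> u \<bullet> z = 0) \<Longrightarrow> support_function Z u \<le> d"
proof -
  have b: "compact Z" "convex Z" "Z \<noteq> {}" using Z by (auto simp: convex_body_def)
  have cA: "1 \<le> card A" using A by (simp add: Suc_le_eq card_gt_0_iff)
  show ?thesis
  proof (cases "dim (span Z) < card A")
    case True
    obtain z where z: "z \<in> Z" using b by auto
    obtain L :: "(real^'n) set" where L: "subspace L" "dim L = card A"
    proof -
      have "card A \<le> dim (UNIV :: (real^'n) set)" by (simp add: card_mono)
      then obtain T :: "(real^'n) set" where "subspace T" "dim T = card A"
        using choose_subspace_of_subspace[of "card A" "UNIV :: (real^'n) set"] by blast
      then show ?thesis by (rule that)
    qed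
    have "(\<lambda>x. z + x) ` (L \<inter> cball 0 0) \<subseteq> Z" using z by auto
    then have "0 \<le> inradius (card A) Z" by (rule inradius_ge[OF b(1) order_refl L cA])
    moreover have "support_function Z u \<le> 0" if "\<And>z. z \<in> span Z \<Longrightarrow> u \<bullet> z = 0" for u
      using that span_base by (intro support_le[OF b(3)]) (force simp: inner_commute)
    ultimately show ?thesis using True by (intro that[of "span Z" 0]) auto
  next
    case False
    obtain C where C: "C \<subseteq> Z" "independent C" "card C = dim Z"
      using basis_exists[of Z] by metis
    then have "card A \<le> card C" using False by simp
    then obtain v0 where v0: "v0 ` A \<subseteq> C" "inj_on v0 A"
      using card_le_inj[of A C] independent_imp_finite[OF C(2)] by auto
    have "independent (v0 ` A)" using C(2) v0(1) by (rule independent_mono)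
    then have pos0: "pvol A v0 > 0" using v0(2) by (intro pvol_pos_if_independent)
    obtain z0 where z0: "z0 \<in> Z" using b by auto
    define X where "X = {x :: real^'n^'n. \<forall>i. x $ i \<in> Z}"
    have "compact X"
    proof -
      have "closed X" unfolding X_def
        by (intro closed_Collect_all) (use compact_imp_closed[OF b(1)] in \<open>auto intro!: closed_vimage_Int[of _ UNIV, simplified vimage_def] continuous_intros simp: continuous_closed_vimage[unfolded vimage_def]\<close>)
      moreover obtain B where B: "\<And>x. x \<in> Z \<Longrightarrow> norm x \<le> B"
        using compact_imp_bounded[OF b(1)] by (auto simp: bounded_iff)
      have "norm x \<le> real CARD('n) * B" if "x \<in> X" for x
      proof -
        have "norm x \<le> (\<Sum>i\<in>UNIV. norm (x $ i))"
          unfolding norm_vec_def by (rule L2_set_le_sum) simp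
        also have "\<dots> \<le> (\<Sum>i\<in>(UNIV :: 'n set). B)" using that B by (intro sum_mono) (auto simp: X_def)
        finally show ?thesis by simp
      qed
      then have "bounded X" by (auto simp: bounded_iff)
      ultimately show ?thesis by (simp add: compact_eq_bounded_closed)
    qed
    moreover have w0: "(\<chi> i. if i \<in> A then v0 i else z0) \<in> X" using v0(1) C(1) z0 by (auto simp: X_def)
    ultimately obtain x where x: "x \<in> X" "\<And>y. y \<in> X \<Longrightarrow> pvol A (\<lambda>i. y $ i) \<le> pvol A (\<lambda>i. x $ i)"
      using continuous_attains_sup[of X "\<lambda>x. pvol A (\<lambda>i. x $ i)"] continuous_on_pvol by blast
    define v where "v i = x $ i" for i
    have vZ: "v i \<in> Z" for i using x(1) by (simp add: X_def v_def)
    have vmax: "pvol A (v(j := z)) \<le> pvol A v" if "z \<in> Z" for j z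
    proof -
      have "(\<chi> i. (v(j := z)) i) \<in> X" using vZ that by (auto simp: X_def)
      from x(2)[OF this] show ?thesis by (simp add: v_def[abs_def] fun_upd_def)
    qed
    have pos: "pvol A v > 0"
    proof -
      have "pvol A v0 = pvol A (\<lambda>i. (\<chi> i. if i \<in> A then v0 i else z0) $ i)" by (rule pvol_cong) simp
      then show ?thesis using x(2)[OF w0] pos0 by (simp add: v_def[abs_def])
    qed
    define dd where "dd i = infdist (v i) (span (v ` (A - {i})))" for i
    obtain j where j: "j \<in> A" "\<And>i. i \<in> A \<Longrightarrow> dd j \<le> dd i"
    proof -
      have "Min (dd ` A) \<in> dd ` A" using A by (intro Min_in) auto
      then obtain j where "j \<in> A" "dd j = Min (dd ` A)" by auto
      then show ?thesis by (intro that[of j]) auto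
    qed
    define d where "d = dd j"
    let ?F = "span (v ` (A - {j}))"
    have fac: "pvol A v = pvol (A - {i}) v * dd i" if "i \<in> A" for i
      unfolding dd_def by (rule pvol_remove[OF that])
    have dpos: "0 < d" and Gpos: "0 < pvol (A - {j}) v"
      using fac[OF j(1)] pos pvol_nonneg[of "A - {j}" v] infdist_nonneg[of "v j" ?F]
      by (auto simp: d_def dd_def zero_less_mult_iff)
    have near: "infdist z ?F \<le> d" if "z \<in> Z" for z
    proof -
      have "pvol (A - {j}) v * infdist z ?F \<le> pvol (A - {j}) v * d"
        using vmax[OF that, of j] pvol_remove_upd[OF j(1), of v z] fac[OF j(1)] by (simp add: d_def)
      then show ?thesis using Gpos by simp
    qed
    have dimF: "dim ?F < card A"
    proof -
      have "dim ?F \<le> card (v ` (A - {j}))" by (simp add: dim_le_card')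
      also have "\<dots> \<le> card (A - {j})" by (rule card_image_le) simp
      also have "\<dots> < card A" using j(1) by (intro psubset_card_mono) auto
      finally show ?thesis .
    qed
    let ?N = "real (card A)"
    have "d / ?N \<le> inradius (card A) Z"
    proof (rule inradius_ge[OF b(1)])
      show "0 \<le> d / ?N" using dpos by simp
      show "dim (span (v ` A)) = card A" using pvol_pos_independent(3)[OF pos] .
      show "(\<lambda>x. 0 + x) ` (span (v ` A) \<inter> cball 0 (d / ?N)) \<subseteq> Z"
      proof safe
        fix y assume y: "y \<in> span (v ` A)" "y \<in> cball 0 (d / ?N)"
        obtain t where t: "y = (\<Sum>i\<in>A. t i *\<^sub>R v i)"
        proof -
          obtain f where "y = (\<Sum>x\<in>v ` A. f x *\<^sub>R x)" using y(1) by (auto simp: span_finite)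
          then have "y = (\<Sum>i\<in>A. f (v i) *\<^sub>R v i)"
            using pvol_pos_independent(1)[OF pos] by (simp add: sum.reindex)
          then show ?thesis by (rule that)
        qed
        have coef: "\<bar>?N * t i\<bar> \<le> 1" if i: "i \<in> A" for i
        proof -
          let ?S = "span (v ` (A - {i}))"
          have "(\<Sum>j\<in>A - {i}. t j *\<^sub>R v j) \<in> ?S"
            by (intro span_sum span_scale span_base) auto
          from infdist_add_subspace[OF subspace_span this, of "t i *\<^sub>R v i"]
          have "infdist y ?S = infdist (t i *\<^sub>R v i) ?S"
            using i by (simp add: t sum.remove[of A i])
          then have "\<bar>t i\<bar> * dd i = infdist y ?S"
            by (simp add: infdist_scale_subspace[OF subspace_span] dd_def)
          also have "\<dots> \<le> d / ?N"
            using infdist_le_norm_subspace[OF subspace_span, of y "v ` (A - {i})"] y(2) by simp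
          finally have "\<bar>t i\<bar> * d \<le> d / ?N"
            using j(2)[OF i] mult_left_mono[of d "dd i" "\<bar>t i\<bar>"] by (simp add: d_def)
          then have "(\<bar>t i\<bar> * ?N) * d \<le> 1 * d" using cA by (simp add: field_simps)
          then have "\<bar>t i\<bar> * ?N \<le> 1" using dpos by (simp only: mult_le_cancel_right_pos)
          then show ?thesis by (simp add: abs_mult mult.commute)
        qed
        have "(\<Sum>i\<in>A. (1 / ?N) *\<^sub>R ((?N * t i) *\<^sub>R v i)) \<in> Z"
        proof (rule convex_sum)
          show "(?N * t i) *\<^sub>R v i \<in> Z" if "i \<in> A" for i
            by (rule symmetric_body_mem[OF Z sym vZ coef[OF that]])
        qed (use b cA in auto)
        moreover have "(\<Sum>i\<in>A. (1 / ?N) *\<^sub>R ((?N * t i) *\<^sub>R v i)) = y"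
          unfolding t using cA by (intro sum.cong) auto
        ultimately show "0 + y \<in> Z" by simp
      qed
    qed (use cA in auto)
    then have "d \<le> ?N * inradius (card A) Z" using cA by (simp add: field_simps)
    moreover have "support_function Z u \<le> d" if u: "norm u \<le> 1" "\<And>z. z \<in> ?F \<Longrightarrow> u \<bullet> z = 0" for u
    proof (rule support_le[OF b(3)])
      fix z assume z: "z \<in> Z"
      have "z \<bullet> u \<le> norm u * infdist z ?F"
        using abs_inner_le_infdist[OF subspace_span[of "v ` (A - {j})"] u(2), where x=z] by simp
      also have "\<dots> \<le> 1 * d" using u near[OF z] by (intro mult_mono) (auto simp: infdist_nonneg)
      finally show "z \<bullet> u \<le> d" by simp
    qed
    ultimately show ?thesis using dimF dpos by (intro that[of ?F d]) auto
  qed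
qed

lemma gen_integrable_infdist:
  assumes "gen_measure \<mu>" "subspace F"
  shows "integrable \<mu> (\<lambda>x. infdist x F)"
proof (rule gen_integrable_le[OF assms(1), where C=1])
  show "(\<lambda>x. infdist x F) \<in> borel_measurable borel"
    by (intro borel_measurable_continuous_onI continuous_intros)
  show "\<bar>infdist x F\<bar> \<le> 1 * norm x" for x
    using infdist_le_norm_subspace[OF assms(2), of x] by (simp add: infdist_nonneg)
qed

text \<open>The distance of \<open>x\<close> to \<open>F\<close> is the norm of the residual of \<open>x\<close>, whose coordinates are \<open>w i \<bullet> x\<close> for
  the residuals \<open>w i\<close> of the standard basis vectors. Integrating \<open>\<bar>w i \<bullet> x\<bar>\<close> gives the support function
  at \<open>w i\<close>.\<close>

lemma integral_infdist_le:
  fixes Z F :: "(real^'n) set"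
  assumes gen: "generates \<mu> Z" and F: "subspace F"
    and d: "\<And>u. norm u \<le> 1 \<Longrightarrow> (\<And>z. z \<in> F \<Longrightarrow> u \<bullet> z = 0) \<Longrightarrow> support_function Z u \<le> d"
  shows "(\<integral>x. infdist x F \<partial>\<mu>) \<le> real CARD('n) * d"
proof -
  have g: "gen_measure \<mu>" using gen by (simp add: generates_def)
  have "\<exists>w. norm w \<le> 1 \<and> (\<forall>z\<in>F. w \<bullet> z = 0) \<and> axis i 1 - w \<in> F" for i :: 'n
  proof -
    obtain p where "p \<in> F" "\<And>z. z \<in> F \<Longrightarrow> (axis i 1 - p) \<bullet> z = 0" "infdist (axis i 1) F = norm (axis i 1 - p)"
      using subspace_residual[OF F, of "axis i 1"] by metis
    then show ?thesis
      using infdist_le_norm_subspace[OF F, of "axis i (1::real)"]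
      by (intro exI[of _ "axis i 1 - p"]) (auto simp: norm_axis_1)
  qed
  then obtain w where w: "\<And>i :: 'n. norm (w i) \<le> 1" "\<And>i z. z \<in> F \<Longrightarrow> w i \<bullet> z = 0" "\<And>i. axis i 1 - w i \<in> F"
    by metis
  have le: "infdist x F \<le> (\<Sum>i\<in>UNIV. \<bar>w i \<bullet> x\<bar>)" for x
  proof -
    obtain p where p: "p \<in> F" "\<And>z. z \<in> F \<Longrightarrow> (x - p) \<bullet> z = 0" "infdist x F = norm (x - p)"
      using subspace_residual[OF F, of x] by metis
    have "(x - p) $ i = w i \<bullet> x" for i
    proof -
      have "(x - p) $ i = (x - p) \<bullet> axis i 1" by (simp add: inner_axis)
      also have "\<dots> = (x - p) \<bullet> (axis i 1 - w i) + (x - p) \<bullet> w i" by (simp add: inner_diff_right)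
      also have "\<dots> = w i \<bullet> x" using p(2)[OF w(3)] w(2)[OF p(1)] by (simp add: inner_diff_right inner_commute)
      finally show ?thesis .
    qed
    then show ?thesis using norm_le_l1_cart[of "x - p"] p(3) by simp
  qed
  have "(\<integral>x. infdist x F \<partial>\<mu>) \<le> (\<integral>x. (\<Sum>i\<in>UNIV. \<bar>w i \<bullet> x\<bar>) \<partial>\<mu>)"
    using le gen_integrable_infdist[OF g F] gen_integrable_inner[OF g] by (intro integral_mono) auto
  also have "\<dots> = (\<Sum>i\<in>UNIV. support_function Z (w i))"
    using gen gen_integrable_inner[OF g] by (subst Bochner_Integration.integral_sum) (auto simp: generates_def)
  also have "\<dots> \<le> (\<Sum>i\<in>(UNIV :: 'n set). d)" using d w by (intro sum_mono) auto
  finally show ?thesis by simp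
qed

section \<open>Deviation of a subspace from the span of a random frame\<close>

lemma bounded_functional_orthogonal:
  fixes f :: "real^'n \<Rightarrow> real"
  assumes lin: "linear f" and F: "subspace F"
    and vanish: "\<And>z. z \<in> F \<Longrightarrow> f z = 0" and le: "\<And>x. \<bar>f x\<bar> \<le> c * infdist x F" and c: "0 \<le> c"
  obtains g where "\<And>x. f x = x \<bullet> g" "\<And>z. z \<in> F \<Longrightarrow> g \<bullet> z = 0" "norm g \<le> c"
proof -
  define g where "g = (\<chi> k. f (axis k 1))"
  have fg: "f x = x \<bullet> g" for x
  proof -
    have "f x = f (\<Sum>k\<in>UNIV. x $ k *\<^sub>R axis k 1)"
      using basis_expansion[of x] by (simp add: scalar_mult_eq_scaleR)
    also have "\<dots> = (\<Sum>k\<in>UNIV. x $ k *\<^sub>R f (axis k 1))"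
      using lin by (simp add: linear_sum linear_scale)
    finally show ?thesis by (simp add: g_def inner_vec_def)
  qed
  have orth: "g \<bullet> z = 0" if "z \<in> F" for z using vanish[OF that] fg[of z] by (simp add: inner_commute)
  have "norm g * norm g \<le> c * norm g"
    using le[of g] fg[of g] infdist_mem_orthogonal[OF F orth] by (simp add: dot_square_norm power2_eq_square)
  then have "norm g \<le> c" using c by (cases "norm g = 0") (auto simp: mult_le_cancel_right)
  with fg orth show ?thesis by (rule that)
qed

text \<open>Up to signs, the residuals of \<open>l\<close> and \<open>x\<close> modulo \<open>F\<close> have directions whose inner products with the
  vector \<open>g / c\<close> of norm at most one are \<open>1 - \<eta>l\<close> and \<open>1 - \<eta>x\<close>. So these directions are within
  \<open>sqrt (2 * \<eta>l)\<close> and \<open>sqrt (2 * \<eta>x)\<close> of \<open>g / c\<close>, and therefore close to each other.\<close>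

lemma infdist_extended_subspace_le:
  fixes F :: "(real^'n) set"
  assumes F: "subspace F" and L: "subspace L" "F \<subseteq> L" "l \<in> L"
    and g: "\<And>z. z \<in> F \<Longrightarrow> g \<bullet> z = 0" "norm g \<le> c" and c: "0 < c"
    and l: "0 < infdist l F" "\<bar>l \<bullet> g\<bar> = (1 - \<eta>l) * (c * infdist l F)"
    and x: "\<bar>x \<bullet> g\<bar> = (1 - \<eta>x) * (c * infdist x F)"
  shows "infdist x L \<le> infdist x F * (sqrt (2 * \<eta>l) + sqrt (2 * \<eta>x))"
proof (cases "infdist x F = 0")
  case True
  have "infdist x L \<le> infdist x F" using L F subspace_0 by (intro infdist_mono) auto
  then show ?thesis using True by simp
next
  case False
  then have dx: "0 < infdist x F" using infdist_nonneg[of x F] by simp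
  have key: "\<exists>w s. w \<in> F \<and> \<bar>s\<bar> = 1 \<and> norm ((s / infdist y F) *\<^sub>R (y - w) - (1 / c) *\<^sub>R g) \<le> sqrt (2 * \<eta>)"
    if dy: "0 < infdist y F" and y: "\<bar>y \<bullet> g\<bar> = (1 - \<eta>) * (c * infdist y F)" for y \<eta>
  proof -
    obtain p where p: "p \<in> F" "\<And>z. z \<in> F \<Longrightarrow> (y - p) \<bullet> z = 0" "infdist y F = norm (y - p)"
      using subspace_residual[OF F, of y] by metis
    define s where "s = (if y \<bullet> g \<ge> 0 then 1 else -1 :: real)"
    have s: "\<bar>s\<bar> = 1" "s * (y \<bullet> g) = \<bar>y \<bullet> g\<bar>" by (auto simp: s_def)
    define u where "u = (s / infdist y F) *\<^sub>R (y - p)"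
    have nu: "norm u = 1" using s dy p(3) by (simp add: u_def)
    have ng: "norm ((1 / c) *\<^sub>R g) \<le> 1" using g(2) c by (simp add: field_simps)
    have "u \<bullet> g = s * (y \<bullet> g) / infdist y F"
      using g(1)[OF p(1)] by (simp add: u_def inner_diff_left inner_diff_right inner_commute)
    also have "\<dots> = (1 - \<eta>) * c" using s(2) y dy by (simp add: field_simps)
    finally have ug: "u \<bullet> ((1 / c) *\<^sub>R g) = 1 - \<eta>" using c by simp
    have "(norm (u - (1 / c) *\<^sub>R g))\<^sup>2 = (norm u)\<^sup>2 + (norm ((1 / c) *\<^sub>R g))\<^sup>2 - 2 * (u \<bullet> ((1 / c) *\<^sub>R g))"
      unfolding power2_norm_eq_inner
      by (simp only: inner_diff_left inner_diff_right inner_commute[of "(1 / c) *\<^sub>R g" u])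
    also have "\<dots> \<le> 1 + 1 - 2 * (1 - \<eta>)"
      using nu power_mono[OF ng norm_ge_zero, of 2] ug by simp
    finally have "(norm (u - (1 / c) *\<^sub>R g))\<^sup>2 \<le> 2 * \<eta>" by simp
    then have "norm (u - (1 / c) *\<^sub>R g) \<le> sqrt (2 * \<eta>)" by (rule real_le_rsqrt)
    then show ?thesis using p(1) s(1) unfolding u_def by blast
  qed
  obtain p s where p: "p \<in> F" "\<bar>s\<bar> = 1"
      "norm ((s / infdist x F) *\<^sub>R (x - p) - (1 / c) *\<^sub>R g) \<le> sqrt (2 * \<eta>x)"
    using key[OF dx x] by blast
  obtain q t where q: "q \<in> F" "\<bar>t\<bar> = 1"
      "norm ((t / infdist l F) *\<^sub>R (l - q) - (1 / c) *\<^sub>R g) \<le> sqrt (2 * \<eta>l)"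
    using key[OF l] by blast
  define y where "y = p + (s * t * infdist x F / infdist l F) *\<^sub>R (l - q)"
  have "y \<in> L"
    using p(1) q(1) L by (auto simp: y_def intro!: subspace_add subspace_scale subspace_diff)
  have ss: "s * s = 1" using p(2) by (metis abs_mult_self_eq mult_1)
  have eq: "x - y = (s * infdist x F) *\<^sub>R ((s / infdist x F) *\<^sub>R (x - p) - (t / infdist l F) *\<^sub>R (l - q))"
    using ss dx by (simp add: y_def scaleR_diff_right mult_ac)
  have "infdist x L \<le> norm (x - y)" using infdist_le[OF \<open>y \<in> L\<close>, of x] by (simp add: dist_norm)
  also have "\<dots> = infdist x F * norm ((s / infdist x F) *\<^sub>R (x - p) - (t / infdist l F) *\<^sub>R (l - q))"
    unfolding eq using p(2) dx by (simp add: abs_mult)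
  also have "\<dots> \<le> infdist x F * (norm ((t / infdist l F) *\<^sub>R (l - q) - (1 / c) *\<^sub>R g)
      + norm ((s / infdist x F) *\<^sub>R (x - p) - (1 / c) *\<^sub>R g))"
    using dx norm_triangle_ineq4[of "(s / infdist x F) *\<^sub>R (x - p) - (1 / c) *\<^sub>R g"
        "(t / infdist l F) *\<^sub>R (l - q) - (1 / c) *\<^sub>R g"] by (intro mult_left_mono) auto
  also have "\<dots> \<le> infdist x F * (sqrt (2 * \<eta>l) + sqrt (2 * \<eta>x))"
    using dx p(3) q(3) by (intro mult_left_mono add_mono) auto
  finally show ?thesis .
qed

text \<open>With respect to the normalized weight, the set where \<open>f j\<close> exceeds \<open>card J + 1\<close> times the bound for its
  mean has measure at most \<open>1 / (card J + 1)\<close>. These \<open>card J\<close> sets do not exhaust the whole mass.\<close>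

lemma markov_selection:
  fixes w :: "'a \<Rightarrow> real" and f :: "'i \<Rightarrow> 'a \<Rightarrow> real"
  assumes J: "finite J"
    and meas: "w \<in> borel_measurable M" "\<And>j. j \<in> J \<Longrightarrow> f j \<in> borel_measurable M"
    and nonneg: "\<And>x. 0 \<le> w x" "\<And>j. j \<in> J \<Longrightarrow> 0 \<le> K j"
    and total: "(\<integral>\<^sup>+x. ennreal (w x) \<partial>M) = ennreal c" "0 < c"
    and mean: "\<And>j. j \<in> J \<Longrightarrow> (\<integral>\<^sup>+x. ennreal (w x * f j x) \<partial>M) \<le> ennreal (K j * c)"
  obtains x where "x \<in> space M" "0 < w x" "\<And>j. j \<in> J \<Longrightarrow> f j x \<le> real (card J + 1) * K j"
proof (rule ccontr)
  note wm[measurable] = meas(1)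
  let ?N = "real (card J + 1)"
  assume "\<not> thesis"
  then have bad: "\<exists>j\<in>J. ?N * K j < f j x" if "x \<in> space M" "0 < w x" for x
    using that \<open>\<And>x. \<lbrakk>x \<in> space M; 0 < w x; \<And>j. j \<in> J \<Longrightarrow> f j x \<le> ?N * K j\<rbrakk> \<Longrightarrow> thesis\<close> by force
  define S where "S j = {x \<in> space M. ?N * K j < f j x}" for j
  have S[measurable]: "S j \<in> sets M" if "j \<in> J" for j
    unfolding S_def using meas(2)[OF that] by measurable
  have Sj: "ennreal ?N * (\<integral>\<^sup>+x. ennreal (w x) * indicator (S j) x \<partial>M) \<le> ennreal c" if j: "j \<in> J" for j
  proof (cases "K j = 0")
    case True
    then have "(\<integral>\<^sup>+x. ennreal (w x * f j x) \<partial>M) = 0" using mean[OF j] by simp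
    then have "AE x in M. ennreal (w x * f j x) = 0"
      using meas(2)[OF j] by (subst (asm) nn_integral_0_iff_AE) auto
    then have "AE x in M. ennreal (w x) * indicator (S j) x = 0"
    proof eventually_elim
      case (elim x)
      then have "w x * f j x \<le> 0" by (simp add: ennreal_eq_0_iff)
      then show ?case using nonneg(1)[of x] True
        by (cases "w x = 0") (auto simp: S_def indicator_def mult_le_0_iff)
    qed
    then have "(\<integral>\<^sup>+x. ennreal (w x) * indicator (S j) x \<partial>M) = (\<integral>\<^sup>+x. 0 \<partial>M)"
      by (rule nn_integral_cong_AE)
    then show ?thesis by simp
  next
    case False
    then have Kp: "0 < K j" using nonneg(2)[OF j] by simp
    have "ennreal ?N * (\<integral>\<^sup>+x. ennreal (w x) * indicator (S j) x \<partial>M)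
        = (\<integral>\<^sup>+x. ennreal ?N * (ennreal (w x) * indicator (S j) x) \<partial>M)"
      using S[OF j] by (intro nn_integral_cmult[symmetric]) auto
    also have "\<dots> \<le> (\<integral>\<^sup>+x. ennreal (1 / K j) * ennreal (w x * f j x) \<partial>M)"
    proof (rule nn_integral_mono)
      fix x assume x: "x \<in> space M"
      show "ennreal ?N * (ennreal (w x) * indicator (S j) x) \<le> ennreal (1 / K j) * ennreal (w x * f j x)"
      proof (cases "x \<in> S j")
        case True
        then have "?N * K j \<le> f j x" by (simp add: S_def)
        then have "?N * w x * K j \<le> w x * f j x"
          using mult_left_mono[of "?N * K j" "f j x" "w x"] nonneg(1)[of x] by (simp add: mult_ac)
        then have "?N * w x \<le> (1 / K j) * (w x * f j x)" using Kp by (simp add: field_simps)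
        moreover have "ennreal ?N * ennreal (w x) = ennreal (?N * w x)"
          using nonneg(1) by (intro ennreal_mult[symmetric]) auto
        moreover have "ennreal (1 / K j) * ennreal (w x * f j x) = ennreal ((1 / K j) * (w x * f j x))"
          using Kp by (intro ennreal_mult'[symmetric]) auto
        ultimately show ?thesis using True by (simp only: indicator_simps mult_1_right ennreal_leI)
      qed simp
    qed
    also have "\<dots> = ennreal (1 / K j) * (\<integral>\<^sup>+x. ennreal (w x * f j x) \<partial>M)"
      using meas(2)[OF j] by (intro nn_integral_cmult) auto
    also have "\<dots> \<le> ennreal (1 / K j) * ennreal (K j * c)" by (intro mult_left_mono mean[OF j]) auto
    also have "\<dots> = ennreal c" using Kp total(2) by (simp add: ennreal_mult[symmetric])
    finally show ?thesis .
  qed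
  have "ennreal (?N * c) = ennreal ?N * (\<integral>\<^sup>+x. ennreal (w x) \<partial>M)"
    unfolding total using total(2) by (intro ennreal_mult) auto
  also have "\<dots> \<le> ennreal ?N * (\<integral>\<^sup>+x. (\<Sum>j\<in>J. ennreal (w x) * indicator (S j) x) \<partial>M)"
  proof (intro mult_left_mono nn_integral_mono)
    fix x assume x: "x \<in> space M"
    show "ennreal (w x) \<le> (\<Sum>j\<in>J. ennreal (w x) * indicator (S j) x)"
    proof (cases "0 < w x")
      case True
      obtain j where j: "j \<in> J" "?N * K j < f j x" using bad[OF x True] by blast
      then have "ennreal (w x) = ennreal (w x) * indicator (S j) x" using x by (simp add: S_def)
      also have "\<dots> \<le> (\<Sum>j\<in>J. ennreal (w x) * indicator (S j) x)"
        using J j(1) by (intro member_le_sum) auto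
      finally show ?thesis .
    next
      case False
      then show ?thesis by (simp add: ennreal_neg)
    qed
  qed simp
  also have "\<dots> = (\<Sum>j\<in>J. ennreal ?N * (\<integral>\<^sup>+x. ennreal (w x) * indicator (S j) x \<partial>M))"
    using S by (subst nn_integral_sum) (auto simp: sum_distrib_left)
  also have "\<dots> \<le> (\<Sum>j\<in>J. ennreal c)" using Sj by (intro sum_mono) auto
  also have "\<dots> = ennreal (real (card J) * c)"
    using total(2) by (simp add: ennreal_of_nat_eq_real_of_nat ennreal_mult[symmetric])
  finally have "?N * c \<le> real (card J) * c" using total(2) by (simp add: ennreal_le_iff)
  then show False using total(2) by (simp add: algebra_simps)
qed

section \<open>Frames with small deviation\<close>

lemma gen_space: "gen_measure \<mu> \<Longrightarrow> space \<mu> = UNIV"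
  using sets_eq_imp_space_eq[of \<mu> borel] by (simp add: gen_measureD)

lemma gen_space_PiM: "(\<And>k. gen_measure (M k)) \<Longrightarrow> space (PiM UNIV M) = UNIV"
  by (simp add: space_PiM gen_space PiE_UNIV_domain)

lemma measurable_PiM_update:
  assumes M: "\<And>k. gen_measure (M k)"
  shows "(\<lambda>(v, x). v(a := x)) \<in> measurable (PiM UNIV M \<Otimes>\<^sub>M M a) (PiM UNIV M)"
proof (rule measurable_PiM_single')
  fix k
  show "(\<lambda>p. (case p of (v, x) \<Rightarrow> v(a := x)) k) \<in> measurable (PiM UNIV M \<Otimes>\<^sub>M M a) (M k)"
  proof (cases "k = a")
    case True then show ?thesis by (simp add: case_prod_beta)
  next
    case False
    have "(\<lambda>p. fst p k) \<in> measurable (PiM UNIV M \<Otimes>\<^sub>M M a) (M k)"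
      by (rule measurable_compose[OF measurable_fst measurable_component_singleton]) simp
    then show ?thesis using False by (simp add: case_prod_beta)
  qed
qed (simp add: gen_space M PiE_UNIV_domain)

lemma borel_measurable_PiM_section:
  assumes M: "\<And>k. gen_measure (M k)" and f: "f \<in> borel_measurable (PiM UNIV M)"
  shows "(\<lambda>x. f (v(a := x))) \<in> borel_measurable (M a)"
proof -
  have "v \<in> space (PiM UNIV M)" by (simp add: gen_space_PiM[OF M])
  from measurable_Pair2[OF measurable_compose[OF measurable_PiM_update[OF M] f] this]
  show ?thesis by simp
qed

lemma borel_measurable_PiM_integral_update:
  fixes f :: "('n::finite \<Rightarrow> real^'n) \<Rightarrow> real"
  assumes M: "\<And>k. gen_measure (M k)" and f: "f \<in> borel_measurable (PiM UNIV M)"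
  shows "(\<lambda>v. \<integral>x. f (v(a := x)) \<partial>M a) \<in> borel_measurable (PiM UNIV M)"
proof -
  interpret prob_space "M a" by (rule gen_measureD[OF M])
  show ?thesis
    using measurable_compose[OF measurable_PiM_update[OF M, of a] f]
    by (intro borel_measurable_lebesgue_integral) (simp add: case_prod_beta')
qed

lemma ennreal_le_of_square_le:
  assumes "X\<^sup>2 \<le> ennreal (y\<^sup>2)" "0 \<le> y" shows "X \<le> ennreal y"
proof (cases X)
  case (real x)
  then have "ennreal (x\<^sup>2) \<le> ennreal (y\<^sup>2)" using assms(1) by (simp add: ennreal_power)
  then have "x\<^sup>2 \<le> y\<^sup>2" by (simp add: ennreal_le_iff)
  then show ?thesis using real assms(2) power2_le_imp_le by (simp add: ennreal_leI)
next
  case top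
  then show ?thesis using assms(1) by (simp add: power2_eq_square ennreal_top_mult top_unique)
qed

text \<open>By Fischer's inequality \<open>\<bar>rdet v\<bar>\<close> is at most the product of the block volumes \<open>D i v = pvol (B i) v\<close>,
  and by independence the product of the means of these is the mean of their product. So the hypothesis
  says that the relative gap \<open>eta v = 1 - \<bar>rdet v\<bar> / (\<Prod>i\<in>I. D i v)\<close> is small in the mean with respect to the
  weight \<open>\<Prod>i\<in>I. D i v\<close>.

  Suppose that the gap is small at \<open>v\<close> and also after one vector of block \<open>i\<close> is replaced by \<open>x\<close>. Then
  the old vector and \<open>x\<close>, reduced modulo the span \<open>F\<close> of the other vectors of the block, point almost in
  the same direction up to sign, so \<open>x\<close> is close to the span of the block. It remains to find one frame
  for which this works for most \<open>x\<close> in all blocks at once.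

  For this purpose the weight is changed. In block \<open>i\<close> the vector \<open>a i\<close> to be replaced is the one whose removal leaves
  the facet with the largest mean volume. The weight \<open>om i\<close> is the volume \<open>G i\<close> of that facet times the height of the
  vector \<open>a i\<close> over it, divided by the mean height. Under this weight the vector \<open>a i\<close>
  has a probability density proportional to its height, just as \<open>x\<close> has in the average distance; the old
  and the new vector then play symmetric roles. The new weight is at most a constant times the old one, by
  the bound for \<open>D i\<close> by a sum over facets. Hence gap and distances have small means for the
  new weight, the square root of the gap being treated by the Cauchy-Schwarz inequality, and Markov's
  inequality yields a frame where all of them are small.\<close>

theorem good_frame_exists:
  fixes b :: "'n::finite \<Rightarrow> 'i" and \<mu> :: "'i \<Rightarrow> (real^'n) measure" and I :: "'i set" and \<epsilon> :: real
  defines "B \<equiv> \<lambda>i. {k. b k = i}"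
  defines "R \<equiv> PiM UNIV (\<lambda>k. \<mu> (b k))"
  defines "\<beta> \<equiv> \<Prod>i\<in>I. real (card {k. b k = i})"
  assumes finI: "finite I" and bI: "\<And>k. b k \<in> I" and Bne: "\<And>i. i \<in> I \<Longrightarrow> B i \<noteq> {}"
    and gen: "\<And>i. i \<in> I \<Longrightarrow> gen_measure (\<mu> i)" and \<epsilon>: "0 \<le> \<epsilon>"
    and pos: "0 < (\<integral>v. \<bar>rdet v\<bar> \<partial>R)"
    and hyp: "(\<Prod>i\<in>I. \<integral>v. pvol (B i) v \<partial>R) \<le> (1 + \<epsilon>) * (\<integral>v. \<bar>rdet v\<bar> \<partial>R)"
  obtains v where "\<And>i. i \<in> I \<Longrightarrow> 0 < pvol (B i) v"
    "1 - \<bar>rdet v\<bar> / (\<Prod>i\<in>I. pvol (B i) v) \<le> real (card I + 2) * (\<epsilon> * \<beta>)"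
    "\<And>i F. i \<in> I \<Longrightarrow> subspace F \<Longrightarrow> dim F < card (B i) \<Longrightarrow>
      (\<integral>x. infdist x (span (v ` B i)) \<partial>\<mu> i)
        \<le> real (card I + 2) * (2 * sqrt 2 * (real (card (B i)) * (\<integral>x. infdist x F \<partial>\<mu> i)) * sqrt (\<epsilon> * \<beta>))"
proof -
  define M where "M k = \<mu> (b k)" for k
  have gM: "gen_measure (M k)" for k using gen bI by (simp add: M_def)
  have pM: "prob_space (M k)" for k by (rule gen_measureD[OF gM])
  have R: "R = PiM UNIV M" by (simp add: R_def M_def[abs_def])
  interpret R: prob_space R unfolding R by (rule prob_space_PiM) (rule pM)
  have Mi: "M k = \<mu> i" if "k \<in> B i" for k i using that by (simp add: B_def M_def)
  have Bdis: "disjoint_family_on B I" by (auto simp: disjoint_family_on_def B_def)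
  have Bun: "(\<Union>i\<in>I. B i) = UNIV" using bI by (auto simp: B_def)
  have cB: "1 \<le> real (card (B i))" if "i \<in> I" for i
    using Bne[OF that] by (simp add: Suc_le_eq card_gt_0_iff)
  define D where "D i v = pvol (B i) v" for i and v :: "'n \<Rightarrow> real^'n"
  have D0: "0 \<le> D i v" for i v by (simp add: D_def pvol_nonneg)
  have mpv: "(\<lambda>v. pvol A v) \<in> borel_measurable R" for A unfolding R by (rule gen_measurable_pvol[where \<mu>=M, OF gM])
  have ipv: "integrable R (\<lambda>v. pvol A v)" for A unfolding R by (rule gen_integrable_pvol[OF gM])
  have npv: "(\<integral>\<^sup>+v. ennreal (pvol A v) \<partial>R) = ennreal (\<integral>v. pvol A v \<partial>R)" for A
    using ipv by (intro nn_integral_eq_integral) (auto simp: pvol_nonneg)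
  have mD: "D i \<in> borel_measurable R" for i using mpv by (simp add: D_def[abs_def])
  define Ic where "Ic i = (\<integral>v. D i v \<partial>R)" for i
  have nD: "(\<integral>\<^sup>+v. ennreal (D i v) \<partial>R) = ennreal (Ic i)" for i using npv by (simp add: D_def Ic_def)
  define pD where "pD v = (\<Prod>i\<in>I. D i v)" for v
  have pD0: "0 \<le> pD v" for v unfolding pD_def by (intro prod_nonneg) (simp add: D0)
  have mpD: "pD \<in> borel_measurable R" unfolding pD_def[abs_def] using mD by simp
  have rdet_le: "\<bar>rdet v\<bar> \<le> pD v" for v
    using pvol_UNION_le[OF finI Bdis, of v] by (simp add: Bun pvol_UNIV pD_def D_def)
  have mrdet: "(\<lambda>v. \<bar>rdet v\<bar>) \<in> borel_measurable R"
    unfolding R using gen_measurable_rdet[of M "\<lambda>_ x. x"] gM by simp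
  have irdet: "integrable R (\<lambda>v. \<bar>rdet v\<bar>)" unfolding R by (rule gen_integrable_rdet[OF gM])
  have npD: "(\<integral>\<^sup>+v. ennreal (pD v) \<partial>R) = ennreal (\<Prod>i\<in>I. Ic i)"
  proof -
    have "(\<integral>\<^sup>+v. ennreal (pD v) \<partial>R) = (\<integral>\<^sup>+v. (\<Prod>i\<in>I. ennreal (D i v)) \<partial>R)"
      unfolding pD_def by (simp add: prod_ennreal D0)
    also have "\<dots> = (\<Prod>i\<in>I. \<integral>\<^sup>+v. ennreal (D i v) \<partial>R)"
      unfolding R
    proof (rule nn_integral_PiM_indep[where M=M, OF pM finI Bdis])
      show "(\<lambda>v. ennreal (D i v)) \<in> borel_measurable (PiM UNIV M)" for i using mD R by simp
      show "ennreal (D i v) = ennreal (D i w)" if "\<And>k. k \<in> B i \<Longrightarrow> v k = w k" for i v w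
        unfolding D_def by (rule arg_cong[where f=ennreal], rule pvol_cong) (rule that)
    qed
    also have "\<dots> = ennreal (\<Prod>i\<in>I. Ic i)"
      unfolding nD by (rule prod_ennreal) (simp add: Ic_def D0)
    finally show ?thesis .
  qed
  have ipD: "integrable R pD"
    using mpD npD pD0 by (intro integrableI_nonneg) auto
  have EpD: "(\<integral>v. pD v \<partial>R) = (\<Prod>i\<in>I. Ic i)"
    using nn_integral_eq_integral[OF ipD] npD pD0
    by (simp add: ennreal_inj Ic_def D0 prod_nonneg)
  have Ic0: "0 \<le> Ic i" for i by (simp add: Ic_def D0)
  have pIc: "0 < (\<Prod>i\<in>I. Ic i)"
    using pos integral_mono[OF irdet ipD rdet_le] EpD by simp
  have Icp: "0 < Ic i" if "i \<in> I" for i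
  proof -
    have "Ic i \<noteq> 0" using pIc that prod_zero[OF finI, of Ic] by fastforce
    then show ?thesis using Ic0[of i] by simp
  qed
  \<comment> \<open>the hypothesis, read as a bound for the weighted mean of the gap\<close>
  have defect: "(\<integral>\<^sup>+v. ennreal (pD v - \<bar>rdet v\<bar>) \<partial>R) \<le> ennreal (\<epsilon> * (\<Prod>i\<in>I. Ic i))"
  proof -
    have "(\<integral>\<^sup>+v. ennreal (pD v - \<bar>rdet v\<bar>) \<partial>R) = ennreal (\<integral>v. pD v - \<bar>rdet v\<bar> \<partial>R)"
      using ipD irdet rdet_le by (intro nn_integral_eq_integral) auto
    also have "(\<integral>v. pD v - \<bar>rdet v\<bar> \<partial>R) = (\<Prod>i\<in>I. Ic i) - (\<integral>v. \<bar>rdet v\<bar> \<partial>R)"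
      using ipD irdet EpD by simp
    also have "\<dots> \<le> \<epsilon> * (\<integral>v. \<bar>rdet v\<bar> \<partial>R)"
      using hyp by (simp add: Ic_def D_def algebra_simps)
    also have "\<dots> \<le> \<epsilon> * (\<Prod>i\<in>I. Ic i)"
      using integral_mono[OF irdet ipD rdet_le] EpD \<epsilon> by (intro mult_left_mono) auto
    finally show ?thesis by (simp add: ennreal_leI)
  qed
  have "\<exists>k\<in>B i. \<forall>l\<in>B i. (\<integral>v. pvol (B i - {l}) v \<partial>R) \<le> (\<integral>v. pvol (B i - {k}) v \<partial>R)" if "i \<in> I" for i
  proof -
    let ?h = "\<lambda>l. \<integral>v. pvol (B i - {l}) v \<partial>R"
    have "Max (?h ` B i) \<in> ?h ` B i" using Bne[OF that] by (intro Max_in) auto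
    then obtain k where "k \<in> B i" "?h k = Max (?h ` B i)" by auto
    then show ?thesis by (intro bexI[of _ k]) auto
  qed
  then obtain a where a: "\<And>i. i \<in> I \<Longrightarrow> a i \<in> B i"
      and amax: "\<And>i l. i \<in> I \<Longrightarrow> l \<in> B i \<Longrightarrow> (\<integral>v. pvol (B i - {l}) v \<partial>R) \<le> (\<integral>v. pvol (B i - {a i}) v \<partial>R)"
    by metis
  have Ma: "M (a i) = \<mu> i" if "i \<in> I" for i using Mi[OF a[OF that]] .
  \<comment> \<open>\<open>C i\<close> spans the facet with volume \<open>G i\<close>; \<open>H i v / G i v\<close> is the mean height of a random vector over it\<close>
  define C where "C i = B i - {a i}" for i
  define G where "G i v = pvol (C i) v" for i and v :: "'n \<Rightarrow> real^'n"
  define gg where "gg i = (\<integral>v. G i v \<partial>R)" for i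
  define H where "H i v = (\<integral>x. D i (v(a i := x)) \<partial>\<mu> i)" for i and v :: "'n \<Rightarrow> real^'n"
  have G0: "0 \<le> G i v" for i v by (simp add: G_def pvol_nonneg)
  have gg0: "0 \<le> gg i" for i by (simp add: gg_def G0)
  have mG: "G i \<in> borel_measurable R" for i using mpv by (simp add: G_def[abs_def])
  have nG: "(\<integral>\<^sup>+v. ennreal (G i v) \<partial>R) = ennreal (gg i)" for i using npv by (simp add: G_def gg_def)
  have Dupd: "D i (v(a i := x)) = G i v * infdist x (span (v ` C i))" if "i \<in> I" for i v x
    unfolding D_def G_def C_def by (rule pvol_remove_upd[OF a[OF that]])
  have Gupd: "G i (v(a i := x)) = G i v" for i v x unfolding G_def C_def by (rule pvol_upd) simp
  have Dupd': "D j (v(a i := x)) = D j v" if "i \<in> I" "j \<noteq> i" for i j v x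
    unfolding D_def using a[OF that(1)] that(2) by (intro pvol_upd) (auto simp: B_def)
  have iInf: "integrable (\<mu> i) (\<lambda>x. infdist x F)" if "i \<in> I" "subspace F" for i F
    using gen_integrable_infdist[OF gen that(2)] that(1) .
  have iD: "integrable (\<mu> i) (\<lambda>x. D i (v(a i := x)))" if "i \<in> I" for i v
    using iInf[OF that subspace_span, of "v ` C i"] by (simp add: Dupd[OF that])
  have H_eq: "H i v = G i v * (\<integral>x. infdist x (span (v ` C i)) \<partial>\<mu> i)" if "i \<in> I" for i v
    unfolding H_def by (simp add: Dupd[OF that])
  have H0: "0 \<le> H i v" for i v by (simp add: H_def D0)
  have nH: "(\<integral>\<^sup>+x. ennreal (D i (v(a i := x))) \<partial>\<mu> i) = ennreal (H i v)" if "i \<in> I" for i v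
    unfolding H_def using iD[OF that] by (intro nn_integral_eq_integral) (auto simp: D0)
  have Hupd: "H i (v(a i := x)) = H i v" for i v x unfolding H_def by simp
  have mH: "H i \<in> borel_measurable R" if "i \<in> I" for i
    using borel_measurable_PiM_integral_update[where M=M, OF gM, of "D i" "a i"] mD[of i]
    by (simp add: R H_def[abs_def] Ma[OF that])
  \<comment> \<open>the mean of the bound by heights over facets; by the choice of \<open>a i\<close> no facet has a larger mean volume than \<open>gg i\<close>\<close>
  have F1: "Ic i \<le> real (card (B i)) * gg i * (\<integral>x. infdist x F \<partial>\<mu> i)"
    if i: "i \<in> I" and F: "subspace F" "dim F < card (B i)" for i F
  proof -
    let ?s = "\<integral>x. infdist x F \<partial>\<mu> i"
    have s0: "0 \<le> ?s" by (simp add: infdist_nonneg)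
    have ns: "(\<integral>\<^sup>+x. ennreal (infdist x F) \<partial>\<mu> i) = ennreal ?s"
      using iInf[OF i F(1)] by (intro nn_integral_eq_integral) (auto simp: infdist_nonneg)
    have mk: "(\<lambda>v. infdist (v k) F) \<in> borel_measurable (PiM UNIV M)" for k
      by (rule measurable_compose[OF gen_component[where \<mu>=M, OF gM]])
        (intro borel_measurable_continuous_onI continuous_intros)
    have "ennreal (Ic i) \<le> (\<integral>\<^sup>+v. (\<Sum>k\<in>B i. ennreal (infdist (v k) F) * ennreal (pvol (B i - {k}) v)) \<partial>R)"
      unfolding nD[symmetric]
    proof (rule nn_integral_mono)
      fix v
      have "ennreal (D i v) \<le> ennreal (\<Sum>k\<in>B i. infdist (v k) F * pvol (B i - {k}) v)"
        unfolding D_def by (rule ennreal_leI[OF pvol_le_sum_infdist[OF F]])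
      also have "\<dots> = (\<Sum>k\<in>B i. ennreal (infdist (v k) F) * ennreal (pvol (B i - {k}) v))"
        by (simp add: sum_ennreal[symmetric] ennreal_mult infdist_nonneg pvol_nonneg)
      finally show "ennreal (D i v) \<le> (\<Sum>k\<in>B i. ennreal (infdist (v k) F) * ennreal (pvol (B i - {k}) v))" .
    qed
    also have "\<dots> = (\<Sum>k\<in>B i. \<integral>\<^sup>+v. ennreal (infdist (v k) F) * ennreal (pvol (B i - {k}) v) \<partial>R)"
      using mk mpv by (intro nn_integral_sum) (auto simp: R)
    also have "\<dots> \<le> (\<Sum>k\<in>B i. ennreal (?s * gg i))"
    proof (rule sum_mono)
      fix k assume k: "k \<in> B i"
      have "(\<integral>\<^sup>+v. ennreal (infdist (v k) F) * ennreal (pvol (B i - {k}) v) \<partial>R)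
          = (\<integral>\<^sup>+v. ennreal (infdist (v k) F) \<partial>R) * (\<integral>\<^sup>+v. ennreal (pvol (B i - {k}) v) \<partial>R)"
        unfolding R
      proof (rule nn_integral_PiM_indep2[where A="{k}" and M=M, OF pM])
        show "(\<lambda>v. ennreal (infdist (v k) F)) \<in> borel_measurable (PiM UNIV M)" using mk by simp
        show "(\<lambda>v. ennreal (pvol (B i - {k}) v)) \<in> borel_measurable (PiM UNIV M)" using mpv by (simp add: R)
        show "ennreal (pvol (B i - {k}) v) = ennreal (pvol (B i - {k}) w)" if "\<And>l. l \<notin> {k} \<Longrightarrow> v l = w l" for v w
          by (rule arg_cong[where f=ennreal], rule pvol_cong) (auto intro: that)
      qed simp
      also have "(\<integral>\<^sup>+v. ennreal (infdist (v k) F) \<partial>R) = ennreal ?s"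
        using nn_integral_PiM_resample[where M=M, OF pM, of "\<lambda>v. ennreal (infdist (v k) F)" k] mk ns Mi[OF k]
        by (simp add: R[symmetric] R.emeasure_space_1)
      also have "ennreal ?s * (\<integral>\<^sup>+v. ennreal (pvol (B i - {k}) v) \<partial>R) \<le> ennreal ?s * ennreal (gg i)"
        unfolding npv using amax[OF i k] by (intro mult_left_mono ennreal_leI) (auto simp: gg_def G_def C_def)
      also have "\<dots> = ennreal (?s * gg i)" using s0 gg0 by (simp add: ennreal_mult)
      finally show "(\<integral>\<^sup>+v. ennreal (infdist (v k) F) * ennreal (pvol (B i - {k}) v) \<partial>R) \<le> ennreal (?s * gg i)" .
    qed
    also have "\<dots> = ennreal (real (card (B i)) * (?s * gg i))"
      using s0 gg0 by (simp add: ennreal_of_nat_eq_real_of_nat ennreal_mult[symmetric])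
    finally have "Ic i \<le> real (card (B i)) * (?s * gg i)"
      using s0 gg0 by (simp add: ennreal_le_iff)
    then show ?thesis by (simp add: mult_ac)
  qed
  have F2: "Ic i * G i v \<le> real (card (B i)) * gg i * H i v" if i: "i \<in> I" for i v
  proof -
    let ?F = "span (v ` C i)"
    have "dim ?F \<le> card (v ` C i)" by (simp add: dim_le_card')
    also have "\<dots> \<le> card (C i)" by (rule card_image_le) simp
    also have "\<dots> < card (B i)" unfolding C_def using a[OF i] by (intro psubset_card_mono) auto
    finally have "Ic i \<le> real (card (B i)) * gg i * (\<integral>x. infdist x ?F \<partial>\<mu> i)" by (intro F1[OF i]) auto
    then have "Ic i * G i v \<le> real (card (B i)) * gg i * (\<integral>x. infdist x ?F \<partial>\<mu> i) * G i v"
      by (intro mult_right_mono) (auto simp: G0)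
    then show ?thesis unfolding H_eq[OF i] by (simp add: mult_ac)
  qed
  have ggp: "0 < gg i" if i: "i \<in> I" for i
  proof -
    have "0 < card (B i)" using cB[OF i] by linarith
    then have "Ic i \<le> real (card (B i)) * gg i * (\<integral>x. infdist x {0} \<partial>\<mu> i)"
      using F1[OF i, of "{0}"] by (simp add: subspace_def)
    then have "gg i \<noteq> 0" using Icp[OF i] by auto
    then show ?thesis using gg0[of i] by simp
  qed
  have HG: "G i v = 0" if i: "i \<in> I" and "H i v = 0" for i v
  proof -
    have "Ic i * G i v \<le> 0" using F2[OF i, of v] that(2) by simp
    then show ?thesis using Icp[OF i] G0[of i v] by (simp add: mult_le_0_iff)
  qed
  \<comment> \<open>Where \<open>H i v = 0\<close> also \<open>G i v = 0\<close>, so the value zero of the quotient is the right one.\<close>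
  define om where "om i v = D i v * G i v / H i v" for i v
  have om0: "0 \<le> om i v" for i v by (simp add: om_def D0 G0 H0)
  have mom: "om i \<in> borel_measurable R" if "i \<in> I" for i
    unfolding om_def[abs_def] using mD mG mH[OF that] by simp
  have om_upd: "om i (v(a i := x)) = D i (v(a i := x)) * (G i v / H i v)" for i v x
    by (simp add: om_def Gupd Hupd)
  have om_upd': "om j (v(a i := x)) = om j v" if "i \<in> I" "j \<in> I" "j \<noteq> i" for i j v x
  proof -
    have ab: "a i \<notin> B j" "a j \<noteq> a i" using a[OF that(1)] a[OF that(2)] that(3) by (auto simp: B_def)
    have "G j (v(a i := x)) = G j v" unfolding G_def C_def using ab by (intro pvol_upd) auto
    moreover have "H j (v(a i := x)) = H j v"
    proof -
      have "v(a i := x, a j := y) = v(a j := y, a i := x)" for y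
        by (rule fun_upd_twist) (use ab in auto)
      then show ?thesis unfolding H_def by (simp only: Dupd'[OF that(1,3)])
    qed
    ultimately show ?thesis unfolding om_def using Dupd'[OF that(1,3)] by simp
  qed
  have om_dep: "om i v = om i w" if "\<And>k. k \<in> B i \<Longrightarrow> v k = w k" for i v w
  proof -
    have 1: "D i v = D i w" unfolding D_def by (rule pvol_cong) (rule that)
    have 2: "G i v = G i w" unfolding G_def C_def by (rule pvol_cong) (auto intro: that)
    have 3: "D i (v(a i := x)) = D i (w(a i := x))" for x
      unfolding D_def by (rule pvol_cong) (auto intro: that)
    show ?thesis unfolding om_def H_def by (simp only: 1 2 3)
  qed
  let ?q = "\<lambda>i. real (card (B i)) * gg i / Ic i"
  have om_le: "om i v \<le> ?q i * D i v" if i: "i \<in> I" for i v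
  proof (cases "H i v = 0")
    case True then show ?thesis using gg0 Ic0 D0 by (simp add: om_def)
  next
    case False
    then have Hp: "0 < H i v" using H0[of i v] by simp
    have "G i v / H i v \<le> ?q i"
      using F2[OF i, of v] Hp Icp[OF i] by (simp add: divide_le_eq le_divide_eq mult_ac)
    then have "D i v * (G i v / H i v) \<le> D i v * ?q i" by (intro mult_left_mono) (auto simp: D0)
    then show ?thesis by (simp add: om_def mult_ac)
  qed
  have HGH: "H i v * (G i v / H i v) = G i v" if "i \<in> I" for i v
    using HG[OF that, of v] by (cases "H i v = 0") auto
  have nom: "(\<integral>\<^sup>+v. ennreal (om i v) \<partial>R) = ennreal (gg i)" if i: "i \<in> I" for i
  proof -
    have "(\<integral>\<^sup>+v. ennreal (om i v) \<partial>R) = (\<integral>\<^sup>+v. (\<integral>\<^sup>+x. ennreal (om i (v(a i := x))) \<partial>\<mu> i) \<partial>R)"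
      unfolding R using nn_integral_PiM_resample[where M=M, OF pM, of "\<lambda>v. ennreal (om i v)" "a i"] mom[OF i] Ma[OF i]
      by (simp add: R)
    also have "\<dots> = (\<integral>\<^sup>+v. ennreal (G i v) \<partial>R)"
    proof (rule nn_integral_cong)
      fix v
      have "(\<integral>\<^sup>+x. ennreal (om i (v(a i := x))) \<partial>\<mu> i)
          = (\<integral>\<^sup>+x. ennreal (D i (v(a i := x))) * ennreal (G i v / H i v) \<partial>\<mu> i)"
        unfolding om_upd by (intro nn_integral_cong ennreal_mult) (simp_all add: D0 G0 H0)
      also have "\<dots> = ennreal (H i v) * ennreal (G i v / H i v)"
        using iD[OF i, of v] nH[OF i, of v] by (simp add: nn_integral_multc)
      also have "\<dots> = ennreal (G i v)" using HGH[OF i, of v] H0 G0 by (simp add: ennreal_mult[symmetric])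
      finally show "(\<integral>\<^sup>+x. ennreal (om i (v(a i := x))) \<partial>\<mu> i) = ennreal (G i v)" .
    qed
    finally show ?thesis by (simp add: nG)
  qed
  \<comment> \<open>\<open>P i\<close> is the part of the new weight without block \<open>i\<close>, and \<open>W i\<close> puts the volume \<open>D i\<close> in the place of \<open>om i\<close>.\<close>
  define P where "P i v = (\<Prod>j\<in>I - {i}. om j v)" for i v
  define w where "w v = (\<Prod>i\<in>I. om i v)" for v
  define W where "W i v = D i v * P i v" for i v
  define \<gamma> where "\<gamma> = (\<Prod>i\<in>I. gg i)"
  have \<gamma>: "0 < \<gamma>" unfolding \<gamma>_def using ggp by (intro prod_pos) auto
  have P0: "0 \<le> P i v" for i v unfolding P_def by (intro prod_nonneg) (simp add: om0)
  have w0: "0 \<le> w v" for v unfolding w_def by (intro prod_nonneg) (simp add: om0)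
  have W0: "0 \<le> W i v" for i v by (simp add: W_def D0 P0)
  have mP: "P i \<in> borel_measurable R" for i unfolding P_def[abs_def] using mom by simp
  have mw: "w \<in> borel_measurable R" unfolding w_def[abs_def] using mom by simp
  have mW: "W i \<in> borel_measurable R" for i unfolding W_def[abs_def] using mD mP by simp
  have w_split: "w v = om i v * P i v" if "i \<in> I" for i v
    unfolding w_def P_def using finI that by (rule prod.remove)
  have nw: "(\<integral>\<^sup>+v. ennreal (w v) \<partial>R) = ennreal \<gamma>"
  proof -
    have "(\<integral>\<^sup>+v. ennreal (w v) \<partial>R) = (\<integral>\<^sup>+v. (\<Prod>i\<in>I. ennreal (om i v)) \<partial>R)"
      unfolding w_def by (simp add: prod_ennreal om0)
    also have "\<dots> = (\<Prod>i\<in>I. \<integral>\<^sup>+v. ennreal (om i v) \<partial>R)"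
      unfolding R
    proof (rule nn_integral_PiM_indep[where M=M, OF pM finI Bdis])
      show "(\<lambda>v. ennreal (om i v)) \<in> borel_measurable (PiM UNIV M)" if "i \<in> I" for i using mom[OF that] R by simp
      show "ennreal (om i v) = ennreal (om i w)" if "\<And>k. k \<in> B i \<Longrightarrow> v k = w k" for i v w
        by (rule arg_cong[where f=ennreal], rule om_dep) (rule that)
    qed
    also have "\<dots> = ennreal \<gamma>" unfolding \<gamma>_def using nom gg0 by (simp add: prod_ennreal)
    finally show ?thesis .
  qed
  define A where "A i = Ic i / gg i" for i
  have A0: "0 \<le> A i" for i by (simp add: A_def Ic0 gg0)
  have A\<gamma>: "A i * \<gamma> = Ic i * (\<Prod>j\<in>I - {i}. gg j)" if i: "i \<in> I" for i
    unfolding \<gamma>_def A_def using prod.remove[OF finI i, of gg] ggp[OF i] by simp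
  have nW: "(\<integral>\<^sup>+v. ennreal (W i v) \<partial>R) = ennreal (A i * \<gamma>)" if i: "i \<in> I" for i
  proof -
    define f where "f j v = (if j = i then D i v else om j v)" for j v
    have f0: "0 \<le> f j v" for j v by (simp add: f_def D0 om0)
    have "W i v = (\<Prod>j\<in>I. f j v)" for v
    proof -
      have "(\<Prod>j\<in>I. f j v) = f i v * (\<Prod>j\<in>I - {i}. f j v)" using finI i by (rule prod.remove)
      also have "(\<Prod>j\<in>I - {i}. f j v) = P i v" unfolding P_def by (intro prod.cong) (auto simp: f_def)
      finally show ?thesis by (simp add: W_def f_def)
    qed
    then have "(\<integral>\<^sup>+v. ennreal (W i v) \<partial>R) = (\<integral>\<^sup>+v. (\<Prod>j\<in>I. ennreal (f j v)) \<partial>R)"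
      by (simp add: prod_ennreal f0)
    also have "\<dots> = (\<Prod>j\<in>I. \<integral>\<^sup>+v. ennreal (f j v) \<partial>R)"
      unfolding R
    proof (rule nn_integral_PiM_indep[where M=M, OF pM finI Bdis])
      show "(\<lambda>v. ennreal (f j v)) \<in> borel_measurable (PiM UNIV M)" if "j \<in> I" for j
        using mom[OF that] mD R by (cases "j = i") (auto simp: f_def)
      show "ennreal (f j v) = ennreal (f j w)" if "\<And>k. k \<in> B j \<Longrightarrow> v k = w k" for j v w
      proof (rule arg_cong[where f=ennreal])
        have 1: "om j v = om j w" by (rule om_dep) (rule that)
        have 2: "D j v = D j w" unfolding D_def by (rule pvol_cong) (rule that)
        show "f j v = f j w" using 1 2 by (cases "j = i") (simp_all only: f_def if_True if_False)
      qed
    qed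
    also have "\<dots> = (\<Prod>j\<in>I. ennreal (if j = i then Ic i else gg j))"
      using nom nD by (intro prod.cong refl) (auto simp: f_def)
    also have "\<dots> = ennreal (\<Prod>j\<in>I. if j = i then Ic i else gg j)"
      using gg0 Ic0 by (intro prod_ennreal) auto
    also have "(\<Prod>j\<in>I. if j = i then Ic i else gg j) = Ic i * (\<Prod>j\<in>I - {i}. gg j)"
      using prod.remove[OF finI i, of "\<lambda>j. if j = i then Ic i else gg j"] by simp
    finally show ?thesis by (simp add: A\<gamma>[OF i])
  qed
  define eta where "eta v = 1 - \<bar>rdet v\<bar> / pD v" for v
  have eta01: "0 \<le> eta v" "eta v \<le> 1" for v
    using rdet_le[of v] pD0[of v] by (auto simp: eta_def divide_le_eq_1)
  have meta: "eta \<in> borel_measurable R" unfolding eta_def[abs_def] using mrdet mpD by simp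
  have pDeta: "pD v * eta v = pD v - \<bar>rdet v\<bar>" for v
    using rdet_le[of v] by (cases "pD v = 0") (auto simp: eta_def field_simps)
  have rdet_eta: "\<bar>rdet v\<bar> = (1 - eta v) * pD v" for v
    using pDeta[of v] by (simp add: algebra_simps)
  have mean_le: "(\<integral>\<^sup>+v. ennreal (h v * eta v) \<partial>R) \<le> ennreal (c * (\<epsilon> * (\<Prod>i\<in>I. Ic i)))"
    if h: "\<And>v. h v \<le> c * pD v" "0 \<le> c" for h c
  proof -
    have "(\<integral>\<^sup>+v. ennreal (h v * eta v) \<partial>R) \<le> (\<integral>\<^sup>+v. ennreal c * ennreal (pD v - \<bar>rdet v\<bar>) \<partial>R)"
    proof (rule nn_integral_mono)
      fix v
      have "h v * eta v \<le> (c * pD v) * eta v" using h(1) eta01 by (intro mult_right_mono) auto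
      also have "\<dots> = c * (pD v - \<bar>rdet v\<bar>)" by (simp add: pDeta[symmetric] mult.assoc)
      finally show "ennreal (h v * eta v) \<le> ennreal c * ennreal (pD v - \<bar>rdet v\<bar>)"
        using h(2) rdet_le[of v] by (simp add: ennreal_mult[symmetric] ennreal_leI)
    qed
    also have "\<dots> = ennreal c * (\<integral>\<^sup>+v. ennreal (pD v - \<bar>rdet v\<bar>) \<partial>R)"
      using mpD mrdet by (intro nn_integral_cmult) auto
    also have "\<dots> \<le> ennreal c * ennreal (\<epsilon> * (\<Prod>i\<in>I. Ic i))" by (intro mult_left_mono defect) simp
    also have "\<dots> = ennreal (c * (\<epsilon> * (\<Prod>i\<in>I. Ic i)))"
      using h(2) \<epsilon> pIc by (intro ennreal_mult[symmetric]) auto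
    finally show ?thesis .
  qed
  have q0: "0 \<le> ?q i" for i by (simp add: gg0 Ic0)
  have \<beta>1: "1 \<le> (\<Prod>i\<in>J. real (card (B i)))" if "J \<subseteq> I" for J
    using cB that by (intro prod_ge_1) auto
  have \<beta>_eq: "\<beta> = (\<Prod>i\<in>I. real (card (B i)))" by (simp add: \<beta>_def B_def)
  have mean_w: "(\<integral>\<^sup>+v. ennreal (w v * eta v) \<partial>R) \<le> ennreal (\<epsilon> * \<beta> * \<gamma>)"
  proof -
    have "w v \<le> (\<Prod>i\<in>I. ?q i) * pD v" for v
      unfolding w_def pD_def prod.distrib[symmetric] using om0 om_le by (intro prod_mono) auto
    from mean_le[OF this] have "(\<integral>\<^sup>+v. ennreal (w v * eta v) \<partial>R) \<le> ennreal ((\<Prod>i\<in>I. ?q i) * (\<epsilon> * (\<Prod>i\<in>I. Ic i)))"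
      using q0 by (simp add: prod_nonneg)
    also have "(\<Prod>i\<in>I. ?q i) * (\<epsilon> * (\<Prod>i\<in>I. Ic i)) = \<epsilon> * \<beta> * \<gamma>"
      using pIc unfolding \<beta>_eq \<gamma>_def prod_dividef prod.distrib by (simp add: field_simps)
    finally show ?thesis .
  qed
  have mean_W: "(\<integral>\<^sup>+v. ennreal (W i v * eta v) \<partial>R) \<le> ennreal (\<epsilon> * \<beta> * (A i * \<gamma>))" if i: "i \<in> I" for i
  proof -
    have "W i v \<le> (\<Prod>j\<in>I - {i}. ?q j) * pD v" for v
    proof -
      have "P i v \<le> (\<Prod>j\<in>I - {i}. ?q j * D j v)"
        unfolding P_def using om0 om_le by (intro prod_mono) auto
      then have "W i v \<le> D i v * (\<Prod>j\<in>I - {i}. ?q j * D j v)"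
        unfolding W_def by (intro mult_left_mono) (auto simp: D0)
      also have "\<dots> = (\<Prod>j\<in>I - {i}. ?q j) * pD v"
        unfolding pD_def prod.distrib prod.remove[OF finI i, of "\<lambda>i. D i v"] by (simp add: mult_ac)
      finally show ?thesis .
    qed
    from mean_le[OF this] have "(\<integral>\<^sup>+v. ennreal (W i v * eta v) \<partial>R)
        \<le> ennreal ((\<Prod>j\<in>I - {i}. ?q j) * (\<epsilon> * (\<Prod>i\<in>I. Ic i)))"
      using q0 by (simp add: prod_nonneg)
    also have "(\<Prod>j\<in>I - {i}. ?q j) * (\<epsilon> * (\<Prod>i\<in>I. Ic i))
        = \<epsilon> * (\<Prod>j\<in>I - {i}. real (card (B j))) * (Ic i * (\<Prod>j\<in>I - {i}. gg j))"
    proof -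
      have "(\<Prod>j\<in>I - {i}. Ic j) \<noteq> 0" using pIc prod.remove[OF finI i, of Ic] by auto
      then show ?thesis
        unfolding prod_dividef prod.distrib prod.remove[OF finI i, of Ic] by (simp add: field_simps)
    qed
    also have "\<dots> \<le> \<epsilon> * \<beta> * (Ic i * (\<Prod>j\<in>I - {i}. gg j))"
    proof (intro mult_right_mono mult_left_mono)
      have "1 * (\<Prod>j\<in>I - {i}. real (card (B j))) \<le> real (card (B i)) * (\<Prod>j\<in>I - {i}. real (card (B j)))"
        using cB[OF i] by (intro mult_right_mono prod_nonneg) auto
      also have "\<dots> = \<beta>" unfolding \<beta>_eq using prod.remove[OF finI i, of "\<lambda>i. real (card (B i))"] by simp
      finally show "(\<Prod>j\<in>I - {i}. real (card (B j))) \<le> \<beta>" by simp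
    qed (use \<epsilon> Ic0 gg0 in \<open>auto intro!: mult_nonneg_nonneg prod_nonneg\<close>)
    finally show ?thesis by (simp add: A\<gamma>[OF i] ennreal_leI)
  qed
  have \<beta>0: "0 \<le> \<beta>" unfolding \<beta>_eq by (intro prod_nonneg) simp
  \<comment> \<open>Cauchy-Schwarz, with \<open>W i\<close> split evenly between the factors\<close>
  have cs: "(\<integral>\<^sup>+v. ennreal (W i v * sqrt (eta v)) \<partial>R) \<le> ennreal (A i * \<gamma> * sqrt (\<epsilon> * \<beta>))" if i: "i \<in> I" for i
  proof (rule ennreal_le_of_square_le)
    let ?f = "\<lambda>v. ennreal (sqrt (W i v))" and ?g = "\<lambda>v. ennreal (sqrt (W i v * eta v))"
    have "(\<integral>\<^sup>+v. ennreal (W i v * sqrt (eta v)) \<partial>R) = (\<integral>\<^sup>+v. ?f v * ?g v \<partial>R)"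
      using W0 eta01 by (intro nn_integral_cong) (simp add: ennreal_mult[symmetric] real_sqrt_mult mult.assoc[symmetric])
    then have "(\<integral>\<^sup>+v. ennreal (W i v * sqrt (eta v)) \<partial>R)\<^sup>2 \<le> (\<integral>\<^sup>+v. (?f v)\<^sup>2 \<partial>R) * (\<integral>\<^sup>+v. (?g v)\<^sup>2 \<partial>R)"
      using Cauchy_Schwarz_nn_integral[of ?f R ?g] mW meta by simp
    also have "(\<integral>\<^sup>+v. (?f v)\<^sup>2 \<partial>R) = ennreal (A i * \<gamma>)"
      using nW[OF i] W0 by (simp add: ennreal_power)
    also have "(\<integral>\<^sup>+v. (?g v)\<^sup>2 \<partial>R) = (\<integral>\<^sup>+v. ennreal (W i v * eta v) \<partial>R)"
      using W0 eta01 by (simp add: ennreal_power)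
    also have "ennreal (A i * \<gamma>) * \<dots> \<le> ennreal (A i * \<gamma>) * ennreal (\<epsilon> * \<beta> * (A i * \<gamma>))"
      by (intro mult_left_mono mean_W[OF i]) simp
    also have "\<dots> = ennreal ((A i * \<gamma> * sqrt (\<epsilon> * \<beta>))\<^sup>2)"
      using A0[of i] \<gamma> \<epsilon> \<beta>0 by (simp add: ennreal_mult[symmetric] power_mult_distrib power2_eq_square mult_ac)
    finally show "(\<integral>\<^sup>+v. ennreal (W i v * sqrt (eta v)) \<partial>R)\<^sup>2 \<le> ennreal ((A i * \<gamma> * sqrt (\<epsilon> * \<beta>))\<^sup>2)" .
    show "0 \<le> A i * \<gamma> * sqrt (\<epsilon> * \<beta>)" using A0[of i] \<gamma> \<epsilon> \<beta>0 by simp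
  qed
  \<comment> \<open>\<open>Y i v / G i v\<close> is the mean of the height times the root of the gap, over the new vector\<close>
  define Y where "Y i v = (\<integral>x. D i (v(a i := x)) * sqrt (eta (v(a i := x))) \<partial>\<mu> i)" for i v
  have Y0: "0 \<le> Y i v" for i v by (simp add: Y_def D0 eta01)
  have mDs: "(\<lambda>v. D i v * sqrt (eta v)) \<in> borel_measurable R" for i using mD meta by simp
  have mY: "Y i \<in> borel_measurable R" if "i \<in> I" for i
    using borel_measurable_PiM_integral_update[where M=M, OF gM, of "\<lambda>v. D i v * sqrt (eta v)" "a i"] mDs
    by (simp add: R Y_def[abs_def] Ma[OF that])
  have iY: "integrable (\<mu> i) (\<lambda>x. D i (v(a i := x)) * sqrt (eta (v(a i := x))))" if i: "i \<in> I" for i v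
  proof (rule Bochner_Integration.integrable_bound[OF iD[OF i, of v]])
    show "(\<lambda>x. D i (v(a i := x)) * sqrt (eta (v(a i := x)))) \<in> borel_measurable (\<mu> i)"
      using borel_measurable_PiM_section[where M=M, OF gM, of "\<lambda>v. D i v * sqrt (eta v)" v "a i"] mDs
      by (simp add: R Ma[OF i])
    have "D i u * sqrt (eta u) \<le> D i u" for u
      using D0[of i u] eta01[of u] by (simp add: mult_left_le)
    then show "AE x in \<mu> i. norm (D i (v(a i := x)) * sqrt (eta (v(a i := x)))) \<le> norm (D i (v(a i := x)))"
      using D0 eta01 by (intro always_eventually) (auto simp: abs_mult)
  qed
  have nY: "(\<integral>\<^sup>+x. ennreal (D i (v(a i := x)) * sqrt (eta (v(a i := x)))) \<partial>\<mu> i) = ennreal (Y i v)"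
    if "i \<in> I" for i v
    unfolding Y_def using iY[OF that] by (intro nn_integral_eq_integral) (auto simp: D0 eta01)
  have Pupd: "P i (v(a i := x)) = P i v" if "i \<in> I" for i v x
    unfolding P_def using om_upd' that by (intro prod.cong) auto
  have Yupd: "Y i (v(a i := x)) = Y i v" for i v x by (simp add: Y_def)
  have resample_Y: "(\<integral>\<^sup>+v. ennreal (w v * (Y i v / G i v)) \<partial>R) \<le> (\<integral>\<^sup>+v. ennreal (W i v * sqrt (eta v)) \<partial>R)"
    if i: "i \<in> I" for i
  proof -
    have "(\<integral>\<^sup>+v. ennreal (w v * (Y i v / G i v)) \<partial>R)
        = (\<integral>\<^sup>+v. (\<integral>\<^sup>+x. ennreal (w (v(a i := x)) * (Y i (v(a i := x)) / G i (v(a i := x)))) \<partial>\<mu> i) \<partial>R)"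
      using nn_integral_PiM_resample[where M=M, OF pM, of "\<lambda>v. ennreal (w v * (Y i v / G i v))" "a i"]
        mw mY[OF i] mG[of i] by (simp add: R Ma[OF i])
    also have "\<dots> \<le> (\<integral>\<^sup>+v. ennreal (Y i v) * ennreal (P i v) \<partial>R)"
    proof (rule nn_integral_mono)
      fix v
      let ?c = "G i v / H i v * P i v * (Y i v / G i v)"
      have c0: "0 \<le> ?c" by (simp add: G0 H0 P0 Y0)
      have "w (v(a i := x)) * (Y i (v(a i := x)) / G i (v(a i := x))) = D i (v(a i := x)) * ?c" for x
        by (simp add: w_split[OF i] om_upd Pupd[OF i] Yupd Gupd mult_ac)
      then have "(\<integral>\<^sup>+x. ennreal (w (v(a i := x)) * (Y i (v(a i := x)) / G i (v(a i := x)))) \<partial>\<mu> i)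
          = (\<integral>\<^sup>+x. ennreal (D i (v(a i := x))) * ennreal ?c \<partial>\<mu> i)"
        using c0 D0 by (simp add: ennreal_mult)
      also have "\<dots> = ennreal (H i v) * ennreal ?c"
        using iD[OF i, of v] nH[OF i, of v] by (simp add: nn_integral_multc)
      also have "\<dots> = ennreal (H i v * ?c)" using H0 c0 by (simp add: ennreal_mult)
      also have "H i v * ?c \<le> Y i v * P i v"
        using H0[of i v] G0[of i v] P0[of i v] Y0[of i v]
        by (cases "H i v = 0 \<or> G i v = 0") (auto simp: field_simps)
      then have "ennreal (H i v * ?c) \<le> ennreal (Y i v) * ennreal (P i v)"
        using Y0 P0 by (simp add: ennreal_mult[symmetric] ennreal_leI)
      finally show "(\<integral>\<^sup>+x. ennreal (w (v(a i := x)) * (Y i (v(a i := x)) / G i (v(a i := x)))) \<partial>\<mu> i)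
          \<le> ennreal (Y i v) * ennreal (P i v)" .
    qed
    also have "\<dots> = (\<integral>\<^sup>+v. (\<integral>\<^sup>+x. ennreal (W i (v(a i := x)) * sqrt (eta (v(a i := x)))) \<partial>\<mu> i) \<partial>R)"
    proof (rule nn_integral_cong)
      fix v
      have "ennreal (W i (v(a i := x)) * sqrt (eta (v(a i := x))))
          = ennreal (D i (v(a i := x)) * sqrt (eta (v(a i := x)))) * ennreal (P i v)" for x
        using D0 P0 eta01 by (simp add: W_def Pupd[OF i] ennreal_mult[symmetric] mult_ac)
      then show "ennreal (Y i v) * ennreal (P i v)
          = (\<integral>\<^sup>+x. ennreal (W i (v(a i := x)) * sqrt (eta (v(a i := x)))) \<partial>\<mu> i)"
        using iY[OF i, of v] nY[OF i, of v] by (simp add: nn_integral_multc)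
    qed
    also have "\<dots> = (\<integral>\<^sup>+v. ennreal (W i v * sqrt (eta v)) \<partial>R)"
      using nn_integral_PiM_resample[where M=M, OF pM, of "\<lambda>v. ennreal (W i v * sqrt (eta v))" "a i"]
        mW[of i] meta by (simp add: R Ma[OF i])
    finally show ?thesis .
  qed
  \<comment> \<open>an upper bound for the mean distance to the span of block \<open>i\<close>, as \<open>dist_le\<close> shows below\<close>
  define U where "U i v = H i v / G i v * sqrt (2 * eta v) + sqrt 2 * (Y i v / G i v)" for i v
  have mU: "U i \<in> borel_measurable R" if "i \<in> I" for i
    unfolding U_def[abs_def] using mH[OF that] mG mY[OF that] meta by simp
  have mean_U: "(\<integral>\<^sup>+v. ennreal (w v * U i v) \<partial>R) \<le> ennreal (2 * sqrt 2 * A i * sqrt (\<epsilon> * \<beta>) * \<gamma>)"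
    if i: "i \<in> I" for i
  proof -
    let ?X = "\<integral>\<^sup>+v. ennreal (W i v * sqrt (eta v)) \<partial>R"
    have pt: "ennreal (w v * U i v) \<le> ennreal (sqrt 2) * (ennreal (W i v * sqrt (eta v)) + ennreal (w v * (Y i v / G i v)))" for v
    proof -
      have "om i v * (H i v / G i v) \<le> D i v"
        using D0[of i v] by (cases "H i v = 0 \<or> G i v = 0") (auto simp: om_def)
      then have "om i v * (H i v / G i v) * P i v \<le> W i v"
        unfolding W_def by (intro mult_right_mono) (auto simp: P0)
      then have "w v * (H i v / G i v) \<le> W i v" by (simp add: w_split[OF i] mult_ac)
      then have "w v * (H i v / G i v) * sqrt (2 * eta v) \<le> W i v * sqrt (2 * eta v)"
        by (intro mult_right_mono) (auto simp: eta01)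
      then have "w v * U i v \<le> sqrt 2 * (W i v * sqrt (eta v) + w v * (Y i v / G i v))"
        unfolding U_def by (simp add: algebra_simps real_sqrt_mult)
      then have "ennreal (w v * U i v) \<le> ennreal (sqrt 2 * (W i v * sqrt (eta v) + w v * (Y i v / G i v)))"
        by (rule ennreal_leI)
      also have "\<dots> = ennreal (sqrt 2) * (ennreal (W i v * sqrt (eta v)) + ennreal (w v * (Y i v / G i v)))"
        using W0 eta01 w0 Y0 G0 by (simp add: ennreal_mult ennreal_plus)
      finally show ?thesis .
    qed
    have "(\<integral>\<^sup>+v. ennreal (w v * U i v) \<partial>R)
        \<le> (\<integral>\<^sup>+v. ennreal (sqrt 2) * (ennreal (W i v * sqrt (eta v)) + ennreal (w v * (Y i v / G i v))) \<partial>R)"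
      by (rule nn_integral_mono) (rule pt)
    also have "\<dots> = ennreal (sqrt 2) * (?X + (\<integral>\<^sup>+v. ennreal (w v * (Y i v / G i v)) \<partial>R))"
      using mW meta mw mY[OF i] mG by (simp add: nn_integral_cmult nn_integral_add)
    also have "\<dots> \<le> ennreal (sqrt 2) * (ennreal (A i * \<gamma> * sqrt (\<epsilon> * \<beta>)) + ennreal (A i * \<gamma> * sqrt (\<epsilon> * \<beta>)))"
      using cs[OF i] order_trans[OF resample_Y[OF i] cs[OF i]] by (intro mult_left_mono add_mono) auto
    also have "\<dots> = ennreal (2 * sqrt 2 * A i * sqrt (\<epsilon> * \<beta>) * \<gamma>)"
      using A0[of i] \<gamma> \<epsilon> \<beta>0 by (simp add: ennreal_mult[symmetric] ennreal_plus[symmetric] mult_ac del: ennreal_plus)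
    finally show ?thesis .
  qed
  \<comment> \<open>Markov's inequality is applied to the gap, under the index \<open>None\<close>, and to the distances in the blocks.\<close>
  define Kf where "Kf j = (case j of None \<Rightarrow> \<epsilon> * \<beta> | Some i \<Rightarrow> 2 * sqrt 2 * A i * sqrt (\<epsilon> * \<beta>))" for j
  define ff where "ff j = (case j of None \<Rightarrow> eta | Some i \<Rightarrow> U i)" for j
  define J where "J = insert None (Some ` I)"
  have cJ: "card J = card I + 1"
    unfolding J_def using finI by (subst card_insert_disjoint) (auto simp: card_image)
  obtain v where v: "v \<in> space R" "0 < w v" "\<And>j. j \<in> J \<Longrightarrow> ff j v \<le> real (card J + 1) * Kf j"
  proof (rule markov_selection[of J w R ff Kf \<gamma>])
    show "ff j \<in> borel_measurable R" if "j \<in> J" for j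
      using that mU meta by (auto simp: J_def ff_def)
    show "0 \<le> Kf j" if "j \<in> J" for j
      using that \<epsilon> \<beta>0 A0 by (auto simp: J_def Kf_def)
    show "(\<integral>\<^sup>+x. ennreal (w x * ff j x) \<partial>R) \<le> ennreal (Kf j * \<gamma>)" if "j \<in> J" for j
      using that mean_w mean_U by (auto simp: J_def Kf_def ff_def)
  qed (use finI mw w0 nw \<gamma> in \<open>auto simp: J_def\<close>)
  have om_pos: "0 < om i v" if "i \<in> I" for i
  proof -
    have "om i v \<noteq> 0" using v(2) that prod_zero[OF finI, of "\<lambda>i. om i v"] unfolding w_def by fastforce
    then show ?thesis using om0[of i v] by simp
  qed
  have Dp: "0 < D i v" "0 < G i v" "0 < H i v" if "i \<in> I" for i
    using om_pos[OF that] D0[of i v] G0[of i v] H0[of i v]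
    by (auto simp: om_def less_le)
  have dist_le: "(\<integral>x. infdist x (span (v ` B i)) \<partial>\<mu> i) \<le> U i v" if i: "i \<in> I" for i
  proof -
    let ?F = "span (v ` C i)" and ?L = "span (v ` B i)"
    define c where "c = (\<Prod>j\<in>I - {i}. D j v) * G i v"
    have c: "0 < c" unfolding c_def using Dp i by (intro mult_pos_pos prod_pos) auto
    have pDupd: "pD (v(a i := x)) = c * infdist x ?F" for x
    proof -
      have "pD (v(a i := x)) = D i (v(a i := x)) * (\<Prod>j\<in>I - {i}. D j (v(a i := x)))"
        unfolding pD_def using finI i by (rule prod.remove)
      also have "(\<Prod>j\<in>I - {i}. D j (v(a i := x))) = (\<Prod>j\<in>I - {i}. D j v)"
        using Dupd'[OF i] by (intro prod.cong) auto
      finally show ?thesis unfolding Dupd[OF i] c_def by (simp only: mult_ac)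
    qed
    have vanish: "rdet (v(a i := z)) = 0" if "z \<in> ?F" for z
    proof -
      have "?F \<subseteq> span (v ` (UNIV - {a i}))" by (intro span_mono) (auto simp: C_def)
      then have "z \<in> span (v(a i := 0) ` (UNIV - {a i}))"
        using that by (auto simp: image_def)
      from rdet_upd_span[OF this] have "rdet (v(a i := z)) = rdet (v(a i := 0))" by simp
      also have "\<dots> = 0" using rdet_upd_scale[of v "a i" 0 0] by simp
      finally show ?thesis .
    qed
    \<comment> \<open>as a function of the vector in place \<open>a i\<close>, the determinant is linear and vanishes on the span of the facet\<close>
    obtain g where g: "\<And>x. rdet (v(a i := x)) = x \<bullet> g" "\<And>z. z \<in> ?F \<Longrightarrow> g \<bullet> z = 0" "norm g \<le> c"
    proof (rule bounded_functional_orthogonal[OF linear_rdet_upd subspace_span vanish])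
      show "\<bar>rdet (v(a i := x))\<bar> \<le> c * infdist x ?F" for x using rdet_le[of "v(a i := x)"] pDupd by simp
    qed (use c in auto)
    have vai: "v(a i := v a') = v" if "a' = a i" for a' using that by simp
    have key: "infdist x ?L \<le> infdist x ?F * (sqrt (2 * eta v) + sqrt (2 * eta (v(a i := x))))" for x
    proof (rule infdist_extended_subspace_le[OF subspace_span subspace_span _ _ g(2,3) c])
      show "?F \<subseteq> ?L" by (intro span_mono) (auto simp: C_def)
      show "v (a i) \<in> ?L" using a[OF i] by (intro span_base) auto
      have "D i v = G i v * infdist (v (a i)) ?F" using Dupd[OF i, of v "v (a i)"] by simp
      then show "0 < infdist (v (a i)) ?F" using Dp[OF i] by (simp add: zero_less_mult_iff)
      show "\<bar>v (a i) \<bullet> g\<bar> = (1 - eta v) * (c * infdist (v (a i)) ?F)"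
        using rdet_eta[of v] pDupd[of "v (a i)"] g(1)[of "v (a i)"] by simp
      show "\<bar>x \<bullet> g\<bar> = (1 - eta (v(a i := x))) * (c * infdist x ?F)"
        using rdet_eta[of "v(a i := x)"] pDupd[of x] g(1)[of x] by simp
    qed
    have e2: "infdist x ?F * sqrt (2 * eta (v(a i := x)))
        = sqrt 2 / G i v * (D i (v(a i := x)) * sqrt (eta (v(a i := x))))" for x
      using Dp(2)[OF i] by (simp add: Dupd[OF i] real_sqrt_mult)
    have i2: "integrable (\<mu> i) (\<lambda>x. infdist x ?F * sqrt (2 * eta (v(a i := x))))"
      unfolding e2 using iY[OF i, of v] by simp
    have i1: "integrable (\<mu> i) (\<lambda>x. infdist x ?F * sqrt (2 * eta v))"
      using iInf[OF i subspace_span] by simp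
    have "(\<integral>x. infdist x ?L \<partial>\<mu> i)
        \<le> (\<integral>x. infdist x ?F * sqrt (2 * eta v) + infdist x ?F * sqrt (2 * eta (v(a i := x))) \<partial>\<mu> i)"
      using iInf[OF i subspace_span] i1 i2 key by (intro integral_mono) (auto simp: algebra_simps)
    also have "\<dots> = (\<integral>x. infdist x ?F \<partial>\<mu> i) * sqrt (2 * eta v) + sqrt 2 / G i v * Y i v"
      using i1 i2 by (simp add: e2 Y_def)
    also have "(\<integral>x. infdist x ?F \<partial>\<mu> i) = H i v / G i v" using H_eq[OF i, of v] Dp(2)[OF i] by simp
    finally show ?thesis by (simp add: U_def)
  qed
  show ?thesis
  proof (rule that[of v])
    show "0 < pvol (B i) v" if "i \<in> I" for i using Dp(1)[OF that] by (simp add: D_def)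
    have "eta v \<le> real (card J + 1) * (\<epsilon> * \<beta>)" using v(3)[of None] by (simp add: J_def ff_def Kf_def)
    then show "1 - \<bar>rdet v\<bar> / (\<Prod>i\<in>I. pvol (B i) v) \<le> real (card I + 2) * (\<epsilon> * \<beta>)"
      by (simp add: eta_def pD_def D_def cJ)
    fix i and F :: "(real^'n) set"
    assume i: "i \<in> I" and F: "subspace F" "dim F < card (B i)"
    let ?t = "real (card (B i)) * (\<integral>x. infdist x F \<partial>\<mu> i)"
    have "A i \<le> ?t" unfolding A_def using F1[OF i F] ggp[OF i] by (simp add: divide_le_eq mult_ac)
    have "(\<integral>x. infdist x (span (v ` B i)) \<partial>\<mu> i) \<le> real (card J + 1) * Kf (Some i)"
      using dist_le[OF i] v(3)[of "Some i"] i by (simp add: J_def ff_def)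
    also have "\<dots> = real (card I + 2) * (2 * sqrt 2 * A i * sqrt (\<epsilon> * \<beta>))"
      by (simp add: Kf_def cJ)
    also have "\<dots> \<le> real (card I + 2) * (2 * sqrt 2 * ?t * sqrt (\<epsilon> * \<beta>))"
      by (intro mult_left_mono mult_right_mono \<open>A i \<le> ?t\<close>) (use \<epsilon> \<beta>0 in auto)
    finally show "(\<integral>x. infdist x (span (v ` B i)) \<partial>\<mu> i) \<le> real (card I + 2) * (2 * sqrt 2 * ?t * sqrt (\<epsilon> * \<beta>))" .
  qed
qed

section \<open>From zonoids to random frames\<close>

text \<open>If \<open>\<rho>\<close> has mass \<open>c\<close>, divide it by \<open>c\<close> and stretch all vectors by \<open>c\<close>.\<close>

lemma zonoid_generator:
  fixes Z :: "(real^'n) set"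
  assumes "zonoid Z" obtains \<mu> where "generates \<mu> Z"
proof -
  obtain \<rho> :: "(real^'n) measure" where \<rho>: "finite_measure \<rho>"
      "sets \<rho> = sets (restrict_space borel (sphere 0 1))" "emeasure \<rho> (sphere 0 1) \<noteq> 0"
      "\<And>u. support_function Z u = (\<integral>v. \<bar>u \<bullet> v\<bar> \<partial>\<rho>)"
    using assms by (auto simp: zonoid_def)
  interpret finite_measure \<rho> by (rule \<rho>)
  have sp: "space \<rho> = sphere 0 1"
    using sets_eq_imp_space_eq[OF \<rho>(2)] by (simp add: space_restrict_space)
  define c where "c = measure \<rho> (space \<rho>)"
  have c: "0 < c" "emeasure \<rho> (space \<rho>) = ennreal c"
    using \<rho>(3) by (auto simp: c_def sp emeasure_eq_measure less_le)
  have mb: "f \<in> borel_measurable \<rho>" if "f \<in> borel_measurable borel" for f :: "real^'n \<Rightarrow> 'b::topological_space"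
    using measurable_restrict_space1[OF that] \<rho>(2) by (simp cong: measurable_cong_sets)
  have ms: "(\<lambda>v. c *\<^sub>R v) \<in> borel_measurable \<rho>" by (rule mb) simp
  define \<mu> where "\<mu> = distr (density \<rho> (\<lambda>_. ennreal (1 / c))) borel (\<lambda>v. c *\<^sub>R v)"
  have m2: "(\<lambda>v. c *\<^sub>R v) \<in> borel_measurable (density \<rho> (\<lambda>_. ennreal (1 / c)))" using ms by simp
  have E: "(\<integral>v. f v \<partial>\<mu>) = (1 / c) * (\<integral>v. f (c *\<^sub>R v) \<partial>\<rho>)" if f: "f \<in> borel_measurable borel" for f :: "real^'n \<Rightarrow> real"
  proof -
    have "(\<integral>v. f v \<partial>\<mu>) = (\<integral>v. f (c *\<^sub>R v) \<partial>density \<rho> (\<lambda>_. ennreal (1 / c)))"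
      unfolding \<mu>_def by (rule integral_distr[OF m2 f])
    also have "\<dots> = (\<integral>v. (1 / c) *\<^sub>R f (c *\<^sub>R v) \<partial>\<rho>)"
      using c measurable_compose[OF ms f] by (intro integral_density) auto
    finally show ?thesis by simp
  qed
  have "prob_space \<mu>"
  proof (rule prob_spaceI)
    have "emeasure \<mu> (space \<mu>) = emeasure (density \<rho> (\<lambda>_. ennreal (1 / c))) (space \<rho>)"
      unfolding \<mu>_def using m2 by (subst emeasure_distr) auto
    also have "\<dots> = ennreal (1 / c) * emeasure \<rho> (space \<rho>)" by (rule emeasure_density_const) simp
    also have "\<dots> = 1" using c by (simp add: ennreal_mult[symmetric])
    finally show "emeasure \<mu> (space \<mu>) = 1" .
  qed
  moreover have "integrable \<mu> norm"
  proof -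
    have mn: "norm \<in> borel_measurable \<rho>" by (rule mb) simp
    have "integrable \<rho> (\<lambda>v. (1 / c) *\<^sub>R norm (c *\<^sub>R v))"
      by (rule integrable_const_bound[where B = 1])
        (use c sp mn in \<open>auto intro!: AE_I2\<close>)
    then have "integrable (density \<rho> (\<lambda>_. ennreal (1 / c))) (\<lambda>v. norm (c *\<^sub>R v))"
      using c mn by (subst integrable_density) auto
    then show ?thesis unfolding \<mu>_def using m2 by (subst integrable_distr_eq) auto
  qed
  moreover have "support_function Z u = (\<integral>v. \<bar>u \<bullet> v\<bar> \<partial>\<mu>)" for u
    using c by (simp add: E \<rho>(4) abs_mult)
  ultimately have "generates \<mu> Z" by (simp add: generates_def gen_measure_def \<mu>_def)
  then show ?thesis by (rule that)
qed

text \<open>The residual \<open>y\<close> of \<open>x \<in> Z\<close> modulo \<open>L\<close> satisfies \<open>(norm y)\<^sup>2 = x \<bullet> y\<close>. This is at most the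
  support function at \<open>y\<close>, that is, the mean of \<open>\<bar>y \<bullet> v\<bar> \<le> norm y * infdist v L\<close>.\<close>

lemma subset_orth_proj_plus_ball:
  fixes Z L :: "(real^'n) set"
  assumes Z: "compact Z" and gen: "generates \<mu> Z" and L: "subspace L"
    and t: "(\<integral>v. infdist v L \<partial>\<mu>) \<le> t"
  shows "Z \<subseteq> orth_proj L ` Z + (\<lambda>x. t *\<^sub>R x) ` cball 0 1"
proof
  fix x assume x: "x \<in> Z"
  have g: "gen_measure \<mu>" using gen by (simp add: generates_def)
  obtain p where p: "p \<in> L" "\<And>z. z \<in> L \<Longrightarrow> (x - p) \<bullet> z = 0"
    using subspace_residual[OF L, of x] by metis
  have proj: "orth_proj L x = p" using p by (intro orth_proj_eqI L) (auto simp: orthogonal_def)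
  define y where "y = x - p"
  have "(norm y)\<^sup>2 = x \<bullet> y"
    using p(2)[OF p(1)] by (simp add: y_def power2_norm_eq_inner inner_diff_left inner_diff_right inner_commute)
  also have "\<dots> \<le> support_function Z y" by (rule inner_le_support[OF Z x])
  also have "\<dots> = (\<integral>v. \<bar>y \<bullet> v\<bar> \<partial>\<mu>)" using gen by (simp add: generates_def)
  also have "\<dots> \<le> (\<integral>v. norm y * infdist v L \<partial>\<mu>)"
  proof (rule integral_mono)
    show "integrable \<mu> (\<lambda>v. \<bar>y \<bullet> v\<bar>)" by (rule gen_integrable_inner[OF g])
    show "integrable \<mu> (\<lambda>v. norm y * infdist v L)" using gen_integrable_infdist[OF g L] by simp
    show "\<bar>y \<bullet> v\<bar> \<le> norm y * infdist v L" for v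
      using abs_inner_le_infdist[OF L, of y v] p(2) by (simp add: y_def inner_commute)
  qed
  also have "\<dots> \<le> norm y * t" using t by (simp add: mult_left_mono)
  finally have "norm y * norm y \<le> norm y * t" by (simp add: power2_eq_square)
  moreover have t0: "0 \<le> t" using t by (rule order_trans[rotated]) (simp add: infdist_nonneg)
  ultimately have ny: "norm y \<le> t" by (cases "norm y = 0") auto
  have "y \<in> (\<lambda>x. t *\<^sub>R x) ` cball 0 1"
  proof (cases "t = 0")
    case True then show ?thesis using ny by (auto intro: image_eqI[of _ _ 0])
  next
    case False
    then have "y = t *\<^sub>R ((1 / t) *\<^sub>R y)" "(1 / t) *\<^sub>R y \<in> cball 0 1"
      using ny t0 by (auto simp: divide_le_eq)
    then show ?thesis by (rule image_eqI)
  qed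
  moreover have "x = p + y" by (simp add: y_def)
  moreover have "p \<in> orth_proj L ` Z" using proj x by auto
  ultimately show "x \<in> orth_proj L ` Z + (\<lambda>x. t *\<^sub>R x) ` cball 0 1"
    by (auto simp: set_plus_def)
qed

text \<open>Exchange the blocks one after the other; each exchange divides the determinant by the volume of the
  block, since the orthonormal frame has volume one and the same span.\<close>

lemma abs_rdet_orthonormal_blocks:
  fixes u v :: "'n::finite \<Rightarrow> real^'n" and B :: "'i \<Rightarrow> 'n set"
  assumes I: "finite I" "disjoint_family_on B I" "(\<Union>i\<in>I. B i) = UNIV"
    and on: "\<And>i k l. i \<in> I \<Longrightarrow> k \<in> B i \<Longrightarrow> l \<in> B i \<Longrightarrow> u k \<bullet> u l = (if k = l then 1 else 0)"
    and sp: "\<And>i. i \<in> I \<Longrightarrow> span (u ` B i) = span (v ` B i)"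
  shows "\<bar>rdet u\<bar> * (\<Prod>i\<in>I. pvol (B i) v) = \<bar>rdet v\<bar>"
proof -
  define h where "h J k = (if k \<in> (\<Union>i\<in>J. B i) then u k else v k)" for J k
  have "\<bar>rdet (h J)\<bar> * (\<Prod>i\<in>J. pvol (B i) v) = \<bar>rdet v\<bar>" if "finite J" "J \<subseteq> I" for J
    using that
  proof (induction J rule: finite_induct)
    case empty then show ?case by (simp add: h_def)
  next
    case (insert i J)
    have dis: "B i \<inter> (\<Union>j\<in>J. B j) = {}"
      using insert I(2) by (fastforce simp: disjoint_family_on_def)
    have hv: "h J k = v k" if "k \<in> B i" for k using dis that by (auto simp: h_def)
    have hu: "h (insert i J) k = u k" if "k \<in> B i" for k using that by (simp add: h_def)
    have eq: "h (insert i J) k = h J k" if "k \<in> - B i" for k using that by (simp add: h_def)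
    have i: "i \<in> I" using insert by simp
    have im: "h J ` B i = v ` B i" "h (insert i J) ` B i = u ` B i"
      using hv hu by (intro image_cong; simp)+
    have "pvol (B i \<union> - B i) (h (insert i J)) * pvol (B i) (h J)
        = pvol (B i \<union> - B i) (h J) * pvol (B i) (h (insert i J))"
      using sp[OF i] by (intro pvol_span_ratio) (auto simp: im eq)
    moreover have "pvol (B i) (h J) = pvol (B i) v" by (rule pvol_cong) (rule hv)
    moreover have "pvol (B i) (h (insert i J)) = 1"
      by (rule orthonormal_on_pvol) (simp add: hu on[OF i])
    ultimately have "\<bar>rdet (h (insert i J))\<bar> * pvol (B i) v = \<bar>rdet (h J)\<bar>"
      by (simp add: pvol_UNIV)
    then show ?case using insert by (simp add: mult.assoc[symmetric])
  qed
  from this[OF I(1) order_refl] show ?thesis using I(3) by (simp add: h_def)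
qed

lemma integral_pvol_block:
  fixes b :: "'n::finite \<Rightarrow> 'i" and \<mu> :: "'i \<Rightarrow> (real^'n) measure"
  assumes gen: "\<And>k. gen_measure (\<mu> (b k))" "gen_measure (\<mu> i)"
  shows "(\<integral>v. pvol {k. b k = i} v \<partial>PiM UNIV (\<lambda>k. \<mu> (b k)))
       = (\<integral>v. pvol {k. b k = i} v \<partial>PiM UNIV (\<lambda>_. \<mu> i))"
proof -
  let ?A = "{k. b k = i}" and ?N = "\<lambda>k. \<mu> (b k)" and ?M = "\<lambda>_::'n. \<mu> i"
  have e: "(\<integral>\<^sup>+v. ennreal (pvol ?A v) \<partial>PiM UNIV ?N) = (\<integral>\<^sup>+v. ennreal (pvol ?A v) \<partial>PiM UNIV ?M)"
  proof (rule nn_integral_PiM_marginal[where A = ?A])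
    show "prob_space (?M k)" "prob_space (?N k)" for k using gen by (auto intro: gen_measureD)
    show "(\<lambda>v. ennreal (pvol ?A v)) \<in> borel_measurable (PiM UNIV ?N)"
      using gen_measurable_pvol[where \<mu> = ?N, OF gen(1)] by simp
    show "ennreal (pvol ?A v) = ennreal (pvol ?A w)" if "\<And>k. k \<in> ?A \<Longrightarrow> v k = w k" for v w
      by (rule arg_cong[where f = ennreal], rule pvol_cong) (rule that)
  qed simp
  have "integrable (PiM UNIV ?N) (\<lambda>v. pvol ?A v)" by (rule gen_integrable_pvol) (rule gen)
  moreover have "integrable (PiM UNIV ?M) (\<lambda>v. pvol ?A v)" by (rule gen_integrable_pvol) (rule gen)
  ultimately have "ennreal (\<integral>v. pvol ?A v \<partial>PiM UNIV ?N) = ennreal (\<integral>v. pvol ?A v \<partial>PiM UNIV ?M)"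
    using e by (simp add: nn_integral_eq_integral pvol_nonneg)
  then show ?thesis by (subst (asm) ennreal_inj) (auto intro!: integral_nonneg simp: pvol_nonneg)
qed

lemma block_indexing:
  fixes \<alpha> :: "nat \<Rightarrow> nat" and Z :: "nat \<Rightarrow> 'a"
  assumes "(\<Sum>i=1..m. \<alpha> i) = CARD('n::finite)"
  obtains idx :: "'n::finite \<Rightarrow> nat" and b :: "'n \<Rightarrow> nat" where "bij_betw idx UNIV {..<CARD('n::finite)}"
    "\<And>k. b k \<in> {1..m}" "\<And>i. i \<in> {1..m} \<Longrightarrow> card {k. b k = i} = \<alpha> i"
    "\<And>k. concat (map (\<lambda>i. replicate (\<alpha> i) (Z i)) [1..<Suc m]) ! idx k = Z (b k)"
proof -
  define bl where "bl = concat (map (\<lambda>i. replicate (\<alpha> i) i) [1..<Suc m])"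
  have len: "length bl = CARD('n)"
  proof -
    have "length bl = sum_list (map \<alpha> [1..<Suc m])" by (simp add: bl_def length_concat o_def del: upt_Suc)
    also have "\<dots> = sum \<alpha> (set [1..<Suc m])" by (rule interv_sum_list_conv_sum_set_nat)
    also have "set [1..<Suc m] = {1..m}" by auto
    finally show ?thesis using assms by simp
  qed
  have count: "card {j. j < length bl \<and> bl ! j = i} = \<alpha> i" if "i \<in> {1..m}" for i
  proof -
    have "card {j. j < length bl \<and> bl ! j = i} = length (filter (\<lambda>j. j = i) bl)"
      by (simp add: length_filter_conv_card)
    also have "\<dots> = sum_list (map (\<lambda>j. if j = i then \<alpha> j else 0) [1..<Suc m])"
      unfolding bl_def filter_concat length_concat map_map
      by (rule arg_cong[where f = sum_list], rule map_cong) auto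
    also have "\<dots> = sum (\<lambda>j. if j = i then \<alpha> j else 0) (set [1..<Suc m])"
      by (rule interv_sum_list_conv_sum_set_nat)
    also have "\<dots> = \<alpha> i" using that by (simp add: sum.delta)
    finally show ?thesis .
  qed
  obtain idx :: "'n \<Rightarrow> nat" where idx: "bij_betw idx UNIV {0..<CARD('n)}"
    using ex_bij_betw_finite_nat[of "UNIV :: 'n set"] by auto
  have lt: "idx k < length bl" for k using bij_betwE[OF idx] len by auto
  have Z: "concat (map (\<lambda>i. replicate (\<alpha> i) (Z i)) [1..<Suc m]) = map Z bl"
    by (simp add: bl_def map_concat o_def del: upt_Suc)
  show ?thesis
  proof (rule that[of idx "\<lambda>k. bl ! idx k"])
    show "bij_betw idx UNIV {..<CARD('n)}" using idx by (simp add: lessThan_atLeast0)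
    show "bl ! idx k \<in> {1..m}" for k
      using nth_mem[OF lt[of k]] by (auto simp: bl_def simp del: upt_Suc)
    show "concat (map (\<lambda>i. replicate (\<alpha> i) (Z i)) [1..<Suc m]) ! idx k = Z (bl ! idx k)" for k
      unfolding Z using lt[of k] by simp
    show "card {k. bl ! idx k = i} = \<alpha> i" if "i \<in> {1..m}" for i
    proof -
      have "idx ` {k. bl ! idx k = i} = {j. j < length bl \<and> bl ! j = i}"
      proof
        show "{j. j < length bl \<and> bl ! j = i} \<subseteq> idx ` {k. bl ! idx k = i}"
        proof
          fix j assume j: "j \<in> {j. j < length bl \<and> bl ! j = i}"
          then have "j \<in> idx ` UNIV" using idx len by (simp add: bij_betw_def)
          then show "j \<in> idx ` {k. bl ! idx k = i}" using j by auto
        qed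
      qed (use lt in auto)
      moreover have "inj_on idx {k. bl ! idx k = i}"
        using idx by (auto simp: bij_betw_def intro: inj_on_subset)
      ultimately show ?thesis using count[OF that] card_image by metis
    qed
  qed
qed

section \<open>Estimates of the constants\<close>

text \<open>The product of the block sizes is at most \<open>2 ^ (n - m)\<close>, as \<open>2 * a \<le> 2 ^ a\<close>, and
  \<open>(m + 2)\<^sup>2 \<le> 4 * 2 ^ m\<close>.\<close>

lemma block_constant_le:
  fixes \<alpha> :: "nat \<Rightarrow> nat"
  assumes m: "2 \<le> m" and \<alpha>: "\<And>i. i \<in> {1..m} \<Longrightarrow> 1 \<le> \<alpha> i" and n: "(\<Sum>i=1..m. \<alpha> i) = n"
  shows "real (m + 2) * sqrt (\<Prod>i=1..m. real (\<alpha> i)) \<le> 2 * 2 powr (real n / 2)"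
proof -
  let ?\<beta> = "\<Prod>i=1..m. real (\<alpha> i)"
  have two: "2 * a \<le> 2 ^ a" if "1 \<le> a" for a :: nat
    using that by (induction a rule: dec_induct) auto
  have sq: "(m + 2)\<^sup>2 \<le> 4 * 2 ^ m"
    using m by (induction m rule: dec_induct) (auto simp: power2_eq_square)
  have "?\<beta> * 2 ^ m = (\<Prod>i=1..m. 2 * real (\<alpha> i))" by (simp add: prod.distrib)
  also have "\<dots> \<le> (\<Prod>i=1..m. 2 ^ \<alpha> i)"
  proof (intro prod_mono conjI)
    fix i assume "i \<in> {1..m}"
    then have "real (2 * \<alpha> i) \<le> real (2 ^ \<alpha> i)" using two \<alpha> of_nat_le_iff by blast
    then show "2 * real (\<alpha> i) \<le> 2 ^ \<alpha> i" by simp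
  qed simp
  also have "\<dots> = 2 ^ n" using n by (simp add: power_sum[symmetric])
  finally have b: "?\<beta> * 2 ^ m \<le> 2 ^ n" .
  have b0: "0 \<le> ?\<beta>" by (intro prod_nonneg) simp
  have "real ((m + 2)\<^sup>2) \<le> real (4 * 2 ^ m)" using sq of_nat_le_iff by blast
  then have "(real (m + 2))\<^sup>2 * ?\<beta> \<le> (4 * 2 ^ m) * ?\<beta>" using b0 by (intro mult_right_mono) auto
  also have "\<dots> \<le> 4 * 2 ^ n" using b by (simp add: mult_ac)
  also have "\<dots> = (2 * 2 powr (real n / 2))\<^sup>2"
    by (simp add: power_mult_distrib power2_eq_square powr_add[symmetric] powr_realpow)
  also have "(real (m + 2))\<^sup>2 * ?\<beta> = (real (m + 2) * sqrt ?\<beta>)\<^sup>2"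
    using b0 by (simp only: power_mult_distrib real_sqrt_pow2)
  finally show ?thesis by (rule power2_le_imp_le) simp
qed

lemma dimension_constant_le:
  assumes "2 \<le> n" "a + 1 \<le> n"
  shows "4 * sqrt 2 * (real a)\<^sup>2 * real n \<le> real n powr (9/2)"
proof -
  have "32 * a ^ 4 \<le> n ^ 7"
  proof (cases "4 \<le> n")
    case True
    have "(32::nat) \<le> 4 ^ 3" by simp
    also have "\<dots> \<le> n ^ 3" using True by (rule power_mono) simp
    finally have "32 * a ^ 4 \<le> n ^ 3 * n ^ 4" using assms(2) by (intro mult_le_mono power_mono) auto
    then show ?thesis by (simp add: power_add[symmetric])
  next
    case False
    then have "n = 2 \<and> a \<le> 1 \<or> n = 3 \<and> a \<le> 2" using assms by auto
    then show ?thesis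
    proof
      assume h: "n = 2 \<and> a \<le> 1"
      then have "a ^ 4 \<le> 1 ^ 4" by (intro power_mono) auto
      then show ?thesis using h by simp
    next
      assume h: "n = 3 \<and> a \<le> 2"
      then have "a ^ 4 \<le> 2 ^ 4" by (intro power_mono) auto
      then show ?thesis using h by simp
    qed
  qed
  then have "real (32 * a ^ 4) \<le> real (n ^ 7)" using of_nat_le_iff by blast
  then have "32 * real a ^ 4 * (real n)\<^sup>2 \<le> real n ^ 7 * (real n)\<^sup>2" by (intro mult_right_mono) auto
  moreover have "(4 * sqrt 2 * (real a)\<^sup>2 * real n)\<^sup>2 = 32 * real a ^ 4 * (real n)\<^sup>2"
    by (simp add: power_mult_distrib)
  moreover have "(real n powr (9/2))\<^sup>2 = real n ^ 7 * (real n)\<^sup>2"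
  proof -
    have "(real n powr (9/2))\<^sup>2 = real n powr real 9" by (simp add: power2_eq_square powr_add[symmetric])
    also have "\<dots> = real n ^ 9" using assms by (intro powr_realpow) auto
    finally show ?thesis by (simp add: power_add[symmetric])
  qed
  ultimately have "(4 * sqrt 2 * (real a)\<^sup>2 * real n)\<^sup>2 \<le> (real n powr (9/2))\<^sup>2" by simp
  then show ?thesis by (rule power2_le_imp_le) simp
qed

section \<open>Stability of the product inequality\<close>

theorem theorem1p6:
  fixes \<epsilon> :: real and m :: nat
    and Z :: "nat \<Rightarrow> (real^'n) set" and \<alpha> :: "nat \<Rightarrow> nat"
  assumes "0 \<le> \<epsilon>" "\<epsilon> \<le> 1"
    and "2 \<le> m" "m \<le> CARD('n)"
    and "\<And>i. i \<in> {1..m} \<Longrightarrow> zonoid (Z i)"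
    and "\<And>i. i \<in> {1..m} \<Longrightarrow> 1 \<le> \<alpha> i"
    and "(\<Sum>i=1..m. \<alpha> i) = CARD('n)"
    and "0 < (\<Prod>i=1..m. intrinsic_volume (\<alpha> i) (Z i))"
    and "(\<Prod>i=1..m. intrinsic_volume (\<alpha> i) (Z i))
           \<le> (1 + \<epsilon>) * (fact CARD('n) / (\<Prod>i=1..m. fact (\<alpha> i)))
              * mixed_volume (concat (map (\<lambda>i. replicate (\<alpha> i) (Z i)) [1..<Suc m]))"
  shows "\<exists>L :: nat \<Rightarrow> (real^'n) set.
           (\<forall>i\<in>{1..m}. subspace (L i) \<and> dim (L i) = \<alpha> i) \<and>
           bracket m L \<ge> 1 - real CARD('n) ^ 10 * 2 powr (real CARD('n) / 2) * sqrt \<epsilon> \<and>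
           (\<forall>i\<in>{1..m}.
              Z i \<subseteq> orth_proj (L i) ` Z i
                + (\<lambda>x. (real CARD('n) powr (9/2) * 2 powr (real CARD('n) / 2)
                          * inradius (\<alpha> i) (Z i) * sqrt \<epsilon>) *\<^sub>R x) ` cball 0 1)"
proof -
  define n where "n = CARD('n)"
  define s where "s = 2 powr (real n / 2)"
  define I where "I = {1..m}"
  note \<epsilon> = assms(1) and \<alpha>1 = assms(6)[folded I_def]
  have I: "finite I" "card I = m" by (simp_all add: I_def)
  have body: "convex_body (Z i)" if "i \<in> I" for i using assms(5) that by (simp add: zonoid_def I_def)
  have "\<exists>\<nu>. generates \<nu> (Z i)" if "i \<in> I" for i
    using zonoid_generator[of "Z i"] assms(5)[of i] that unfolding I_def by blast
  then obtain \<mu> where gen: "\<And>i. i \<in> I \<Longrightarrow> generates (\<mu> i) (Z i)" by metis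
  have gm: "gen_measure (\<mu> i)" if "i \<in> I" for i using gen[OF that] by (simp add: generates_def)
  obtain idx b :: "'n \<Rightarrow> nat" where idx: "bij_betw idx UNIV {..<CARD('n)}"
    and b: "\<And>k. b k \<in> I" and cB: "\<And>i. i \<in> I \<Longrightarrow> card {k. b k = i} = \<alpha> i"
    and Ks: "\<And>k. concat (map (\<lambda>i. replicate (\<alpha> i) (Z i)) [1..<Suc m]) ! idx k = Z (b k)"
    using block_indexing[OF assms(7), of Z] unfolding I_def by blast
  define B where "B i = {k. b k = i}" for i
  have cB': "card (B i) = \<alpha> i" if "i \<in> I" for i using cB[OF that] by (simp add: B_def)
  have Bne: "B i \<noteq> {}" if "i \<in> I" for i using cB'[OF that] \<alpha>1[OF that] by auto
  define R where "R = PiM UNIV (\<lambda>k. \<mu> (b k))"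
  define E where "E i = (\<integral>v. pvol (B i) v \<partial>R)" for i
  define D where "D = (\<integral>v. \<bar>rdet v\<bar> \<partial>R)"
  have MV: "mixed_volume (concat (map (\<lambda>i. replicate (\<alpha> i) (Z i)) [1..<Suc m])) = 2 ^ n / fact n * D"
    unfolding n_def D_def R_def using idx by (rule mixed_volume_zonoids) (simp_all only: Ks b body gen)
  have IV: "intrinsic_volume (\<alpha> i) (Z i) = 2 ^ \<alpha> i / fact (\<alpha> i) * E i" if i: "i \<in> I" for i
    using intrinsic_volume_zonoid[OF body[OF i] gen[OF i], of "B i"]
      integral_pvol_block[of \<mu> b i] gm i b cB'[OF i] by (simp add: E_def R_def B_def)
  have "(\<Prod>i\<in>I. intrinsic_volume (\<alpha> i) (Z i)) = (\<Prod>i\<in>I. 2 ^ \<alpha> i / fact (\<alpha> i) * E i)"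
    by (rule prod.cong) (simp_all add: IV)
  also have "\<dots> = 2 ^ n / (\<Prod>i\<in>I. fact (\<alpha> i)) * (\<Prod>i\<in>I. E i)"
    using assms(7) by (simp add: prod.distrib prod_dividef power_sum[symmetric] n_def I_def)
  finally have PV: "(\<Prod>i\<in>I. intrinsic_volume (\<alpha> i) (Z i)) = 2 ^ n / (\<Prod>i\<in>I. fact (\<alpha> i)) * (\<Prod>i\<in>I. E i)" .
  define q where "q = 2 ^ n / (\<Prod>i\<in>I. fact (\<alpha> i) :: real)"
  have q: "0 < q" unfolding q_def by (intro divide_pos_pos prod_pos) auto
  have "q * (\<Prod>i\<in>I. E i) \<le> (1 + \<epsilon>) * (fact n / (\<Prod>i\<in>I. fact (\<alpha> i))) * (2 ^ n / fact n * D)"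
    using assms(9) unfolding MV I_def[symmetric] PV q_def n_def[symmetric] .
  also have "\<dots> = q * ((1 + \<epsilon>) * D)" by (simp add: q_def)
  finally have hyp: "(\<Prod>i\<in>I. E i) \<le> (1 + \<epsilon>) * D" using q by simp
  have "0 < q * (\<Prod>i\<in>I. E i)" using assms(8) unfolding I_def[symmetric] PV q_def .
  then have "0 < (\<Prod>i\<in>I. E i)" using q by (simp add: zero_less_mult_iff)
  then have "0 < (1 + \<epsilon>) * D" using hyp by linarith
  then have D0: "0 < D" using \<epsilon> by (simp add: zero_less_mult_iff)
  define \<beta> where "\<beta> = (\<Prod>i\<in>I. real (\<alpha> i))"
  have \<beta>0: "0 \<le> \<beta>" unfolding \<beta>_def by (intro prod_nonneg) simp
  have \<beta>_eq: "(\<Prod>i\<in>I. real (card (B i))) = \<beta>"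
    unfolding \<beta>_def by (rule prod.cong) (simp_all add: cB')
  have c\<beta>: "real (m + 2) * sqrt \<beta> \<le> 2 * s"
    unfolding \<beta>_def s_def n_def I_def using assms(3,6,7) by (rule block_constant_le)
  obtain v where pos: "\<And>i. i \<in> I \<Longrightarrow> 0 < pvol (B i) v"
    and dev: "1 - \<bar>rdet v\<bar> / (\<Prod>i\<in>I. pvol (B i) v) \<le> real (m + 2) * (\<epsilon> * \<beta>)"
    and dist: "\<And>i F. i \<in> I \<Longrightarrow> subspace F \<Longrightarrow> dim F < card (B i) \<Longrightarrow>
      (\<integral>x. infdist x (span (v ` B i)) \<partial>\<mu> i)
        \<le> real (m + 2) * (2 * sqrt 2 * (real (card (B i)) * (\<integral>x. infdist x F \<partial>\<mu> i)) * sqrt (\<epsilon> * \<beta>))"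
  proof (rule good_frame_exists[of I b \<mu> \<epsilon>, folded B_def R_def, unfolded \<beta>_eq I(2)])
    show "b k \<in> I" for k by (rule b)
    show "B i \<noteq> {}" "gen_measure (\<mu> i)" if "i \<in> I" for i using Bne[OF that] gm[OF that] .
    show "0 < (\<integral>v. \<bar>rdet v\<bar> \<partial>R)" using D0 unfolding D_def .
    show "(\<Prod>i\<in>I. \<integral>v. pvol (B i) v \<partial>R) \<le> (1 + \<epsilon>) * (\<integral>v. \<bar>rdet v\<bar> \<partial>R)"
      using hyp unfolding D_def E_def .
  qed (rule I(1) \<epsilon> that; blast)+
  define L where "L i = span (v ` B i)" for i
  have dimL: "dim (L i) = \<alpha> i" if "i \<in> I" for i
    using pvol_pos_independent(3)[OF pos[OF that]] cB'[OF that] by (simp add: L_def)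
  have "\<exists>u. (\<forall>k\<in>B i. \<forall>l\<in>B i. u k \<bullet> u l = (if k = l then 1 else 0)) \<and> span (u ` B i) = L i" if "i \<in> I" for i
    unfolding L_def by (rule orthonormal_reframe[OF pos[OF that]]) blast
  then obtain f where f: "\<And>i k l. i \<in> I \<Longrightarrow> k \<in> B i \<Longrightarrow> l \<in> B i \<Longrightarrow> f i k \<bullet> f i l = (if k = l then 1 else 0)"
      "\<And>i. i \<in> I \<Longrightarrow> span (f i ` B i) = L i"
    by metis
  define u where "u k = f (b k) k" for k
  have uB: "u k = f i k" if "k \<in> B i" for i k using that by (simp add: u_def B_def)
  have imB: "u ` B i = f i ` B i" for i by (rule image_cong) (simp_all add: uB)
  have "adapted_frame m L b u"
    unfolding adapted_frame_def I_def[symmetric] B_def[symmetric]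
  proof (intro conjI allI ballI impI)
    show "u k \<bullet> u l = (if k = l then 1 else 0)" if "b k = b l" for k l
      using f(1)[OF b[of k], of k l] that by (simp add: u_def B_def)
  qed (simp_all add: b imB f(2))
  then have br: "bracket m L = \<bar>rdet u\<bar>" by (rule bracket_eq)
  have "\<bar>rdet u\<bar> * (\<Prod>i\<in>I. pvol (B i) v) = \<bar>rdet v\<bar>"
  proof (rule abs_rdet_orthonormal_blocks[OF I(1)])
    show "disjoint_family_on B I" by (auto simp: disjoint_family_on_def B_def)
    show "(\<Union>i\<in>I. B i) = UNIV" using b by (auto simp: B_def)
    show "u k \<bullet> u l = (if k = l then 1 else 0)" if "i \<in> I" "k \<in> B i" "l \<in> B i" for i k l
      using f(1)[OF that] by (simp add: uB[OF that(2)] uB[OF that(3)])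
    show "span (u ` B i) = span (v ` B i)" if "i \<in> I" for i using f(2)[OF that] by (simp add: imB L_def)
  qed
  moreover have "0 < (\<Prod>i\<in>I. pvol (B i) v)" using pos by (intro prod_pos) auto
  ultimately have rd: "\<bar>rdet u\<bar> = \<bar>rdet v\<bar> / (\<Prod>i\<in>I. pvol (B i) v)" by (simp add: field_simps)
  have n2: "2 \<le> n" using assms(3,4) by (simp add: n_def)
  \<comment> \<open>The gap is at most the square of \<open>2 * s * sqrt \<epsilon>\<close>. If this number exceeds one, the claimed lower bound is negative.\<close>
  have bracket: "1 - real n ^ 10 * s * sqrt \<epsilon> \<le> bracket m L"
  proof -
    define x where "x = 2 * s * sqrt \<epsilon>"
    have x0: "0 \<le> x" using \<epsilon> by (simp add: x_def s_def)
    have "2 \<le> real n" using n2 by simp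
    also have "\<dots> \<le> real n ^ 10" using n2 by (intro self_le_power) auto
    finally have xn: "x \<le> real n ^ 10 * s * sqrt \<epsilon>"
      unfolding x_def using \<epsilon> by (intro mult_right_mono) (auto simp: s_def)
    show ?thesis
    proof (cases "x \<le> 1")
      case True
      have "real (m + 2) * 1 \<le> real (m + 2) * real (m + 2)" by (intro mult_left_mono) auto
      then have "real (m + 2) * (\<epsilon> * \<beta>) \<le> (real (m + 2))\<^sup>2 * (\<epsilon> * \<beta>)"
        using \<epsilon> \<beta>0 by (intro mult_right_mono) (auto simp: power2_eq_square)
      also have "\<dots> = (real (m + 2) * sqrt \<beta> * sqrt \<epsilon>)\<^sup>2"
        using \<epsilon> \<beta>0 by (simp add: power_mult_distrib mult_ac)
      also have "\<dots> \<le> x\<^sup>2"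
        unfolding x_def using c\<beta> \<epsilon> \<beta>0 by (intro power_mono mult_right_mono) auto
      also have "\<dots> \<le> x" using x0 True by (simp add: power2_eq_square mult_left_le)
      finally show ?thesis using dev xn by (simp add: br rd)
    next
      case False
      then have "1 - real n ^ 10 * s * sqrt \<epsilon> \<le> 0" using xn by simp
      also have "0 \<le> bracket m L" by (simp add: br)
      finally show ?thesis .
    qed
  qed
  have incl: "Z i \<subseteq> orth_proj (L i) ` Z i
      + (\<lambda>x. (real n powr (9/2) * s * inradius (\<alpha> i) (Z i) * sqrt \<epsilon>) *\<^sub>R x) ` cball 0 1"
    if i: "i \<in> I" for i
  proof (rule subset_orth_proj_plus_ball[OF _ gen[OF i]])
    show "compact (Z i)" using body[OF i] by (simp add: convex_body_def)
    show "subspace (L i)" by (simp add: L_def)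
    have sym: "support_function (Z i) (- w) = support_function (Z i) w" for w
      using gen[OF i] by (simp add: generates_def)
    let ?r = "inradius (\<alpha> i) (Z i)" and ?a = "real (\<alpha> i)"
    obtain F d where F: "subspace F" "dim F < \<alpha> i" and d: "0 \<le> d" "d \<le> ?a * ?r"
      and sup: "\<And>w. norm w \<le> 1 \<Longrightarrow> (\<And>z. z \<in> F \<Longrightarrow> w \<bullet> z = 0) \<Longrightarrow> support_function (Z i) w \<le> d"
      using subspace_near_symmetric_body[OF body[OF i] sym Bne[OF i]] unfolding cB'[OF i] by blast
    have "0 \<le> ?a * ?r" using d by linarith
    then have r0: "0 \<le> ?r" using \<alpha>1[OF i] by (simp add: zero_le_mult_iff)
    have "(\<integral>x. infdist x F \<partial>\<mu> i) \<le> real CARD('n) * d" by (rule integral_infdist_le[OF gen[OF i] F(1) sup])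
    also have "\<dots> \<le> real n * (?a * ?r)" unfolding n_def using d by (intro mult_left_mono) auto
    finally have iF: "(\<integral>x. infdist x F \<partial>\<mu> i) \<le> real n * (?a * ?r)" .
    have "\<alpha> i + 1 \<le> n"
    proof -
      obtain j where j: "j \<in> I" "j \<noteq> i"
        using that[of 1] that[of 2] assms(3) i by (cases "i = 1") (auto simp: I_def)
      have "\<alpha> i + \<alpha> j = sum \<alpha> {i, j}" using j by simp
      also have "\<dots> \<le> sum \<alpha> I" using i j I by (intro sum_mono2) auto
      also have "\<dots> = n" using assms(7) by (simp add: I_def n_def)
      finally show ?thesis using \<alpha>1[OF j(1)] by simp
    qed
    note cn = dimension_constant_le[OF n2 this]
    have "(\<integral>x. infdist x (L i) \<partial>\<mu> i)
        \<le> real (m + 2) * (2 * sqrt 2 * (?a * (\<integral>x. infdist x F \<partial>\<mu> i)) * sqrt (\<epsilon> * \<beta>))"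
      using dist[OF i F(1)] F(2) unfolding L_def cB'[OF i] by blast
    also have "\<dots> \<le> real (m + 2) * (2 * sqrt 2 * (?a * (real n * (?a * ?r))) * sqrt (\<epsilon> * \<beta>))"
      using iF \<epsilon> \<beta>0 by (intro mult_left_mono mult_right_mono) auto
    also have "\<dots> = (real (m + 2) * sqrt \<beta>) * (2 * sqrt 2 * ?a\<^sup>2 * real n * ?r * sqrt \<epsilon>)"
      by (simp add: real_sqrt_mult power2_eq_square mult_ac)
    also have "\<dots> \<le> (2 * s) * (2 * sqrt 2 * ?a\<^sup>2 * real n * ?r * sqrt \<epsilon>)"
      using c\<beta> r0 \<epsilon> by (intro mult_right_mono) auto
    also have "\<dots> = (4 * sqrt 2 * ?a\<^sup>2 * real n) * (s * ?r * sqrt \<epsilon>)" by simp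
    also have "\<dots> \<le> real n powr (9/2) * (s * ?r * sqrt \<epsilon>)"
      using cn r0 \<epsilon> by (intro mult_right_mono) (auto simp: s_def)
    finally show "(\<integral>x. infdist x (L i) \<partial>\<mu> i) \<le> real n powr (9/2) * s * ?r * sqrt \<epsilon>"
      by (simp add: mult_ac)
  qed
  show ?thesis
    using dimL bracket incl unfolding n_def s_def I_def
    by (intro exI[of _ L] conjI ballI) (auto simp: L_def)
qed

end
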